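(* Let $E$ be a Hermite--Biehler function without real zeroes, let $\mathcal{H}=\mathcal{H}(E)$ be the associated de Branges space, and write $E(x)=|E(x)|e^{-i\varphi(x)}$ for $x\in\mathbb{R}$, where the phase $\varphi:\mathbb{R}\to\mathbb{R}$ is real-analytic. Assume that $\varphi$ is bi-Lipschitz for distances larger than $N\ge 0$, i.e. there exist constants $C_1,C_2>0$ such that $$C_1(x_2-x_1)\le \varphi(x_2)-\varphi(x_1)\le C_2(x_2-x_1)\quad\text{for all } x_1,x_2\in\mathbb{R}\text{ with } x_2-x_1>N.$$ Then there exist a measurable function $m:\mathbb{R}\to(0,\infty)$ with $m\simeq 1$ and a real-entire function $g$ such that $$\mathcal{H}\subseteq e^{g}PW(m).$$ Namely, $m$ and $g$ can be chosen so that, as sets of entire functions, $e^{-g}\mathcal{H}=\{e^{-g}F: F\in\mathcal{H}\}$ is equal to the set of all entire functions $f$ satisfying both $$\int_{-\infty}^\infty |f(x)|^2e^{-2\omega_m(x)}e^{2\theta(x)}\,dx<\infty$$ and: for every $\varepsilon>0$ there exists $C_\varepsilon>0$ such that $|f(z)|e^{-\omega_m(z)}\le C_\varepsilon e^{\varepsilon|\operatorname{Im} z|}$ for all $z\in\mathbb{C}$, where $$\theta(x)=\frac1\pi\int_{|t-x|<N}\frac{\varphi(t)-\varphi(x)}{t-x}\,dt .$$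
   Context: A Hermite--Biehler function is an entire function $E$ with $|E(\bar z)|<|E(z)|$ whenever $\operatorname{Im} z>0$. If $E$ has no real zeroes, then on the real axis $E(x)=|E(x)|e^{-i\varphi(x)}$ with $\varphi$ real-analytic, unique up to adding a constant integer multiple of $2\pi$; $\varphi$ is called the phase of $E$, and it is increasing. For an entire function $f$ put $f^*(z)=\overline{f(\bar z)}$. An entire function is real-entire if it is real on the real line. $\|f\|_2^2=\int_{-\infty}^\infty|f(x)|^2\,dx$. A function analytic in $\mathbb{C}^+=\{\operatorname{Im} z>0\}$ is in the Nevanlinna class if it is the ratio of two bounded analytic functions in $\mathbb{C}^+$; its mean type is $\limsup_{y\to\infty}\frac{\log|f(iy)|}{y}$. $\mathcal{N}_0^+$ is the class of functions in the Nevanlinna class whose mean type is at most $0$. The de Branges space of $E$ is $$\mathcal{H}(E)=\{f\text{ entire}: \|f/E\|_2<\infty \text{ and } f/E,\ f^*/E\in\mathcal{N}_0^+\},$$ with norm $\|f/E\|_2$. For a measurable $m:\mathbb{R}\to(0,\infty)$, $m\simeq 1$ means there are constants $A,B>0$ with $A\le m\le B$. For such $m$, the potential is $$\omega_m(z)=\int_{-\infty}^\infty \log^*\left|1-\frac zt\right|m(t)\,dt,\quad z\in\mathbb{C},$$ where $\log^*|1-z/t|=\log|1-z/t|+(\operatorname{Re} z)/t$ if $|t|>1$ and $\log^*|1-z/t|=\log|1-z/t|$ otherwise. The space $PW(m)$ is the set of entire $f$ such that $\|fe^{-\omega_m}\|_2<\infty$ and, for every $\varepsilon>0$, there is $C_\varepsilon>0$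 with $|f(z)|e^{-\omega_m(z)}\le C_\varepsilon e^{\varepsilon|\operatorname{Im} z|}$ for all $z\in\mathbb{C}$. Also $e^gPW(m)=\{e^gf: f\in PW(m)\}$. *)

theory Defs
  imports "HOL-Complex_Analysis.Complex_Analysis"
begin

definition entire :: "(complex \<Rightarrow> complex) \<Rightarrow> bool" where
  "entire f \<longleftrightarrow> f holomorphic_on UNIV"

definition real_entire :: "(complex \<Rightarrow> complex) \<Rightarrow> bool" where
  "real_entire f \<longleftrightarrow> entire f \<and> (\<forall>x::real. f (of_real x) \<in> \<real>)"

definition sharp :: "(complex \<Rightarrow> complex) \<Rightarrow> complex \<Rightarrow> complex" where
  "sharp f = (\<lambda>z. cnj (f (cnj z)))"

definition upper_half_plane :: "complex set" where
  "upper_half_plane = {z. 0 < Im z}"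

definition hermite_biehler :: "(complex \<Rightarrow> complex) \<Rightarrow> bool" where
  "hermite_biehler E \<longleftrightarrow> entire E \<and> (\<forall>z. 0 < Im z \<longrightarrow> cmod (E (cnj z)) < cmod (E z))"

definition real_analytic :: "(real \<Rightarrow> real) \<Rightarrow> bool" where
  "real_analytic f \<longleftrightarrow>
     (\<forall>x0. \<exists>r>0. \<exists>a::nat \<Rightarrow> real. \<forall>x. \<bar>x - x0\<bar> < r \<longrightarrow> (\<lambda>n. a n * (x - x0) ^ n) sums f x)"

definition is_phase :: "(complex \<Rightarrow> complex) \<Rightarrow> (real \<Rightarrow> real) \<Rightarrow> bool" where
  "is_phase E \<phi> \<longleftrightarrow> real_analytic \<phi> \<and>
     (\<forall>x::real. E (of_real x) = of_real (cmod (E (of_real x))) * exp (- \<i> * of_real (\<phi> x)))"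

definition bi_lipschitz_beyond :: "real \<Rightarrow> (real \<Rightarrow> real) \<Rightarrow> bool" where
  "bi_lipschitz_beyond N \<phi> \<longleftrightarrow> (\<exists>C1>0. \<exists>C2>0. \<forall>x1 x2. x2 - x1 > N \<longrightarrow>
     C1 * (x2 - x1) \<le> \<phi> x2 - \<phi> x1 \<and> \<phi> x2 - \<phi> x1 \<le> C2 * (x2 - x1))"

text \<open>
  The denominator may have zeros, as long as it does not vanish identically; the functions
  live on the upper half-plane and their values elsewhere are irrelevant.
\<close>

definition nevanlinna :: "(complex \<Rightarrow> complex) set" where
  "nevanlinna = {f. f holomorphic_on upper_half_plane \<and>
     (\<exists>g h. g holomorphic_on upper_half_plane \<and> bounded (g ` upper_half_plane) \<and>
            h holomorphic_on upper_half_plane \<and> bounded (h ` upper_half_plane) \<and>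
            (\<exists>z\<in>upper_half_plane. h z \<noteq> 0) \<and>
            (\<forall>z\<in>upper_half_plane. h z \<noteq> 0 \<longrightarrow> f z = g z / h z))}"

text \<open>
  The mean type is extended-real valued, with the convention that the logarithm of \<open>0\<close> is
  \<open>- \<infinity>\<close> (the library sets \<open>ln 0 = 0\<close>); in particular the zero function has mean type \<open>- \<infinity>\<close>.
\<close>

definition mean_type :: "(complex \<Rightarrow> complex) \<Rightarrow> ereal" where
  "mean_type f = Limsup at_top (\<lambda>y::real.
     if f (\<i> * of_real y) = 0 then - \<infinity> else ereal (ln (cmod (f (\<i> * of_real y))) / y))"

definition nevanlinna0 :: "(complex \<Rightarrow> complex) set" where
  "nevanlinna0 = {f \<in> nevanlinna. mean_type f \<le> 0}"

definition square_integrable :: "(real \<Rightarrow> complex) \<Rightarrow> bool" where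
  "square_integrable h \<longleftrightarrow> integrable lborel (\<lambda>x. (cmod (h x))\<^sup>2)"

definition de_branges :: "(complex \<Rightarrow> complex) \<Rightarrow> (complex \<Rightarrow> complex) set" where
  "de_branges E = {f. entire f \<and> square_integrable (\<lambda>x. f (of_real x) / E (of_real x)) \<and>
     (\<lambda>z. f z / E z) \<in> nevanlinna0 \<and> (\<lambda>z. sharp f z / E z) \<in> nevanlinna0}"

definition comparable_to_1 :: "(real \<Rightarrow> real) \<Rightarrow> bool" where
  "comparable_to_1 m \<longleftrightarrow> (\<exists>A>0. \<exists>B>0. \<forall>t. A \<le> m t \<and> m t \<le> B)"

text \<open>
  Regularised logarithm of \<open>\<bar>1 - z/t\<bar>\<close>. For fixed \<open>z\<close> the conventional values at \<open>t = 0\<close> and at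
  \<open>t = z\<close> concern at most two points \<open>t\<close> and do not affect the potential.
\<close>

definition log_star :: "complex \<Rightarrow> real \<Rightarrow> real" where
  "log_star z t = ln (cmod (1 - z / of_real t)) + (if \<bar>t\<bar> > 1 then Re z / t else 0)"

definition potential :: "(real \<Rightarrow> real) \<Rightarrow> complex \<Rightarrow> real" where
  "potential m z = (LINT t|lborel. log_star z t * m t)"

definition subexp_growth :: "(real \<Rightarrow> real) \<Rightarrow> (complex \<Rightarrow> complex) \<Rightarrow> bool" where
  "subexp_growth m f \<longleftrightarrow> (\<forall>\<epsilon>>0. \<exists>C>0. \<forall>z.
     cmod (f z) * exp (- potential m z) \<le> C * exp (\<epsilon> * \<bar>Im z\<bar>))"

definition PW :: "(real \<Rightarrow> real) \<Rightarrow> (complex \<Rightarrow> complex) set" where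
  "PW m = {f. entire f \<and>
     square_integrable (\<lambda>x. f (of_real x) * of_real (exp (- potential m (of_real x)))) \<and>
     subexp_growth m f}"

definition exp_mult :: "(complex \<Rightarrow> complex) \<Rightarrow> (complex \<Rightarrow> complex) set \<Rightarrow> (complex \<Rightarrow> complex) set" where
  "exp_mult g S = {\<lambda>z. exp (g z) * f z | f. f \<in> S}"

definition theta :: "real \<Rightarrow> (real \<Rightarrow> real) \<Rightarrow> real \<Rightarrow> real" where
  "theta N \<phi> x = 1 / pi * (LINT t:{t. \<bar>t - x\<bar> < N}|lborel. (\<phi> t - \<phi> x) / (t - x))"

end

theory Submission
  imports Defs "HOL-Probability.Sinc_Integral"
begin

text \<open>
  Let \<open>l\<close> be a logarithm of \<open>E\<close> on the closed upper half plane, so that \<open>Im l = - \<phi>\<close> on the real line, and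
  let \<open>\<pi> m\<close> be the derivative of the average of \<open>\<phi>\<close> over windows of radius \<open>h = N + 1\<close>.
  With the analytic completion \<open>W\<close> of the potential of \<open>m\<close>, the imaginary part of \<open>l - W\<close> is
  \<open>- \<Psi>\<close> on the real line (up to a constant), where \<open>\<Psi>\<close> has a bounded primitive \<open>\<Psi>\<^sub>1\<close>. Hence \<open>l = g + W + D\<close> with
  \<open>D z = - (1/\<pi>) \<integral> \<Psi>\<^sub>1 t / (z - t)\<^sup>2 dt\<close>, and \<open>g\<close> is real on the real line and extends to an entire function by
  reflection. The explicit formula gives \<open>\<bar>D z\<bar> = O(1 / Im z)\<close>, \<open>Re D \<le> O(1)\<close>, and
  \<open>Re D = - \<theta> + O(1)\<close> on the real line, so that \<open>\<bar>E\<bar>\<close> is comparable to \<open>exp (Re g + \<omega> - \<theta>)\<close> there.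

  Membership of \<open>f/E\<close> in the Nevanlinna class with nonpositive mean type is related to the growth condition by
  a Phragmen-Lindelof principle which admits a bound \<open>exp (O(\<bar>z\<bar>\<^sup>2 / Im z))\<close>. This is exactly
  what quotients of bounded analytic functions satisfy by Harnack's inequality, and also what a bound
  \<open>exp (\<epsilon> Im z + O(1 / Im z))\<close> gives.
\<close>

section \<open>Phragmen-Lindelof principles\<close>

text \<open>The bounds on \<open>D\<close> are deliberately asymmetric. Its real part is bounded
  above, but near the real line it follows -\<theta>, for which no lower bound is available. Passing
  from H(E) to the weighted space multiplies by exp (Re D), so the upper bound suffices. The
  converse multiplies by exp (- Re D), where only O(1 / Im z) is at hand; this is the second reason
  for admitting 1 / Im z in the exponent. The weight \<theta> records the steepness of the phase
  inside windows of radius N, where the bi-Lipschitz condition is silent. Since \<phi> is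
  increasing, \<theta> is nonnegative, whence the inclusion in PW(m). No boundary theory or
  factorisation of the Nevanlinna class enters: zeros of a denominator are removed by finitely many
  Blaschke factors in slightly smaller discs.\<close>

lemma norm_le_from_frontier_limsup:
  fixes f :: "complex \<Rightarrow> complex"
  assumes "open S" "bounded S" and holf: "f holomorphic_on S"
    and bd: "\<And>\<xi> \<epsilon>. \<xi> \<in> frontier S \<Longrightarrow> \<epsilon> > 0 \<Longrightarrow> \<exists>\<delta>>0. \<forall>z\<in>S. dist z \<xi> < \<delta> \<longrightarrow> cmod (f z) \<le> 1 + \<epsilon>"
    and "w \<in> S"
  shows "cmod (f w) \<le> 1"
proof (rule field_le_epsilon)
  fix e :: real assume "e > 0"
  show "cmod (f w) \<le> 1 + e"
  proof (rule ccontr)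
    assume neg: "\<not> cmod (f w) \<le> 1 + e"
    \<comment> \<open>The boundary hypothesis keeps the closure of \<open>T\<close> inside
      \<open>S\<close>, so the ordinary maximum principle applies on \<open>T\<close>, on whose
      frontier the modulus is at most \<open>1 + e\<close>.\<close>
    define T where "T = {z \<in> S. cmod (f z) > 1 + e}"
    have contf: "continuous_on S f" by (rule holomorphic_on_imp_continuous_on [OF holf])
    have "open T" unfolding T_def
      using continuous_open_preimage [OF continuous_on_norm [OF contf] \<open>open S\<close> open_greaterThan [of "1 + e"]]
      by (simp add: vimage_def Int_def)
    have clT: "closure T \<subseteq> S"
    proof
      fix x assume x: "x \<in> closure T"
      show "x \<in> S"
      proof (rule ccontr)
        assume "x \<notin> S"
        moreover have "x \<in> closure S" using x closure_mono [of T S] by (auto simp: T_def)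
        ultimately have "x \<in> frontier S" using \<open>open S\<close> by (simp add: frontier_def interior_open)
        then obtain d where d: "d > 0" "\<forall>z\<in>S. dist z x < d \<longrightarrow> cmod (f z) \<le> 1 + e"
          using bd \<open>e > 0\<close> by blast
        obtain y where "y \<in> T" "dist y x < d" using x d(1) closure_approachable by blast
        then show False using d(2) by (force simp: T_def)
      qed
    qed
    have fr: "cmod (f z) \<le> 1 + e" if z: "z \<in> frontier T" for z
    proof -
      have "z \<in> S" using z clT by (auto simp: frontier_def)
      moreover have "z \<notin> T" using z \<open>open T\<close> by (simp add: frontier_def interior_open)
      ultimately show ?thesis by (auto simp: T_def)
    qed
    have "cmod (f w) \<le> 1 + e"
    proof (rule maximum_modulus_frontier [of f T])
      show "f holomorphic_on interior T"
        using holf by (rule holomorphic_on_subset) (use interior_subset in \<open>auto simp: T_def\<close>)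
      show "continuous_on (closure T) f" using contf clT by (rule continuous_on_subset)
      show "bounded T" using \<open>bounded S\<close> by (rule bounded_subset) (auto simp: T_def)
      show "w \<in> T" using neg \<open>w \<in> S\<close> by (auto simp: T_def)
    qed (rule fr)
    then show False using neg by simp
  qed
qed

lemma Im_inverse_of_real_diff:
  fixes z :: complex and R :: real
  assumes "0 < Im z"
  shows "Im (1 / (of_real R - z)) = Im z / (cmod (z - of_real R))\<^sup>2"
    and "Im (- (1 / (of_real R + z))) = Im z / (cmod (z + of_real R))\<^sup>2"
  unfolding cmod_power2 by (simp_all add: Im_divide algebra_simps power2_eq_square)

text \<open>On a half disc of radius \<open>R\<close> the function \<open>1 / y\<close> on the semicircle is the boundary value of the
  positive harmonic function \<open>y / \<bar>z - R\<bar>\<^sup>2 + y / \<bar>z + R\<bar>\<^sup>2\<close>, which vanishes on the segment.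
  This allows a boundary singularity of the order of \<open>1 / y\<close> at the two corners.\<close>

lemma norm_le_exp_half_disc:
  fixes Q :: "complex \<Rightarrow> complex"
  assumes holQ: "Q holomorphic_on {z. 0 < Im z}"
    and real: "\<And>x::real. \<exists>\<delta>>0. \<forall>z. 0 < Im z \<longrightarrow> dist z (of_real x) < \<delta> \<longrightarrow> cmod (Q z) \<le> 1"
    and "R > 0" "b \<ge> 0"
    and circ: "\<And>z. 0 < Im z \<Longrightarrow> cmod z = R \<Longrightarrow> cmod (Q z) \<le> exp (b / Im z)"
    and z: "0 < Im z" "cmod z < R"
  shows "cmod (Q z) \<le> exp (b * (Im z / (cmod (z - of_real R))\<^sup>2 + Im z / (cmod (z + of_real R))\<^sup>2))"
proof -
  define P where "P z = Im z / (cmod (z - of_real R))\<^sup>2 + Im z / (cmod (z + of_real R))\<^sup>2" for z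
  define k where "k z = Q z * exp (\<i> * of_real b * (1 / (of_real R - z) - 1 / (of_real R + z)))" for z
  define S where "S = ball 0 R \<inter> {z. 0 < Im z}"
  have P_pos: "P z \<ge> 0" if "0 < Im z" for z using that by (simp add: P_def)
  have nk: "cmod (k z) = cmod (Q z) * exp (- b * P z)" if "0 < Im z" for z
  proof -
    have "Im (1 / (of_real R - z) - 1 / (of_real R + z)) = P z"
      using Im_inverse_of_real_diff[OF that] by (simp add: P_def)
    moreover have "cmod (exp (\<i> * of_real b * w)) = exp (- b * Im w)" for w by simp
    ultimately show ?thesis by (simp only: k_def norm_mult)
  qed
  have P_circ: "P z = 1 / Im z" if "0 < Im z" "cmod z = R" for z
  proof -
    obtain u v where zuv: "z = Complex u v" by (cases z)
    have v: "v > 0" and R2: "R\<^sup>2 = u\<^sup>2 + v\<^sup>2" using that by (auto simp: zuv cmod_def)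
    have e1: "(cmod (z - of_real R))\<^sup>2 = 2 * R * (R - u)" and e2: "(cmod (z + of_real R))\<^sup>2 = 2 * R * (R + u)"
      using R2 unfolding zuv cmod_power2 by (simp_all add: power2_eq_square algebra_simps)
    have "u\<^sup>2 < R\<^sup>2" using v R2 by simp
    then have "\<bar>u\<bar> < R" using \<open>R > 0\<close> by (metis abs_le_square_iff abs_of_pos not_le)
    then have p: "R - u > 0" "R + u > 0" by linarith+
    have "(R - u) * (R + u) = v\<^sup>2" using R2 by (simp add: power2_eq_square algebra_simps)
    then have v2: "(R - u) * (R + u) = v * v" by (simp add: power2_eq_square)
    have "P z = v / (2 * R * (R - u)) + v / (2 * R * (R + u))" unfolding P_def e1 e2 by (simp add: zuv)
    also have "\<dots> = v * ((R - u) + (R + u)) / (2 * R * ((R - u) * (R + u)))"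
    proof -
      have "v / (2 * R * p) + v / (2 * R * q) = v * (p + q) / (2 * R * (p * q))" if "p > 0" "q > 0" for p q
        using that \<open>R > 0\<close> by (simp add: field_simps)
      then show ?thesis using p by blast
    qed
    also have "\<dots> = v / ((R - u) * (R + u))" using p \<open>R > 0\<close> by simp
    also have "\<dots> = 1 / v" unfolding v2 using v by simp
    finally show ?thesis by (simp add: zuv)
  qed
  have ne: "of_real R - z \<noteq> 0" "of_real R + z \<noteq> 0" if "0 < Im z" for z :: complex
    using that by (auto simp: complex_eq_iff)
  have holk: "k holomorphic_on {z. 0 < Im z}"
    unfolding k_def by (intro holomorphic_intros holQ) (use ne in auto)
  have "cmod (k z) \<le> 1"
  proof (rule norm_le_from_frontier_limsup [of S k z])
    show "open S" unfolding S_def by (intro open_Int open_ball open_halfspace_Im_gt)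
    show "bounded S" unfolding S_def by (simp add: bounded_Int)
    show "k holomorphic_on S" using holk by (rule holomorphic_on_subset) (auto simp: S_def)
    show "z \<in> S" using z by (simp add: S_def)
    fix \<xi> \<epsilon> assume xi: "\<xi> \<in> frontier S" and "(\<epsilon>::real) > 0"
    have cl: "closure S \<subseteq> cball 0 R \<inter> {z. 0 \<le> Im z}"
      by (rule closure_minimal) (auto simp: S_def intro: closed_halfspace_Im_ge)
    have ximem: "cmod \<xi> \<le> R" "0 \<le> Im \<xi>" "\<xi> \<notin> S"
      using xi cl \<open>open S\<close> by (auto simp: frontier_def interior_open)
    show "\<exists>\<delta>>0. \<forall>z\<in>S. dist z \<xi> < \<delta> \<longrightarrow> cmod (k z) \<le> 1 + \<epsilon>"
    \<comment> \<open>The corners of the half disc are real points and belong to the first case.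
      There \<open>P\<close> is only known to be nonnegative, which is enough.\<close>
    proof (cases "Im \<xi> = 0")
      case True
      then have "\<xi> = of_real (Re \<xi>)" by (simp add: complex_eq_iff)
      with real[of "Re \<xi>"] obtain d where d: "d > 0" "\<forall>z. 0 < Im z \<longrightarrow> dist z \<xi> < d \<longrightarrow> cmod (Q z) \<le> 1"
        by auto
      have "cmod (k z) \<le> 1 + \<epsilon>" if "z \<in> S" "dist z \<xi> < d" for z
      proof -
        have z: "0 < Im z" using that by (simp add: S_def)
        have "cmod (k z) = cmod (Q z) * exp (- b * P z)" by (rule nk[OF z])
        also have "\<dots> \<le> 1 * 1"
          by (rule mult_mono) (use d z that P_pos \<open>b \<ge> 0\<close> in auto)
        finally show ?thesis using \<open>\<epsilon> > 0\<close> by simp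
      qed
      then show ?thesis using d(1) by blast
    next
      case False
      then have I: "0 < Im \<xi>" and c: "cmod \<xi> = R" using ximem by (auto simp: S_def)
      have "cmod (k \<xi>) \<le> exp (b / Im \<xi>) * exp (- b * P \<xi>)"
        unfolding nk[OF I] by (rule mult_right_mono) (use circ I c in auto)
      also have "\<dots> = 1" unfolding P_circ[OF I c] by (simp add: exp_add[symmetric])
      finally have k1: "cmod (k \<xi>) \<le> 1" .
      have "continuous_on {z. 0 < Im z} k" by (rule holomorphic_on_imp_continuous_on[OF holk])
      then have "isCont k \<xi>" using I continuous_on_eq_continuous_at[OF open_halfspace_Im_gt] by auto
      then obtain d where d: "d > 0" "\<forall>z. dist z \<xi> < d \<longrightarrow> dist (k z) (k \<xi>) < \<epsilon>"
        using \<open>\<epsilon> > 0\<close> unfolding continuous_at_eps_delta by blast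
      have "cmod (k z) \<le> 1 + \<epsilon>" if "dist z \<xi> < d" for z
      proof -
        have "cmod (k z) \<le> cmod (k \<xi>) + dist (k z) (k \<xi>)"
          by (metis add.commute dist_norm norm_triangle_sub)
        then show ?thesis using d(2) that k1 by force
      qed
      then show ?thesis using d(1) by blast
    qed
  qed
  then have "cmod (Q z) * exp (- b * P z) * exp (b * P z) \<le> 1 * exp (b * P z)"
    unfolding nk[OF z(1)] by (intro mult_right_mono) auto
  then show ?thesis by (simp add: P_def mult.assoc exp_add[symmetric])
qed

text \<open>The half disc estimate is used with \<open>b = (c + \<epsilon>) * R^2\<close>. As R
  grows, R^2 times each of the two kernels tends to \<open>Im z\<close>, which explains the factor 2
  in the conclusion. For c = 0 the growth hypothesis forces the bound 1.\<close>

lemma phragmen_lindelof_half_plane: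
  fixes Q :: "complex \<Rightarrow> complex"
  assumes holQ: "Q holomorphic_on {z. 0 < Im z}"
    and real: "\<And>x::real. \<exists>\<delta>>0. \<forall>z. 0 < Im z \<longrightarrow> dist z (of_real x) < \<delta> \<longrightarrow> cmod (Q z) \<le> 1"
    and "c \<ge> 0"
    and growth: "\<And>\<epsilon>. \<epsilon> > 0 \<Longrightarrow> \<exists>R0. \<forall>z. 0 < Im z \<longrightarrow> cmod z \<ge> R0 \<longrightarrow> cmod (Q z) \<le> exp ((c + \<epsilon>) * (cmod z)\<^sup>2 / Im z)"
    and z: "0 < Im z"
  shows "cmod (Q z) \<le> exp (2 * c * Im z)"
proof -
  have lim: "cmod (Q z) \<le> exp ((c + \<epsilon>) * (2 * Im z))" if eps: "\<epsilon> > 0" for \<epsilon>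
  proof -
    obtain R0 where R0: "\<And>z. 0 < Im z \<Longrightarrow> cmod z \<ge> R0 \<Longrightarrow> cmod (Q z) \<le> exp ((c + \<epsilon>) * (cmod z)\<^sup>2 / Im z)"
      using growth[OF eps] by blast
    define F where "F R = exp ((c + \<epsilon>) * (R\<^sup>2 * Im z / (cmod (z - of_real R))\<^sup>2 + R\<^sup>2 * Im z / (cmod (z + of_real R))\<^sup>2))" for R
    have "((\<lambda>R. (c + \<epsilon>) * (R\<^sup>2 * Im z / (cmod (z - of_real R))\<^sup>2 + R\<^sup>2 * Im z / (cmod (z + of_real R))\<^sup>2))
        \<longlongrightarrow> (c + \<epsilon>) * (Im z + Im z)) at_top"
    proof -
      have "((\<lambda>R. R\<^sup>2 * Im z / ((Re z - R)\<^sup>2 + (Im z)\<^sup>2)) \<longlongrightarrow> Im z) at_top"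
        "((\<lambda>R. R\<^sup>2 * Im z / ((Re z + R)\<^sup>2 + (Im z)\<^sup>2)) \<longlongrightarrow> Im z) at_top"
        by real_asymp+
      then show ?thesis
        unfolding cmod_power2 by (intro tendsto_intros) auto
    qed
    then have Flim: "(F \<longlongrightarrow> exp ((c + \<epsilon>) * (Im z + Im z))) at_top"
      unfolding F_def by (intro tendsto_exp)
    have "eventually (\<lambda>R. cmod (Q z) \<le> F R) at_top"
    proof -
      have "eventually (\<lambda>R. R > max 0 (max R0 (cmod z))) at_top" by (rule eventually_gt_at_top)
      then show ?thesis
      proof eventually_elim
        case (elim R)
        have "cmod (Q z) \<le> exp (((c + \<epsilon>) * R\<^sup>2) * (Im z / (cmod (z - of_real R))\<^sup>2 + Im z / (cmod (z + of_real R))\<^sup>2))"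
          by (rule norm_le_exp_half_disc[OF holQ real]) (use elim R0 \<open>c \<ge> 0\<close> eps z in auto)
        also have "\<dots> = F R" by (simp add: F_def algebra_simps add_divide_distrib)
        finally show ?case .
      qed
    qed
    then have "cmod (Q z) \<le> exp ((c + \<epsilon>) * (Im z + Im z))"
      by (intro tendsto_lowerbound[OF Flim]) auto
    then show ?thesis by (simp add: algebra_simps)
  qed
  have "((\<lambda>\<epsilon>. exp ((c + \<epsilon>) * (2 * Im z))) \<longlongrightarrow> exp ((c + 0) * (2 * Im z))) (at_right 0)"
    by (intro tendsto_intros)
  then have "cmod (Q z) \<le> exp ((c + 0) * (2 * Im z))"
    by (rule tendsto_lowerbound) (use lim in \<open>auto simp: eventually_at_filter\<close>)
  then show ?thesis by (simp add: mult_ac)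
qed

section \<open>Quotients of bounded analytic functions\<close>

text \<open>The cofactor of the local factorisation and the quotient by \<open>(z - a) ^ n\<close>
  agree on a punctured disc, so they glue to a function on all of \<open>A\<close>.\<close>

lemma holomorphic_factor_zero_global:
  fixes f :: "complex \<Rightarrow> complex"
  assumes "f holomorphic_on A" "open A" "connected A" "a \<in> A" "f a = 0" "\<exists>w\<in>A. f w \<noteq> 0"
  obtains n g where "g holomorphic_on A" "g a \<noteq> 0" "\<And>z. z \<in> A \<Longrightarrow> f z = (z - a) ^ n * g z"
proof -
  have "\<not> f constant_on A" using assms(4-6) unfolding constant_on_def by metis
  then obtain g r n where g: "0 < n" "0 < r" "ball a r \<subseteq> A" "g holomorphic_on ball a r"
    "\<And>w. w \<in> ball a r \<Longrightarrow> f w = (w - a) ^ n * g w" "\<And>w. w \<in> ball a r \<Longrightarrow> g w \<noteq> 0"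
    using holomorphic_factor_zero_nonconstant[OF assms(1-4,5)] by metis
  define k where "k z = (if z \<in> ball a r then g z else f z / (z - a) ^ n)" for z
  have keq: "k z = f z / (z - a) ^ n" if "z \<noteq> a" for z
    using g(5)[of z] that by (auto simp: k_def)
  have "k holomorphic_on (A - {a}) \<union> ball a r"
  proof (rule holomorphic_on_Un)
    show "k holomorphic_on A - {a}"
      by (rule holomorphic_transform[where f = "\<lambda>z. f z / (z - a) ^ n"])
         (use keq assms in \<open>auto intro!: holomorphic_intros intro: holomorphic_on_subset\<close>)
    show "k holomorphic_on ball a r"
      by (rule holomorphic_transform[OF g(4)]) (simp add: k_def)
  qed (use assms in auto)
  moreover have "(A - {a}) \<union> ball a r = A" using g assms by auto
  ultimately have "k holomorphic_on A" by simp
  moreover have "k a \<noteq> 0" using g by (simp add: k_def)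
  moreover have "f z = (z - a) ^ n * k z" if "z \<in> A" for z
    using keq[of z] assms(5) \<open>0 < n\<close> by (cases "z = a") auto
  ultimately show ?thesis using that by blast
qed

text \<open>This divides by a finite Blaschke product. Replacing \<open>(z - a) ^ n\<close> by
  \<open>(1 - cnj a * z) ^ n\<close> keeps the modulus on the unit circle and does not decrease it
  at 0, while the zero at \<open>a\<close> leaves the disc. The induction is on the number of
  distinct zeros, finite because \<open>H\<close> is holomorphic beyond the closed disc.\<close>

lemma exists_zero_free_multiplier:
  fixes Q H :: "complex \<Rightarrow> complex"
  assumes "s > 1" "Q holomorphic_on ball 0 s" "H holomorphic_on ball 0 s"
    and "\<And>z. cmod z = 1 \<Longrightarrow> cmod (H z) \<le> 1" "\<And>z. cmod z = 1 \<Longrightarrow> cmod (Q z * H z) \<le> 1" "H 0 \<noteq> 0"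
  shows "\<exists>h. h holomorphic_on ball 0 s \<and> (\<forall>z\<in>ball 0 1. h z \<noteq> 0) \<and>
     (\<forall>z. cmod z = 1 \<longrightarrow> cmod (h z) \<le> 1 \<and> cmod (Q z * h z) \<le> 1) \<and> cmod (H 0) \<le> cmod (h 0)"
  using assms(3-)
proof (induction "card {z \<in> ball 0 1. H z = 0}" arbitrary: H rule: less_induct)
  case less
  have sub: "ball 0 1 \<subseteq> ball (0::complex) s" "cball 0 1 \<subseteq> ball (0::complex) s" "0 \<in> ball (0::complex) s"
    using \<open>s > 1\<close> by auto
  show ?case
  proof (cases "\<exists>a\<in>ball 0 1. H a = 0")
    case False
    then show ?thesis using less.prems by blast
  next
    case True
    then obtain a where a: "cmod a < 1" "H a = 0" by auto
    have a0: "a \<noteq> 0" using a less.prems by auto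
    obtain n g where g: "g holomorphic_on ball 0 s" "g a \<noteq> 0"
      "\<And>z. z \<in> ball 0 s \<Longrightarrow> H z = (z - a) ^ n * g z"
      using holomorphic_factor_zero_global[OF less.prems(1) open_ball connected_ball, of a] a sub less.prems(4)
      by (metis in_mono mem_ball_0)
    define h where "h z = g z * (1 - cnj a * z) ^ n" for z
    have sphere: "cmod (z - a) = cmod (1 - cnj a * z)" if "cmod z = 1" for z
    proof -
      have "(cmod (1 - cnj a * z))\<^sup>2 = (cmod (z - a))\<^sup>2 + (1 - (cmod z)\<^sup>2) * (1 - (cmod a)\<^sup>2)"
        unfolding cmod_power2 by (simp add: power2_eq_square algebra_simps)
      then show ?thesis using that by simp
    qed
    have nh: "cmod (h z) = cmod (H z)" if "cmod z = 1" for z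
      using that sphere[OF that] g(3)[of z] \<open>s > 1\<close> by (simp add: h_def norm_mult norm_power mult.commute)
    have one: "1 - cnj a * z \<noteq> 0" if "cmod z < 1" for z
    proof
      assume "1 - cnj a * z = 0"
      then have "cmod a * cmod z = 1" by (metis complex_mod_cnj norm_mult norm_one right_minus_eq)
      moreover have "cmod a * cmod z < 1 * 1"
        using a that by (intro mult_strict_mono) auto
      ultimately show False by simp
    qed
    have zeros: "{z \<in> ball 0 1. h z = 0} \<subset> {z \<in> ball 0 1. H z = 0}"
    proof
      show "{z \<in> ball 0 1. h z = 0} \<subseteq> {z \<in> ball 0 1. H z = 0}"
        using one g(3) sub by (auto simp: h_def)
      have "a \<notin> {z \<in> ball 0 1. h z = 0}" using g(2) one a by (auto simp: h_def)
      then show "{z \<in> ball 0 1. h z = 0} \<noteq> {z \<in> ball 0 1. H z = 0}" using a by auto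
    qed
    have "\<not> H constant_on ball 0 s"
      using a less.prems(4) sub(1,3) unfolding constant_on_def by (metis in_mono mem_ball_0)
    then have "finite {z \<in> cball 0 1. H z = 0}"
      using holomorphic_compact_finite_zeros[OF less.prems(1) open_ball connected_ball compact_cball sub(2)] by blast
    then have "finite {z \<in> ball 0 1. H z = 0}" by (rule rev_finite_subset) auto
    then have card: "card {z \<in> ball 0 1. h z = 0} < card {z \<in> ball 0 1. H z = 0}"
      using zeros by (rule psubset_card_mono)
    have holh: "h holomorphic_on ball 0 s" unfolding h_def by (intro holomorphic_intros g)
    have H0: "cmod (H 0) \<le> cmod (h 0)"
    proof -
      have "cmod (H 0) = cmod a ^ n * cmod (h 0)"
        using g(3)[of 0] sub by (simp add: h_def norm_mult norm_power)
      also have "\<dots> \<le> 1 * cmod (h 0)"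
        by (intro mult_right_mono power_le_one) (use a in auto)
      finally show ?thesis by simp
    qed
    have "h 0 \<noteq> 0" using H0 less.prems(4) by auto
    then obtain k where "k holomorphic_on ball 0 s" "\<forall>z\<in>ball 0 1. k z \<noteq> 0"
      "\<forall>z. cmod z = 1 \<longrightarrow> cmod (k z) \<le> 1 \<and> cmod (Q z * k z) \<le> 1" "cmod (h 0) \<le> cmod (k 0)"
      using less.hyps[OF card holh] nh less.prems by (auto simp: norm_mult)
    then show ?thesis using H0 by (blast intro: order_trans)
  qed
qed

text \<open>Harnack's inequality for the positive harmonic function \<open>- log \<bar>h\<bar>\<close>, obtained from the
  Schwarz lemma for the Cayley transform of its analytic completion.\<close>

lemma zero_free_lower_bound:
  fixes h :: "complex \<Rightarrow> complex"
  assumes h: "h holomorphic_on ball 0 1" "\<And>z. z \<in> ball 0 1 \<Longrightarrow> h z \<noteq> 0"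
    and le: "\<And>z. z \<in> ball 0 1 \<Longrightarrow> cmod (h z) < 1" and w: "cmod w < 1"
  shows "- ln (cmod (h w)) \<le> - ln (cmod (h 0)) * ((1 + cmod w) / (1 - cmod w))"
proof -
  obtain L where L: "L holomorphic_on ball 0 1" "\<And>z. z \<in> ball 0 1 \<Longrightarrow> exp (L z) = h z"
    using holomorphic_logarithm_exists[OF convex_ball open_ball h, of 0] by auto
  have lnL: "ln (cmod (h z)) = Re (L z)" if "z \<in> ball 0 1" for z
    by (simp add: L(2)[OF that, symmetric])
  have pos: "Re (L z) < 0" if "cmod z < 1" for z
    using lnL[of z] le[of z] h(2)[of z] that by (metis ln_less_zero_iff mem_ball_0 zero_less_norm_iff)
  define P where "P z = - L z" for z
  have Ppos: "Re (P z) > 0" if "cmod z < 1" for z using pos[OF that] by (simp add: P_def)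
  define s where "s z = (P z - P 0) / (P z + cnj (P 0))" for z
  have den: "P z + cnj (P 0) \<noteq> 0" if "cmod z < 1" for z
    using Ppos[OF that] Ppos[of 0] by (auto simp: complex_eq_iff)
  have sq: "(cmod (u + cnj v))\<^sup>2 = (cmod (u - v))\<^sup>2 + 4 * Re u * Re v" for u v :: complex
    unfolding cmod_power2 by (simp add: power2_eq_square algebra_simps)
  have s1: "cmod (s z) < 1" if z: "cmod z < 1" for z
  proof -
    have "0 < 4 * Re (P z) * Re (P 0)" using Ppos[OF z] Ppos[of 0] by simp
    then have "(cmod (P z - P 0))\<^sup>2 < (cmod (P z + cnj (P 0)))\<^sup>2"
      using sq[of "P z" "P 0"] by linarith
    then have "cmod (P z - P 0) < cmod (P z + cnj (P 0))" by (rule power2_less_imp_less) simp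
    then show ?thesis using den[OF z] by (simp add: s_def norm_divide)
  qed
  have "s holomorphic_on ball 0 1" unfolding s_def P_def
    by (intro holomorphic_intros L) (use den P_def in auto)
  then have "cmod (s w) \<le> cmod w"
    by (rule Schwarz_Lemma(1)) (use s1 w in \<open>auto simp: s_def\<close>)
  then have *: "cmod (P w - P 0) \<le> cmod w * cmod (P w + cnj (P 0))"
    using den[OF w] by (simp add: s_def norm_divide divide_le_eq)
  define p q r d where "p = Re (P w)" and "q = Re (P 0)" and "r = cmod w" and "d = Im (P w) - Im (P 0)"
  have pq: "p > 0" "q > 0" "0 \<le> r" "r < 1" using Ppos w by (auto simp: p_def q_def r_def)
  have "(cmod (P w - P 0))\<^sup>2 \<le> (r * cmod (P w + cnj (P 0)))\<^sup>2"
    using * unfolding r_def by (intro power_mono) auto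
  then have "(p - q)\<^sup>2 + d\<^sup>2 \<le> r\<^sup>2 * ((p + q)\<^sup>2 + d\<^sup>2)"
    unfolding power_mult_distrib cmod_power2 by (simp add: p_def q_def d_def)
  \<comment> \<open>The difference \<open>d\<close> of imaginary parts occurs on both sides of the
    Schwarz estimate and drops out because \<open>r < 1\<close>.\<close>
  moreover have "r\<^sup>2 * d\<^sup>2 \<le> 1 * d\<^sup>2"
    using pq by (intro mult_right_mono) (auto simp: power_le_one)
  ultimately have "(p - q)\<^sup>2 \<le> (r * (p + q))\<^sup>2" unfolding power_mult_distrib by (simp add: distrib_left)
  then have "p - q \<le> r * (p + q)"
    using pq by (smt (verit) mult_nonneg_nonneg power2_le_imp_le)
  then have "p \<le> q * ((1 + r) / (1 - r))" using pq by (simp add: field_simps)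
  then show ?thesis using lnL[of w] lnL[of 0] w by (simp add: p_def q_def r_def P_def)
qed

text \<open>Once the multiplier \<open>h\<close> has no zeros, the maximum principle gives |Q| \<le>
  1 / |h|, and Harnack's inequality bounds - log |h| by its value at 0.\<close>

lemma quotient_bound_disc_aux:
  fixes Q H :: "complex \<Rightarrow> complex"
  assumes "s > 1" "Q holomorphic_on ball 0 s" "H holomorphic_on ball 0 s"
    and "\<And>z. cmod z = 1 \<Longrightarrow> cmod (H z) \<le> 1" "\<And>z. cmod z = 1 \<Longrightarrow> cmod (Q z * H z) \<le> 1" "H 0 \<noteq> 0"
    and w: "cmod w < 1"
  shows "cmod (Q w) \<le> exp (- ln (cmod (H 0) / 2) * ((1 + cmod w) / (1 - cmod w)))"
proof -
  obtain h where h: "h holomorphic_on ball 0 s" "\<And>z. z\<in>ball 0 1 \<Longrightarrow> h z \<noteq> 0"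
     "\<And>z. cmod z = 1 \<Longrightarrow> cmod (h z) \<le> 1" "\<And>z. cmod z = 1 \<Longrightarrow> cmod (Q z * h z) \<le> 1" "cmod (H 0) \<le> cmod (h 0)"
    using exists_zero_free_multiplier[OF assms(1-6)] by blast
  have maxm: "cmod (f z) \<le> 1" if "f holomorphic_on ball 0 s" "\<And>z. cmod z = 1 \<Longrightarrow> cmod (f z) \<le> 1" "cmod z < 1" for f z
  proof (rule maximum_modulus_frontier[of f "ball 0 1"])
    show "f holomorphic_on interior (ball 0 1)" "continuous_on (closure (ball 0 1)) f"
      using \<open>s > 1\<close>
      by (auto intro!: holomorphic_on_subset[OF that(1)] continuous_on_subset[OF holomorphic_on_imp_continuous_on[OF that(1)]])
  qed (use that in auto)
  have hle: "cmod (h z) \<le> 1" if "cmod z < 1" for z using maxm[OF h(1,3) that] .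
  have Qh: "cmod (Q w * h w) \<le> 1"
    by (rule maxm[of "\<lambda>z. Q z * h z"]) (use assms h in \<open>auto intro!: holomorphic_intros\<close>)
  \<comment> \<open>Halving makes the modulus strictly less than 1, as
    \<open>zero_free_lower_bound\<close> requires; hence the 2 in the final bound.\<close>
  have h2: "(\<lambda>z. h z / 2) holomorphic_on ball 0 1"
    using \<open>s > 1\<close> by (intro holomorphic_intros holomorphic_on_subset[OF h(1)]) auto
  have lt: "cmod (h z / 2) < 1" if "z \<in> ball 0 1" for z using hle[of z] that by (simp add: norm_divide)
  have bd: "- ln (cmod (h w / 2)) \<le> - ln (cmod (h 0 / 2)) * ((1 + cmod w) / (1 - cmod w))"
    by (rule zero_free_lower_bound[OF h2 _ lt w]) (use h(2) in auto)
  have hw: "cmod (h w) > 0" using h(2)[of w] w by simp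
  have "cmod (Q w) \<le> 1 / cmod (h w)" using Qh hw by (simp add: norm_mult field_simps)
  also have "\<dots> \<le> 1 / cmod (h w / 2)" using hw by (simp add: norm_divide field_simps)
  also have "\<dots> = exp (- ln (cmod (h w / 2)))" using hw by (simp add: exp_minus inverse_eq_divide norm_divide)
  also have "\<dots> \<le> exp (- ln (cmod (h 0 / 2)) * ((1 + cmod w) / (1 - cmod w)))" using bd by simp
  also have "\<dots> \<le> exp (- ln (cmod (H 0) / 2) * ((1 + cmod w) / (1 - cmod w)))"
  proof -
    have "ln (cmod (H 0) / 2) \<le> ln (cmod (h 0 / 2))"
      using h(5) \<open>H 0 \<noteq> 0\<close> by (subst ln_le_cancel_iff) (auto simp: norm_divide)
    then have "- ln (cmod (h 0 / 2)) * ((1 + cmod w) / (1 - cmod w)) \<le> - ln (cmod (H 0) / 2) * ((1 + cmod w) / (1 - cmod w))"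
      by (intro mult_right_mono) (use w in auto)
    then show ?thesis by simp
  qed
  finally show ?thesis .
qed

text \<open>With bounds only in the open disc, both functions are dilated by r < 1, which makes them
  holomorphic on a disc of radius 1 / r; then r tends to 1.\<close>

lemma quotient_bound_disc:
  fixes Q H :: "complex \<Rightarrow> complex"
  assumes Q: "Q holomorphic_on ball 0 1" and H: "H holomorphic_on ball 0 1"
    and "\<And>z. cmod z < 1 \<Longrightarrow> cmod (H z) \<le> 1" "\<And>z. cmod z < 1 \<Longrightarrow> cmod (Q z * H z) \<le> 1" "H 0 \<noteq> 0"
    and w: "cmod w < 1"
  shows "cmod (Q w) \<le> exp (- ln (cmod (H 0) / 2) * ((1 + cmod w) / (1 - cmod w)))"
proof -
  have bd: "cmod (Q w) \<le> exp (- ln (cmod (H 0) / 2) * ((1 + cmod w / r) / (1 - cmod w / r)))" if r: "cmod w < r" "r < 1" for r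
  proof -
    have "0 < r" using r by (metis norm_ge_zero order_le_less_trans)
    have im: "(*) (of_real r) ` ball 0 (1 / r) \<subseteq> ball (0::complex) 1"
      using \<open>0 < r\<close> by (auto simp: norm_mult field_simps)
    have "cmod (Q (of_real r * (w / of_real r))) \<le> exp (- ln (cmod (H (of_real r * 0)) / 2) * ((1 + cmod (w / of_real r)) / (1 - cmod (w / of_real r))))"
    proof (rule quotient_bound_disc_aux[where s = "1 / r" and Q = "\<lambda>z. Q (of_real r * z)" and H = "\<lambda>z. H (of_real r * z)"])
      show "(\<lambda>z. Q (of_real r * z)) holomorphic_on ball 0 (1 / r)"
        "(\<lambda>z. H (of_real r * z)) holomorphic_on ball 0 (1 / r)"
        using holomorphic_on_compose_gen[OF _ Q im] holomorphic_on_compose_gen[OF _ H im]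
        by (auto simp: o_def intro!: holomorphic_intros)
    qed (use assms r \<open>0 < r\<close> in \<open>auto simp: norm_mult norm_divide\<close>)
    then show ?thesis using \<open>0 < r\<close> by (simp add: norm_divide)
  qed
  have "((\<lambda>r. exp (- ln (cmod (H 0) / 2) * ((1 + cmod w / r) / (1 - cmod w / r)))) \<longlongrightarrow>
     exp (- ln (cmod (H 0) / 2) * ((1 + cmod w / 1) / (1 - cmod w / 1)))) (at_left 1)"
    by (intro tendsto_intros) (use w in auto)
  moreover have "eventually (\<lambda>r. cmod (Q w) \<le> exp (- ln (cmod (H 0) / 2) * ((1 + cmod w / r) / (1 - cmod w / r)))) (at_left 1)"
    unfolding eventually_at_left_field using bd w by blast
  ultimately have "cmod (Q w) \<le> exp (- ln (cmod (H 0) / 2) * ((1 + cmod w / 1) / (1 - cmod w / 1)))"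
    by (rule tendsto_lowerbound) simp
  then show ?thesis by simp
qed

text \<open>This is the source of the growth |z|^2 / Im z. The Moebius map \<open>M\<close> carries
  the disc to the half plane with \<open>M 0 = z0\<close>, and (1 + r) / (1 - r) = (1 + r)^2 / (1 -
  r^2), where 1 - r^2 = 4 Im z Im z0 / |z - cnj z0|^2. The restriction on \<open>cmod z\<close>
  allows |z - cnj z0| to be replaced by 2 |z|.\<close>

lemma quotient_bound_half_plane:
  fixes Q H :: "complex \<Rightarrow> complex"
  assumes Q: "Q holomorphic_on {z. 0 < Im z}" and H: "H holomorphic_on {z. 0 < Im z}"
    and bd: "\<And>z. 0 < Im z \<Longrightarrow> cmod (H z) \<le> 1" "\<And>z. 0 < Im z \<Longrightarrow> cmod (Q z * H z) \<le> 1"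
    and z0: "0 < Im z0" "H z0 \<noteq> 0"
  shows "\<exists>c\<ge>0. \<forall>z. 0 < Im z \<longrightarrow> cmod z \<ge> cmod z0 \<longrightarrow> cmod (Q z) \<le> exp (c * (cmod z)\<^sup>2 / Im z)"
proof -
  define M where "M w = (z0 - cnj z0 * w) / (1 - w)" for w
  have one: "1 - w \<noteq> 0" if "cmod w < 1" for w :: complex using that by auto
  have ImM: "0 < Im (M w)" if "cmod w < 1" for w
  proof -
    have "Im (M w) = Im z0 * (1 - (cmod w)\<^sup>2) / (cmod (1 - w))\<^sup>2"
      unfolding cmod_power2 M_def by (simp add: Im_divide power2_eq_square algebra_simps)
    moreover have "(cmod w)\<^sup>2 < 1" using that by (simp add: abs_square_less_1)
    ultimately show ?thesis using z0 one[OF that] by simp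
  qed
  have holM: "M holomorphic_on ball 0 1" unfolding M_def by (intro holomorphic_intros) (use one in auto)
  have im: "M ` ball 0 1 \<subseteq> {z. 0 < Im z}" using ImM by auto
  have QM: "Q \<circ> M holomorphic_on ball 0 1" and HM: "H \<circ> M holomorphic_on ball 0 1"
    using holomorphic_on_compose_gen[OF holM Q im] holomorphic_on_compose_gen[OF holM H im] .
  have M0: "M 0 = z0" by (simp add: M_def)
  define C where "C = - ln (cmod (H z0) / 2)"
  have Cpos: "C \<ge> 0" using bd(1)[of z0] z0 by (simp add: C_def)
  have disc: "cmod (Q (M w)) \<le> exp (C * ((1 + cmod w) / (1 - cmod w)))" if w: "cmod w < 1" for w
  proof -
    have "cmod ((Q \<circ> M) w) \<le> exp (- ln (cmod ((H \<circ> M) 0) / 2) * ((1 + cmod w) / (1 - cmod w)))"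
      by (rule quotient_bound_disc[OF QM HM]) (use bd ImM z0 w in \<open>auto simp: M0\<close>)
    then show ?thesis by (simp add: M0 C_def)
  qed
  have "cmod (Q z) \<le> exp ((4 * C / Im z0) * (cmod z)\<^sup>2 / Im z)" if z: "0 < Im z" "cmod z \<ge> cmod z0" for z
  proof -
    have d0: "z - cnj z0 \<noteq> 0" using z z0 by (auto simp: complex_eq_iff)
    define w where "w = (z - z0) / (z - cnj z0)"
    define r where "r = cmod w"
    have eq: "(cmod (z - cnj z0))\<^sup>2 - (cmod (z - z0))\<^sup>2 = 4 * Im z * Im z0"
      unfolding cmod_power2 by (simp add: power2_eq_square algebra_simps)
    have r2: "1 - r\<^sup>2 = 4 * Im z * Im z0 / (cmod (z - cnj z0))\<^sup>2"
    proof -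
      have "1 - r\<^sup>2 = ((cmod (z - cnj z0))\<^sup>2 - (cmod (z - z0))\<^sup>2) / (cmod (z - cnj z0))\<^sup>2"
      proof -
        have "r\<^sup>2 = (cmod (z - z0))\<^sup>2 / (cmod (z - cnj z0))\<^sup>2"
          by (simp add: r_def w_def norm_divide power_divide)
        then show ?thesis using d0 by (simp add: diff_divide_distrib)
      qed
      then show ?thesis unfolding eq .
    qed
    then have "1 - r\<^sup>2 > 0" using z z0 d0 by simp
    then have r1: "r < 1" "0 \<le> r" by (auto simp: r_def abs_square_less_1)
    have Mw: "M w = z"
    proof -
      have "1 - w = (z0 - cnj z0) / (z - cnj z0)" using d0 by (simp add: w_def field_simps)
      moreover have "z0 - cnj z0 * w = z * (z0 - cnj z0) / (z - cnj z0)" using d0 by (simp add: w_def field_simps)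
      moreover have "z0 - cnj z0 \<noteq> 0" using z0 by (auto simp: complex_eq_iff)
      ultimately show ?thesis using d0 by (simp add: M_def)
    qed
    have "(1 + r) / (1 - r) = (1 + r)\<^sup>2 / (1 - r\<^sup>2)"
    proof -
      have "1 - r\<^sup>2 = (1 + r) * (1 - r)" by (simp add: power2_eq_square algebra_simps)
      then show ?thesis using r1 by (simp add: power2_eq_square)
    qed
    also have "\<dots> \<le> 2\<^sup>2 / (1 - r\<^sup>2)"
      using \<open>1 - r\<^sup>2 > 0\<close> r1 by (intro divide_right_mono power_mono) auto
    also have "\<dots> = (cmod (z - cnj z0))\<^sup>2 / (Im z * Im z0)" unfolding r2 by simp
    also have "\<dots> \<le> (2 * cmod z)\<^sup>2 / (Im z * Im z0)"
    proof (intro divide_right_mono power_mono)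
      have "cmod (z - cnj z0) \<le> cmod z + cmod z0" by (metis complex_mod_cnj norm_triangle_ineq4)
      then show "cmod (z - cnj z0) \<le> 2 * cmod z" using z by simp
    qed (use z z0 in auto)
    finally have le: "(1 + r) / (1 - r) \<le> (2 * cmod z)\<^sup>2 / (Im z * Im z0)" .
    have "cmod (Q z) \<le> exp (C * ((1 + r) / (1 - r)))"
      using disc[of w] r1 by (simp add: Mw r_def)
    also have "\<dots> \<le> exp (C * ((2 * cmod z)\<^sup>2 / (Im z * Im z0)))"
      using mult_left_mono[OF le Cpos] by simp
    also have "\<dots> = exp ((4 * C / Im z0) * (cmod z)\<^sup>2 / Im z)" by (simp add: power_mult_distrib field_simps)
    finally show ?thesis .
  qed
  then show ?thesis using Cpos z0 by (intro exI[of _ "4 * C / Im z0"]) auto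
qed

text \<open>Squaring opens the quadrant to the half plane. Growth exp (c Im z) becomes exp (c sqrt
  |w|), which is below exp (\<epsilon> |w|^2 / Im w) for large |w|, so the half plane principle
  applies with constant 0.\<close>

lemma phragmen_lindelof_quadrant:
  fixes Q :: "complex \<Rightarrow> complex"
  assumes holQ: "Q holomorphic_on {z. 0 < Im z}"
    and real: "\<And>x::real. \<exists>\<delta>>0. \<forall>z. 0 < Im z \<longrightarrow> dist z (of_real x) < \<delta> \<longrightarrow> cmod (Q z) \<le> 1"
    and "c \<ge> 0" and growth: "\<And>z. 0 < Im z \<Longrightarrow> cmod (Q z) \<le> exp (c * Im z)"
    and axis: "\<And>y. y > 0 \<Longrightarrow> cmod (Q (\<i> * of_real y)) \<le> 1"
    and z: "0 < Im z" "0 < Re z"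
  shows "cmod (Q z) \<le> 1"
proof -
  have bd: "cmod (Q z) \<le> 1 + \<eta>" if eta: "\<eta> > 0" for \<eta>
  proof -
    \<comment> \<open>On the imaginary axis the bound 1 holds only at the points themselves, whereas
      the principle demands it in a neighbourhood. The slack \<eta> makes room for
      continuity.\<close>
    define k where "k w = Q (csqrt w) / of_real (1 + \<eta>)" for w
    have nk: "cmod (k w) = cmod (Q (csqrt w)) / (1 + \<eta>)" for w
      using eta unfolding k_def norm_divide norm_of_real by simp
    have sq: "0 < Im (csqrt w)" if "0 < Im w" for w
    proof -
      have "Im (u\<^sup>2) = 2 * Re u * Im u" for u by (simp add: power2_eq_square)
      from this[of "csqrt w"] have "Im w = 2 * Re (csqrt w) * Im (csqrt w)" unfolding power2_csqrt .
      then show ?thesis using that Re_csqrt[of w]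
        by (smt (verit) mult_nonneg_nonneg mult_nonneg_nonpos)
    qed
    have npos: "w \<notin> \<real>\<^sub>\<le>\<^sub>0" if "0 < Im w" for w using that by (auto simp: complex_nonpos_Reals_iff)
    have im: "csqrt ` {w. 0 < Im w} \<subseteq> {z. 0 < Im z}" using sq by auto
    have "csqrt holomorphic_on {w. 0 < Im w}"
      using holomorphic_on_csqrt by (rule holomorphic_on_subset) (use npos in auto)
    then have "Q \<circ> csqrt holomorphic_on {w. 0 < Im w}"
      by (rule holomorphic_on_compose_gen[OF _ holQ im])
    then have holk: "k holomorphic_on {w. 0 < Im w}"
      unfolding k_def o_def by (intro holomorphic_intros) (use eta in \<open>simp only: of_real_eq_0_iff, simp\<close>)
    have contQ: "isCont Q z" if "0 < Im z" for z
      using holomorphic_on_imp_continuous_on[OF holQ] that continuous_on_eq_continuous_at[OF open_halfspace_Im_gt] by auto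
    have "cmod (k (z\<^sup>2)) \<le> exp (2 * 0 * Im (z\<^sup>2))"
    proof (rule phragmen_lindelof_half_plane[OF holk])
      fix x :: real
      show "\<exists>\<delta>>0. \<forall>w. 0 < Im w \<longrightarrow> dist w (of_real x) < \<delta> \<longrightarrow> cmod (k w) \<le> 1"
      proof (cases "x \<ge> 0")
        case True
        obtain d where d: "d > 0" "\<And>z. 0 < Im z \<Longrightarrow> dist z (of_real (sqrt x)) < d \<Longrightarrow> cmod (Q z) \<le> 1"
          using real[of "sqrt x"] by blast
        \<comment> \<open>The origin is treated separately: \<open>csqrt\<close> is continuous
          there, although 0 lies on the branch cut.\<close>
        have "isCont csqrt (of_real x)"
        proof (cases "x = 0")
          case True
          have "((\<lambda>w. csqrt w) \<longlongrightarrow> 0) (at 0)"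
          proof (rule tendsto_norm_zero_cancel)
            have "((\<lambda>w. sqrt (cmod w)) \<longlongrightarrow> sqrt (cmod (0::complex))) (at 0)" by (intro tendsto_intros)
            then show "((\<lambda>w. cmod (csqrt w)) \<longlongrightarrow> 0) (at 0)" by simp
          qed
          then show ?thesis using True by (simp add: isCont_def)
        qed (use \<open>x \<ge> 0\<close> in \<open>auto intro!: continuous_at_csqrt\<close>)
        then obtain e where e: "e > 0" "\<And>w. dist w (of_real x) < e \<Longrightarrow> dist (csqrt w) (csqrt (of_real x)) < d"
          unfolding continuous_at_eps_delta using d(1) by blast
        have "cmod (k w) \<le> 1" if "0 < Im w" "dist w (of_real x) < e" for w
        proof -
          have "cmod (Q (csqrt w)) \<le> 1"
            using d(2)[OF sq[OF that(1)]] e(2)[OF that(2)] True by (simp add: csqrt_of_real)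
          then show ?thesis using eta unfolding nk by simp
        qed
        then show ?thesis using e(1) by blast
      next
        case False
        \<comment> \<open>The negative axis is the branch cut of \<open>csqrt\<close>. For
          \<open>0 < Im w\<close> it equals \<open>\<i> * csqrt (- w)\<close>, which is continuous
          across the cut.\<close>
        have "isCont (\<lambda>w. \<i> * csqrt (- w)) (of_real x)"
          using False by (intro continuous_intros isCont_csqrt') (auto simp: complex_nonpos_Reals_iff)
        then have "isCont (\<lambda>w. Q (\<i> * csqrt (- w))) (of_real x)"
          by (rule isCont_o2) (use False in \<open>auto intro!: contQ simp: csqrt_of_real[of "-x", simplified]\<close>)
        then obtain e where e: "e > 0" "\<And>w. dist w (of_real x) < e \<Longrightarrow>
             dist (Q (\<i> * csqrt (- w))) (Q (\<i> * csqrt (- of_real x))) < \<eta>"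
          unfolding continuous_at_eps_delta using eta by blast
        have "cmod (k w) \<le> 1" if "0 < Im w" "dist w (of_real x) < e" for w
        proof -
          have "csqrt w = \<i> * csqrt (- w)" using csqrt_minus[of "-w"] that by simp
          moreover have "csqrt (- of_real x) = of_real (sqrt (- x))"
            using csqrt_of_real[of "-x"] False by simp
          ultimately have "dist (Q (csqrt w)) (Q (\<i> * of_real (sqrt (- x)))) < \<eta>" using e(2)[OF that(2)] by simp
          moreover have "cmod (Q (\<i> * of_real (sqrt (- x)))) \<le> 1" using axis[of "sqrt (-x)"] False by simp
          ultimately have "cmod (Q (csqrt w)) \<le> 1 + \<eta>"
            by (smt (verit) dist_norm norm_triangle_sub)
          then show ?thesis using eta unfolding nk by simp
        qed
        then show ?thesis using e(1) by blast
      qed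
    next
      fix \<epsilon> :: real assume "\<epsilon> > 0"
      have "cmod (k w) \<le> exp ((0 + \<epsilon>) * (cmod w)\<^sup>2 / Im w)" if w: "0 < Im w" "cmod w \<ge> (c / \<epsilon>)\<^sup>2" for w
      proof -
        have "c / \<epsilon> \<le> sqrt (cmod w)" using w(2) by (simp add: real_le_rsqrt)
        then have "c * sqrt (cmod w) \<le> \<epsilon> * sqrt (cmod w) * sqrt (cmod w)"
          using \<open>\<epsilon> > 0\<close> by (intro mult_right_mono) (auto simp: field_simps)
        then have 1: "c * sqrt (cmod w) \<le> \<epsilon> * cmod w" by (simp add: mult.assoc)
        have "cmod w * Im w \<le> cmod w * cmod w" using abs_Im_le_cmod[of w] by (intro mult_left_mono) auto
        then have 2: "cmod w \<le> (cmod w)\<^sup>2 / Im w" using w by (simp add: field_simps power2_eq_square)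
        have "cmod (k w) \<le> cmod (Q (csqrt w))" unfolding nk using eta by (simp add: divide_le_eq mult_le_cancel_left1)
        also have "\<dots> \<le> exp (c * Im (csqrt w))" by (rule growth[OF sq[OF w(1)]])
        also have "\<dots> \<le> exp (c * sqrt (cmod w))"
        proof -
          have "Im (csqrt w) \<le> cmod (csqrt w)" using abs_Im_le_cmod[of "csqrt w"] by (rule order_trans[OF abs_ge_self])
          then have "Im (csqrt w) \<le> sqrt (cmod w)" unfolding norm_csqrt .
          from mult_left_mono[OF this \<open>c \<ge> 0\<close>] show ?thesis by (simp only: exp_le_cancel_iff)
        qed
        also have "\<dots> \<le> exp (\<epsilon> * cmod w)" using 1 by simp
        also have "\<dots> \<le> exp (\<epsilon> * ((cmod w)\<^sup>2 / Im w))" using mult_left_mono[OF 2, of \<epsilon>] \<open>\<epsilon> > 0\<close> by simp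
        finally show ?thesis by simp
      qed
      then show "\<exists>R0. \<forall>w. 0 < Im w \<longrightarrow> R0 \<le> cmod w \<longrightarrow> cmod (k w) \<le> exp ((0 + \<epsilon>) * (cmod w)\<^sup>2 / Im w)" by blast
    qed (use z in \<open>auto simp: power2_eq_square\<close>)
    moreover have "csqrt (z\<^sup>2) = z" by (rule csqrt_square) (use z in auto)
    ultimately show ?thesis using eta unfolding nk by (simp add: divide_le_eq)
  qed
  then show ?thesis by (rule field_le_epsilon)
qed

text \<open>A quotient of bounded functions is a priori \<open>O(exp (C y))\<close> in the half plane, and the exponent
  is then improved to the growth on the imaginary axis.\<close>

lemma phragmen_lindelof_bounded_type:
  fixes Q H :: "complex \<Rightarrow> complex"
  assumes Q: "Q holomorphic_on {z. 0 < Im z}" and H: "H holomorphic_on {z. 0 < Im z}"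
    and bd: "\<And>z. 0 < Im z \<Longrightarrow> cmod (H z) \<le> 1" "\<And>z. 0 < Im z \<Longrightarrow> cmod (Q z * H z) \<le> 1"
    and z0: "0 < Im z0" "H z0 \<noteq> 0"
    and real: "\<And>x::real. \<exists>\<delta>>0. \<forall>z. 0 < Im z \<longrightarrow> dist z (of_real x) < \<delta> \<longrightarrow> cmod (Q z) \<le> 1"
    and axis: "\<And>\<epsilon>. \<epsilon> > 0 \<Longrightarrow> \<exists>M. \<forall>y>0. cmod (Q (\<i> * of_real y)) \<le> M * exp (\<epsilon> * y)"
    and z: "0 < Im z"
  shows "cmod (Q z) \<le> 1"
proof -
  obtain c where c: "c \<ge> 0" and cb: "\<And>z. 0 < Im z \<Longrightarrow> cmod z \<ge> cmod z0 \<Longrightarrow> cmod (Q z) \<le> exp (c * (cmod z)\<^sup>2 / Im z)"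
    using quotient_bound_half_plane[OF Q H bd z0] by blast
  have exp_bd: "cmod (Q z) \<le> exp (2 * c * Im z)" if "0 < Im z" for z
  proof (rule phragmen_lindelof_half_plane[OF Q real c _ that])
    fix \<epsilon> :: real assume "\<epsilon> > 0"
    have "cmod (Q z) \<le> exp ((c + \<epsilon>) * (cmod z)\<^sup>2 / Im z)" if "0 < Im z" "cmod z \<ge> cmod z0" for z
    proof -
      have "c * (cmod z)\<^sup>2 / Im z \<le> (c + \<epsilon>) * (cmod z)\<^sup>2 / Im z"
        using that \<open>\<epsilon> > 0\<close> by (intro divide_right_mono mult_right_mono) auto
      then show ?thesis using cb[OF that] by (meson exp_le_cancel_iff order_trans)
    qed
    then show "\<exists>R0. \<forall>z. 0 < Im z \<longrightarrow> R0 \<le> cmod z \<longrightarrow> cmod (Q z) \<le> exp ((c + \<epsilon>) * (cmod z)\<^sup>2 / Im z)" by blast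
  qed
  have eps: "\<exists>M\<ge>1. \<forall>z. 0 < Im z \<longrightarrow> cmod (Q z) \<le> M * exp (\<epsilon> * Im z)" if e: "\<epsilon> > 0" for \<epsilon>
  proof -
    obtain M' where M': "\<And>y. y > 0 \<Longrightarrow> cmod (Q (\<i> * of_real y)) \<le> M' * exp (\<epsilon> * y)" using axis[OF e] by blast
    define M where "M = max 1 M'"
    have M1: "M \<ge> 1" by (simp add: M_def)
    have M: "cmod (Q (\<i> * of_real y)) \<le> M * exp (\<epsilon> * y)" if "y > 0" for y
      by (rule order_trans[OF M'[OF that]]) (simp add: M_def)
    \<comment> \<open>The exponential factor has modulus \<open>exp (- \<epsilon> * Im z)\<close>,
      which brings the values on the imaginary axis below 1 after division by
      \<open>M\<close>.\<close>
    define k where "k z = Q z * exp (\<i> * of_real \<epsilon> * z) / of_real M" for z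
    have nk: "cmod (k z) = cmod (Q z) * exp (- \<epsilon> * Im z) / M" for z
      using M1 by (simp add: k_def norm_mult norm_divide)
    have holk: "k holomorphic_on {z. 0 < Im z}" unfolding k_def
      using M1 by (intro holomorphic_intros Q) auto
    have kQ: "cmod (k z) \<le> cmod (Q z)" if "0 < Im z" for z
    proof -
      have "cmod (Q z) * exp (- \<epsilon> * Im z) \<le> cmod (Q z) * 1" using that e by (intro mult_left_mono) auto
      also have "\<dots> \<le> cmod (Q z) * M" using M1 by (intro mult_left_mono) auto
      finally show ?thesis unfolding nk using M1 by (simp add: divide_le_eq)
    qed
    have kreal: "\<exists>\<delta>>0. \<forall>z. 0 < Im z \<longrightarrow> dist z (of_real x) < \<delta> \<longrightarrow> cmod (k z) \<le> 1" for x :: real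
      using real[of x] kQ by (meson order_trans)
    have kexp: "cmod (k z) \<le> exp (2 * c * Im z)" if "0 < Im z" for z using kQ[OF that] exp_bd[OF that] by simp
    have kaxis: "cmod (k (\<i> * of_real y)) \<le> 1" if "y > 0" for y
    proof -
      have "cmod (Q (\<i> * of_real y)) * exp (- \<epsilon> * y) \<le> M * exp (\<epsilon> * y) * exp (- \<epsilon> * y)"
        by (intro mult_right_mono M that) auto
      then show ?thesis unfolding nk using M1 by (simp add: mult.assoc exp_add[symmetric] divide_le_eq)
    qed
    \<comment> \<open>Reflection in the imaginary axis, z \<mapsto> - cnj z, reduces the left
      quadrant to the right one.\<close>
    define k' where "k' = cnj \<circ> (\<lambda>w. k (- w)) \<circ> cnj"
    have nk': "cmod (k' z) = cmod (k (- cnj z))" for z by (simp add: k'_def)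
    have "k \<circ> (\<lambda>w. - w) holomorphic_on cnj ` {z. 0 < Im z}"
      by (rule holomorphic_on_compose_gen[OF _ holk]) (auto intro!: holomorphic_intros)
    then have "(\<lambda>w. k (- w)) holomorphic_on cnj ` {z. 0 < Im z}" by (simp add: o_def)
    then have holk': "k' holomorphic_on {z. 0 < Im z}"
      unfolding k'_def by (rule holomorphic_on_compose_cnj_cnj) (rule open_halfspace_Im_gt)
    have "cmod (k z) \<le> 1" if z: "0 < Im z" for z
    proof (cases "Re z" "0::real" rule: linorder_cases)
      case greater
      then show ?thesis using phragmen_lindelof_quadrant[OF holk kreal _ kexp kaxis z] c by simp
    next
      case equal
      then have "z = \<i> * of_real (Im z)" by (simp add: complex_eq_iff)
      then show ?thesis using kaxis[OF z] by simp
    next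
      case less
      have "cmod (k' (- cnj z)) \<le> 1"
      proof (rule phragmen_lindelof_quadrant[OF holk'])
        fix x :: real
        obtain d where d: "d > 0" "\<And>z. 0 < Im z \<Longrightarrow> dist z (of_real (-x)) < d \<Longrightarrow> cmod (k z) \<le> 1" using kreal[of "-x"] by blast
        have "dist (- cnj z) (of_real (- x)) = dist z (of_real x)" for z
          by (metis complex_cnj_complex_of_real complex_cnj_diff complex_mod_cnj dist_minus dist_norm of_real_minus)
        then show "\<exists>\<delta>>0. \<forall>z. 0 < Im z \<longrightarrow> dist z (of_real x) < \<delta> \<longrightarrow> cmod (k' z) \<le> 1"
          unfolding nk' using d by (intro exI[of _ d]) auto
      next
        show "cmod (k' z) \<le> exp ((2 * c) * Im z)" if "0 < Im z" for z
          unfolding nk' using kexp[of "- cnj z"] that by simp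
        show "cmod (k' (\<i> * of_real y)) \<le> 1" if "y > 0" for y
          unfolding nk' using kaxis[OF that] by simp
      qed (use z less c in auto)
      then show ?thesis by (simp add: nk')
    qed
    then have "cmod (Q z) \<le> M * exp (\<epsilon> * Im z)" if "0 < Im z" for z
      using that M1 unfolding nk by (auto simp: exp_minus field_simps)
    then show ?thesis using M1 by blast
  qed
  have "cmod (Q z) \<le> exp (2 * 0 * Im z)"
  proof (rule phragmen_lindelof_half_plane[OF Q real _ _ z])
    fix \<epsilon> :: real assume e: "\<epsilon> > 0"
    \<comment> \<open>Half of \<epsilon> is kept for the exponential; the other half absorbs the
      constant \<open>ln M\<close> once |z| is large.\<close>
    obtain M where M: "M \<ge> 1" "\<And>z. 0 < Im z \<Longrightarrow> cmod (Q z) \<le> M * exp (\<epsilon> / 2 * Im z)" using eps[of "\<epsilon>/2"] e by auto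
    have "cmod (Q z) \<le> exp ((0 + \<epsilon>) * (cmod z)\<^sup>2 / Im z)" if z: "0 < Im z" "cmod z \<ge> 2 * ln M / \<epsilon>" for z
    proof -
      have I: "Im z \<le> cmod z" using abs_Im_le_cmod[of z] by simp
      have "cmod (Q z) \<le> exp (ln M + \<epsilon> / 2 * Im z)" using M(2)[OF z(1)] M(1) by (simp add: exp_add)
      also have "\<dots> \<le> exp (\<epsilon> * cmod z)"
      proof -
        have "ln M \<le> \<epsilon> / 2 * cmod z" using z(2) e by (simp add: field_simps)
        moreover have "\<epsilon> / 2 * Im z \<le> \<epsilon> / 2 * cmod z" using I e by (intro mult_left_mono) auto
        ultimately show ?thesis by simp
      qed
      also have "\<dots> \<le> exp (\<epsilon> * ((cmod z)\<^sup>2 / Im z))"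
      proof -
        have "cmod z * Im z \<le> cmod z * cmod z" using I by (intro mult_left_mono) auto
        then have "cmod z \<le> (cmod z)\<^sup>2 / Im z" using z by (simp add: field_simps power2_eq_square)
        from mult_left_mono[OF this, of \<epsilon>] show ?thesis using e by simp
      qed
      finally show ?thesis by simp
    qed
    then show "\<exists>R0. \<forall>z. 0 < Im z \<longrightarrow> R0 \<le> cmod z \<longrightarrow> cmod (Q z) \<le> exp ((0 + \<epsilon>) * (cmod z)\<^sup>2 / Im z)" by blast
  qed auto
  then show ?thesis by simp
qed

section \<open>Square-integrable boundary values\<close>

text \<open>The mean value inequality on the ball bounds every difference quotient by the majorant
  \<open>w\<close> of the derivative, so dominated convergence applies along sequences.\<close>

lemma has_field_derivative_integral:
  fixes f f' :: "complex \<Rightarrow> 'a \<Rightarrow> complex"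
  assumes "r > 0" and int: "\<And>z. z \<in> ball z0 r \<Longrightarrow> integrable M (f z)"
    and der: "\<And>z t. z \<in> ball z0 r \<Longrightarrow> ((\<lambda>z. f z t) has_field_derivative f' z t) (at z)"
    and meas: "f' z0 \<in> borel_measurable M"
    and bd: "\<And>z t. z \<in> ball z0 r \<Longrightarrow> cmod (f' z t) \<le> w t" and w: "integrable M w"
  shows "((\<lambda>z. LINT t|M. f z t) has_field_derivative (LINT t|M. f' z0 t)) (at z0)"
  unfolding has_field_derivative_iff tendsto_at_iff_sequentially
proof (intro allI impI)
  fix X :: "nat \<Rightarrow> complex"
  assume X: "\<forall>i. X i \<in> UNIV - {z0}" "X \<longlonglongrightarrow> z0"
  then obtain N where N: "\<And>n. n \<ge> N \<Longrightarrow> X n \<in> ball z0 r"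
    using \<open>r > 0\<close> by (metis dist_commute lim_sequentially mem_ball)
  define Y where "Y n = X (n + N)" for n
  have Y: "Y n \<in> ball z0 r" "Y n \<noteq> z0" for n using N X(1) by (auto simp: Y_def)
  have Ylim: "Y \<longlonglongrightarrow> z0" unfolding Y_def by (rule LIMSEQ_ignore_initial_segment[OF X(2)])
  have z0: "z0 \<in> ball z0 r" using \<open>r > 0\<close> by simp
  have "(\<lambda>n. LINT t|M. (f (Y n) t - f z0 t) / (Y n - z0)) \<longlonglongrightarrow> (LINT t|M. f' z0 t)"
  proof (rule integral_dominated_convergence[OF meas _ w])
    show "(\<lambda>t. (f (Y n) t - f z0 t) / (Y n - z0)) \<in> borel_measurable M" for n
      using int[OF Y(1)] int[OF z0] by (intro borel_measurable_divide borel_measurable_diff) auto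
    show "AE t in M. (\<lambda>n. (f (Y n) t - f z0 t) / (Y n - z0)) \<longlonglongrightarrow> f' z0 t"
    proof (rule AE_I2)
      fix t
      have "((\<lambda>z. (f z t - f z0 t) / (z - z0)) \<longlongrightarrow> f' z0 t) (at z0)"
        using der[OF z0, of t] by (simp add: has_field_derivative_iff)
      then show "(\<lambda>n. (f (Y n) t - f z0 t) / (Y n - z0)) \<longlonglongrightarrow> f' z0 t"
        unfolding tendsto_at_iff_sequentially o_def using Y Ylim by auto
    qed
    show "AE t in M. norm ((f (Y n) t - f z0 t) / (Y n - z0)) \<le> w t" for n
    proof (rule AE_I2)
      fix t
      have "norm (f (Y n) t - f z0 t) \<le> w t * norm (Y n - z0)"
      proof (rule field_differentiable_bound[of "ball z0 r" "\<lambda>z. f z t" "\<lambda>z. f' z t"])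
        show "((\<lambda>z. f z t) has_field_derivative f' z t) (at z within ball z0 r)" if "z \<in> ball z0 r" for z
          by (rule has_field_derivative_at_within) (rule der[OF that])
      qed (use Y z0 bd in auto)
      then show "norm ((f (Y n) t - f z0 t) / (Y n - z0)) \<le> w t"
        using Y by (simp add: norm_divide divide_le_eq)
    qed
  qed
  also have "(\<lambda>n. LINT t|M. (f (Y n) t - f z0 t) / (Y n - z0)) =
     (\<lambda>n. ((LINT t|M. f (Y n) t) - (LINT t|M. f z0 t)) / (Y n - z0))"
    by (intro ext) (simp add: int[OF Y(1)] int[OF z0])
  finally have *: "(\<lambda>n. ((LINT t|M. f (X (n + N)) t) - (LINT t|M. f z0 t)) / (X (n + N) - z0)) \<longlonglongrightarrow> (LINT t|M. f' z0 t)"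
    unfolding Y_def .
  show "((\<lambda>z. ((LINT t|M. f z t) - (LINT t|M. f z0 t)) / (z - z0)) \<circ> X) \<longlonglongrightarrow> (LINT t|M. f' z0 t)"
    unfolding o_def by (rule LIMSEQ_offset[where k = N]) (rule *)
qed

section \<open>Poisson kernels and Herglotz transforms\<close>

lemma integrable_inverse_one_plus_square:
  "integrable lborel (\<lambda>t::real. 1 / (1 + t\<^sup>2))"
  using integrable_inverse_1_plus_square by (simp add: set_integrable_def inverse_eq_divide)

lemma integral_inverse_one_plus_square: "(LINT t|lborel. 1 / (1 + t\<^sup>2)) = pi"
  using LBINT_inverse_1_plus_square
  by (simp add: interval_lebesgue_integral_def set_lebesgue_integral_def inverse_eq_divide)

lemma cmod_diff_of_real_sq: "(cmod (z - of_real t))\<^sup>2 = (Re z - t)\<^sup>2 + (Im z)\<^sup>2"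
  by (simp add: cmod_power2)

lemma
  assumes y: "0 < Im z"
  shows poisson_integrable: "integrable lborel (\<lambda>t. 1 / (cmod (z - of_real t))\<^sup>2)"
    and poisson_integral: "(LINT t|lborel. 1 / (cmod (z - of_real t))\<^sup>2) = pi / Im z"
proof -
  have e: "1 / (cmod (z - of_real (Re z + Im z * s)))\<^sup>2 = 1 / (Im z)\<^sup>2 * (1 / (1 + s\<^sup>2))" for s
    unfolding cmod_diff_of_real_sq using y by (simp add: power_mult_distrib field_simps)
  show "integrable lborel (\<lambda>t. 1 / (cmod (z - of_real t))\<^sup>2)"
  proof (subst lborel_integrable_real_affine_iff[where c = "Im z" and t = "Re z", symmetric])
    show "integrable lborel (\<lambda>s. 1 / (cmod (z - of_real (Re z + Im z * s)))\<^sup>2)"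
      unfolding e by (intro integrable_mult_right integrable_inverse_one_plus_square)
  qed (use y in auto)
  have "(LINT t|lborel. 1 / (cmod (z - of_real t))\<^sup>2) = \<bar>Im z\<bar> *\<^sub>R (LINT s|lborel. 1 / (cmod (z - of_real (Re z + Im z * s)))\<^sup>2)"
    by (rule lborel_integral_real_affine) (use y in auto)
  also have "\<dots> = pi / Im z"
    unfolding e integral_mult_right_zero integral_inverse_one_plus_square using y by (simp add: power2_eq_square)
  finally show "(LINT t|lborel. 1 / (cmod (z - of_real t))\<^sup>2) = pi / Im z" .
qed

text \<open>The factor in front makes the real part on the upper half plane the Poisson integral of
  \<open>w\<close>.\<close>

definition herglotz :: "(real \<Rightarrow> real) \<Rightarrow> complex \<Rightarrow> complex" where
  "herglotz w z = \<i> / of_real pi * (LINT t|lborel. of_real (w t) / (z - of_real t))"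

lemma diff_of_real_nonzero: "0 < Im z \<Longrightarrow> z - of_real t \<noteq> 0"
  by (auto simp: complex_eq_iff)

lemma Im_le_cmod_diff_of_real: "Im z \<le> cmod (z - of_real t)"
  using abs_Im_le_cmod[of "z - of_real t"] by simp

lemma herglotz_integrable:
  assumes w: "integrable lborel w" and z: "0 < Im z"
  shows "integrable lborel (\<lambda>t. complex_of_real (w t) / (z - of_real t))"
proof (rule Bochner_Integration.integrable_bound)
  show "integrable lborel (\<lambda>t. w t / Im z)" using w by simp
  show "(\<lambda>t. complex_of_real (w t) / (z - of_real t)) \<in> borel_measurable lborel"
    using w by measurable
  show "AE t in lborel. norm (complex_of_real (w t) / (z - of_real t)) \<le> norm (w t / Im z)"
  proof (rule AE_I2)
    fix t
    show "norm (complex_of_real (w t) / (z - of_real t)) \<le> norm (w t / Im z)"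
      using z Im_le_cmod_diff_of_real[of z t] diff_of_real_nonzero[OF z, of t]
      by (auto simp: norm_divide intro!: divide_left_mono mult_pos_pos)
  qed
qed

lemma herglotz_holomorphic:
  assumes w: "integrable lborel w"
  shows "herglotz w holomorphic_on {z. 0 < Im z}"
proof -
  have "(\<lambda>z. LINT t|lborel. complex_of_real (w t) / (z - of_real t)) holomorphic_on {z. 0 < Im z}"
    unfolding holomorphic_on_open[OF open_halfspace_Im_gt]
  proof (intro ballI exI)
    fix z0 assume "z0 \<in> {z. 0 < Im z}"
    then have z0: "0 < Im z0" by simp
    have I: "Im z0 / 2 < Im z" if "z \<in> ball z0 (Im z0 / 2)" for z
      using abs_Im_le_cmod[of "z0 - z"] that by (auto simp: dist_norm)
    show "((\<lambda>z. LINT t|lborel. complex_of_real (w t) / (z - of_real t)) has_field_derivative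
        (LINT t|lborel. - complex_of_real (w t) / (z0 - of_real t)\<^sup>2)) (at z0)"
    proof (rule has_field_derivative_integral[where r = "Im z0 / 2" and w = "\<lambda>t. \<bar>w t\<bar> / (Im z0 / 2)\<^sup>2"
          and f' = "\<lambda>z t. - complex_of_real (w t) / (z - of_real t)\<^sup>2"])
      show "Im z0 / 2 > 0" using z0 by simp
      fix z assume z: "z \<in> ball z0 (Im z0 / 2)"
      have Iz: "0 < Im z" using I[OF z] z0 by simp
      show "integrable lborel (\<lambda>t. complex_of_real (w t) / (z - of_real t))"
        by (rule herglotz_integrable[OF w Iz])
      fix t
      show "((\<lambda>z. complex_of_real (w t) / (z - of_real t)) has_field_derivative - complex_of_real (w t) / (z - of_real t)\<^sup>2) (at z)"
        using diff_of_real_nonzero[OF Iz, of t] by (auto intro!: derivative_eq_intros simp: power2_eq_square)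
      have "Im z0 / 2 \<le> cmod (z - of_real t)" using I[OF z] Im_le_cmod_diff_of_real[of z t] by linarith
      then have "(Im z0 / 2)\<^sup>2 \<le> (cmod (z - of_real t))\<^sup>2" using z0 by (intro power_mono) auto
      then show "cmod (- complex_of_real (w t) / (z - of_real t)\<^sup>2) \<le> \<bar>w t\<bar> / (Im z0 / 2)\<^sup>2"
        unfolding norm_divide norm_power norm_minus_cancel norm_of_real
        using z0 diff_of_real_nonzero[OF Iz, of t] by (intro divide_left_mono mult_pos_pos) auto
    qed (use w in \<open>auto\<close>)
  qed
  then show ?thesis unfolding herglotz_def by (intro holomorphic_intros) auto
qed

lemma Re_herglotz:
  assumes w: "integrable lborel w" and z: "0 < Im z"
  shows "Re (herglotz w z) = (LINT t|lborel. w t * (Im z / (cmod (z - of_real t))\<^sup>2)) / pi"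
    and "integrable lborel (\<lambda>t. w t * (Im z / (cmod (z - of_real t))\<^sup>2))"
proof -
  have e: "Im (complex_of_real (w t) / (z - of_real t)) = - (w t * (Im z / (cmod (z - of_real t))\<^sup>2))" for t
    unfolding cmod_power2 by (simp add: Im_divide)
  have "Re (herglotz w z) = - Im (LINT t|lborel. complex_of_real (w t) / (z - of_real t)) / pi"
  proof -
    have "Re (\<i> / of_real pi * u) = - Im u / pi" for u :: complex
    proof -
      have "\<i> / of_real pi * u = \<i> * u / of_real pi" by simp
      then show ?thesis by (simp only: Re_divide_of_real) simp
    qed
    then show ?thesis by (simp only: herglotz_def)
  qed
  also have "Im (LINT t|lborel. complex_of_real (w t) / (z - of_real t)) = (LINT t|lborel. Im (complex_of_real (w t) / (z - of_real t)))"
    by (rule integral_Im[symmetric]) (rule herglotz_integrable[OF w z])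
  finally show "Re (herglotz w z) = (LINT t|lborel. w t * (Im z / (cmod (z - of_real t))\<^sup>2)) / pi"
    unfolding e by simp
  have "integrable lborel (\<lambda>t. Im (complex_of_real (w t) / (z - of_real t)))"
    by (rule integrable_Im) (rule herglotz_integrable[OF w z])
  then show "integrable lborel (\<lambda>t. w t * (Im z / (cmod (z - of_real t))\<^sup>2))" unfolding e by simp
qed

text \<open>On the window of radius \<open>Im z\<close> about \<open>Re z\<close> the kernel
  \<open>Im z / (cmod (z - of_real t))^2\<close> is at least 1 / (2 Im z), and the window has length
  2 Im z. Only values of \<open>w\<close> in that window are needed, so the lower bound is
  local.\<close>

lemma Re_herglotz_ge:
  assumes w: "integrable lborel w" and pos: "\<And>t. w t \<ge> 0" and z: "0 < Im z"
    and s: "s \<ge> 0" "\<And>t. \<bar>t - Re z\<bar> < Im z \<Longrightarrow> s \<le> w t"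
  shows "Re (herglotz w z) \<ge> s / pi"
proof -
  define J where "J = {Re z - Im z<..<Re z + Im z}"
  have "s = (LINT t|lborel. indicator J t * (s / (2 * Im z)))"
    using z by (simp add: J_def)
  also have "\<dots> \<le> (LINT t|lborel. w t * (Im z / (cmod (z - of_real t))\<^sup>2))"
  proof (rule integral_mono)
    show "integrable lborel (\<lambda>t. indicator J t * (s / (2 * Im z)))"
      using z by (intro integrable_mult_left integrable_real_indicator) (auto simp: J_def)
    show "integrable lborel (\<lambda>t. w t * (Im z / (cmod (z - of_real t))\<^sup>2))" by (rule Re_herglotz(2)[OF w z])
    fix t
    show "indicator J t * (s / (2 * Im z)) \<le> w t * (Im z / (cmod (z - of_real t))\<^sup>2)"
    proof (cases "t \<in> J")
      case True
      then have t: "\<bar>t - Re z\<bar> < Im z" by (auto simp: J_def)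
      have "\<bar>Re z - t\<bar>\<^sup>2 \<le> (Im z)\<^sup>2" by (rule power_mono) (use t in auto)
      then have c: "(cmod (z - of_real t))\<^sup>2 \<le> 2 * (Im z)\<^sup>2" unfolding cmod_diff_of_real_sq by simp
      have "s / (2 * Im z) = s * (Im z / (2 * (Im z)\<^sup>2))" using z by (simp add: power2_eq_square)
      also have "\<dots> \<le> w t * (Im z / (cmod (z - of_real t))\<^sup>2)"
        using c z s(2)[OF t] s(1) pos diff_of_real_nonzero[OF z, of t] by (intro mult_mono divide_left_mono mult_pos_pos) auto
      finally show ?thesis using True by simp
    qed (use pos z in auto)
  qed
  finally show ?thesis unfolding Re_herglotz(1)[OF w z] by (intro divide_right_mono) auto
qed

lemma norm_herglotz_le:
  assumes w: "integrable lborel w" and z: "0 < Im z"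
  shows "cmod (herglotz w z) \<le> (LINT t|lborel. \<bar>w t\<bar>) / (pi * Im z)"
proof -
  have "cmod (LINT t|lborel. complex_of_real (w t) / (z - of_real t)) \<le> (LINT t|lborel. \<bar>w t\<bar> / Im z)"
  proof (rule order_trans[OF integral_norm_bound], rule integral_mono)
    show "integrable lborel (\<lambda>t. cmod (complex_of_real (w t) / (z - of_real t)))"
      by (intro integrable_norm herglotz_integrable[OF w z])
    show "integrable lborel (\<lambda>t. \<bar>w t\<bar> / Im z)" using w by simp
    show "cmod (complex_of_real (w t) / (z - of_real t)) \<le> \<bar>w t\<bar> / Im z" for t
      using z Im_le_cmod_diff_of_real[of z t] diff_of_real_nonzero[OF z, of t]
      by (auto simp: norm_divide intro!: divide_left_mono mult_pos_pos)
  qed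
  from divide_right_mono[OF this, of pi]
  have "cmod (herglotz w z) \<le> (LINT t|lborel. \<bar>w t\<bar> / Im z) / pi"
    unfolding herglotz_def norm_mult norm_divide by simp
  then show ?thesis by (simp add: mult.commute)
qed

text \<open>Dividing \<open>q\<^sup>2\<close> by \<open>1 + K\<close>, where \<open>K\<close> has the Poisson integral of \<open>\<bar>q\<bar>\<^sup>2\<close> as real part,
  gives a function with bounded boundary values. The constant \<open>2\<pi>\<close> is not optimal.\<close>

locale boundary_square_integrable =
  fixes q :: "complex \<Rightarrow> complex"
  assumes holq: "q holomorphic_on {z. 0 < Im z}"
    and contq: "continuous_on {z. 0 \<le> Im z} q"
    and sq: "square_integrable (\<lambda>x. q (of_real x))"
begin

definition K :: "complex \<Rightarrow> complex" where "K = herglotz (\<lambda>t. (cmod (q (of_real t)))\<^sup>2)"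

definition Q :: "complex \<Rightarrow> complex" where "Q z = (q z)\<^sup>2 / (of_real (2 * pi) * (1 + K z))"

lemma norm_sq_integrable: "integrable lborel (\<lambda>t. (cmod (q (of_real t)))\<^sup>2)"
  using sq by (simp add: square_integrable_def)

lemma Re_K_nonneg: "0 < Im z \<Longrightarrow> Re (K z) \<ge> 0"
  using Re_herglotz_ge[OF norm_sq_integrable _ _ order_refl] by (simp add: K_def)

lemma norm_one_plus_K: "0 < Im z \<Longrightarrow> 1 + Re (K z) \<le> cmod (1 + K z)" "0 < Im z \<Longrightarrow> 1 \<le> cmod (1 + K z)"
  using complex_Re_le_cmod[of "1 + K z"] Re_K_nonneg[of z] by auto

lemma holK: "K holomorphic_on {z. 0 < Im z}"
  unfolding K_def by (rule herglotz_holomorphic[OF norm_sq_integrable])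

lemma one_plus_K_nonzero: "0 < Im z \<Longrightarrow> 1 + K z \<noteq> 0"
  using norm_one_plus_K(2)[of z] by auto

lemma holQ: "Q holomorphic_on {z. 0 < Im z}"
  unfolding Q_def by (intro holomorphic_intros holq holK) (use one_plus_K_nonzero in auto)

lemma norm_Q: "cmod (Q z) = (cmod (q z))\<^sup>2 / (2 * pi * cmod (1 + K z))"
  by (simp add: Q_def norm_mult norm_divide norm_power)

lemma Q_le_q: assumes "0 < Im z" shows "cmod (Q z) \<le> (cmod (q z))\<^sup>2"
proof -
  have "1 \<le> 2 * pi" using pi_ge_two by simp
  then have "1 * 1 \<le> 2 * pi * cmod (1 + K z)"
    using norm_one_plus_K(2)[OF assms] by (intro mult_mono) auto
  then show ?thesis unfolding norm_Q by (simp add: divide_le_eq mult_left_le_imp_le mult_le_cancel_left1)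
qed

text \<open>Near \<open>x0\<close> the density |q|^2 stays within 1 of its value s at
  \<open>x0\<close>, so the local lower bound gives 2 \<pi> |1 + K| \<ge> 2 \<pi> + 2 max 0 (s - 1).
  This exceeds s + 1, hence |q|^2.\<close>

lemma Q_boundary: "\<exists>\<delta>>0. \<forall>z. 0 < Im z \<longrightarrow> dist z (of_real x0) < \<delta> \<longrightarrow> cmod (Q z) \<le> 1"
proof -
  define s where "s = (cmod (q (of_real x0)))\<^sup>2"
  have "continuous_on {z. 0 \<le> Im z} (\<lambda>z. (cmod (q z))\<^sup>2)" by (intro continuous_intros contq)
  then obtain d where d: "d > 0"
    "\<And>z. 0 \<le> Im z \<Longrightarrow> dist z (of_real x0) < d \<Longrightarrow> dist ((cmod (q z))\<^sup>2) s < 1"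
    unfolding continuous_on_iff s_def using zero_less_one by (metis Im_complex_of_real mem_Collect_eq order_refl)
  \<comment> \<open>Half the radius: a point t of the window about \<open>Re z\<close> satisfies |t
    - x0| < d/2 + d/2.\<close>
  have "cmod (Q z) \<le> 1" if z: "0 < Im z" "dist z (of_real x0) < d / 2" for z
  proof -
    have "max 0 (s - 1) / pi \<le> Re (K z)" unfolding K_def
    proof (rule Re_herglotz_ge[OF norm_sq_integrable])
      fix t assume t: "\<bar>t - Re z\<bar> < Im z"
      have "\<bar>Re z - x0\<bar> \<le> dist z (of_real x0)" using abs_Re_le_cmod[of "z - of_real x0"] by (simp add: dist_norm)
      moreover have "Im z \<le> dist z (of_real x0)" using Im_le_cmod_diff_of_real[of z x0] by (simp add: dist_norm)
      ultimately have "\<bar>t - x0\<bar> < d" using t z by linarith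
      then have "dist (complex_of_real t) (of_real x0) < d" by (simp add: dist_of_real dist_real_def)
      then have "dist ((cmod (q (of_real t)))\<^sup>2) s < 1" by (intro d(2)) auto
      then show "max 0 (s - 1) \<le> (cmod (q (of_real t)))\<^sup>2" by (auto simp: dist_real_def)
    qed (use z in auto)
    then have "1 + max 0 (s - 1) / pi \<le> cmod (1 + K z)" using norm_one_plus_K(1)[OF z(1)] by linarith
    then have "2 * pi * (1 + max 0 (s - 1) / pi) \<le> 2 * pi * cmod (1 + K z)" by (intro mult_left_mono) auto
    then have "2 * pi + 2 * max 0 (s - 1) \<le> 2 * pi * cmod (1 + K z)" by (simp add: distrib_left)
    moreover have "dist ((cmod (q z))\<^sup>2) s < 1" using z d by (intro d(2)) auto
    ultimately have "(cmod (q z))\<^sup>2 \<le> 2 * pi * cmod (1 + K z)"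
      using pi_ge_two max.cobounded1[of 0 "s - 1"] max.cobounded2[of "s - 1" 0]
    proof -
      have "u \<le> v" if "2 * p + 2 * m \<le> v" "\<bar>u - s\<bar> < 1" "2 \<le> p" "0 \<le> m" "s - 1 \<le> m" for u v p m :: real
        using that by linarith
      then show "(cmod (q z))\<^sup>2 \<le> 2 * pi * cmod (1 + K z)"
        using \<open>2 * pi + 2 * max 0 (s - 1) \<le> 2 * pi * cmod (1 + K z)\<close> \<open>dist ((cmod (q z))\<^sup>2) s < 1\<close> pi_ge_two
        unfolding dist_real_def by (meson max.cobounded1 max.cobounded2)
    qed
    moreover have "cmod (1 + K z) > 0" using norm_one_plus_K(2)[OF z(1)] by linarith
    then have "2 * pi * cmod (1 + K z) > 0" by simp
    ultimately show ?thesis unfolding norm_Q by (simp only: divide_le_eq_1_pos)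
  qed
  then show ?thesis using d(1) by (intro exI[of _ "d/2"]) auto
qed

lemma q_sq_le:
  assumes "0 < Im z" "cmod (Q z) \<le> 1"
  shows "(cmod (q z))\<^sup>2 \<le> 2 * pi * cmod (1 + K z)"
proof -
  have "cmod (1 + K z) > 0" using norm_one_plus_K(2)[OF assms(1)] by linarith
  then have "2 * pi * cmod (1 + K z) > 0" by simp
  then show ?thesis using assms(2) unfolding norm_Q by (simp only: divide_le_eq_1_pos)
qed

text \<open>The Phragmen-Lindelof principle extends the boundary bound |Q| \<le> 1 to the half
  plane, that is, |q|^2 \<le> 2 \<pi> |1 + K|; and \<open>K\<close> is O(1 / Im z) because its
  density is integrable.\<close>

lemma pointwise_bound:
  assumes "q \<in> nevanlinna0"
  shows "\<exists>A\<ge>0. \<forall>z. 0 < Im z \<longrightarrow> (cmod (q z))\<^sup>2 \<le> A * (1 + 1 / Im z)"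
proof -
  obtain g h z0 where gh: "bounded (g ` {z. 0 < Im z})"
    "h holomorphic_on {z. 0 < Im z}" "bounded (h ` {z. 0 < Im z})" "0 < Im z0" "h z0 \<noteq> 0"
    "\<And>z. 0 < Im z \<Longrightarrow> h z \<noteq> 0 \<Longrightarrow> q z = g z / h z"
    using assms unfolding nevanlinna0_def nevanlinna_def upper_half_plane_def by auto
  obtain B1 B2 where B12: "\<And>z. 0 < Im z \<Longrightarrow> cmod (g z) \<le> B1" "\<And>z. 0 < Im z \<Longrightarrow> cmod (h z) \<le> B2"
    using gh(1,3) unfolding bounded_iff by auto
  define B where "B = max 1 (max B1 B2)"
  have B: "B > 0" "\<And>z. 0 < Im z \<Longrightarrow> cmod (g z) \<le> B" "\<And>z. 0 < Im z \<Longrightarrow> cmod (h z) \<le> B"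
    using B12 by (auto simp: B_def le_max_iff_disj)
  have qh: "cmod (q z * h z) \<le> B" if "0 < Im z" for z
    using gh(6)[OF that] B(1) B(2)[OF that] by (cases "h z = 0") auto
  \<comment> \<open>The denominator is squared because \<open>Q\<close> is quadratic in
    \<open>q\<close>, and normalised so that both \<open>H\<close> and \<open>Q * H\<close> are
    bounded by 1.\<close>
  define H where "H z = (h z / of_real B)\<^sup>2" for z
  have Q1: "cmod (Q z) \<le> 1" if "0 < Im z" for z
  proof (rule phragmen_lindelof_bounded_type[OF holQ _ _ _ gh(4) _ Q_boundary _ that])
    show "H holomorphic_on {z. 0 < Im z}" unfolding H_def using B(1) by (intro holomorphic_intros gh) auto
    show "H z0 \<noteq> 0" using gh B by (simp add: H_def)
    fix z assume z: "0 < Im z"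
    show "cmod (H z) \<le> 1" unfolding H_def norm_power
      by (intro power_le_one) (use B z in \<open>auto simp: norm_divide\<close>)
    have "cmod (Q z * H z) \<le> (cmod (q z))\<^sup>2 * cmod (H z)"
      unfolding norm_mult by (intro mult_right_mono Q_le_q z) auto
    also have "\<dots> = (cmod (q z * h z) / B)\<^sup>2" using B(1) by (simp add: H_def norm_mult norm_divide norm_power power_mult_distrib power_divide)
    also have "\<dots> \<le> 1" by (intro power_le_one) (use qh[OF z] B(1) in auto)
    finally show "cmod (Q z * H z) \<le> 1" .
  next
    fix \<epsilon> :: real assume e: "\<epsilon> > 0"
    have "mean_type q < ereal (\<epsilon> / 2)"
      using assms e by (auto simp: nevanlinna0_def intro: le_less_trans)
    then have "eventually (\<lambda>y::real. (if q (\<i> * of_real y) = 0 then - \<infinity> else ereal (ln (cmod (q (\<i> * of_real y))) / y)) < ereal (\<epsilon> / 2)) at_top"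
      unfolding mean_type_def by (rule Limsup_lessD)
    then obtain Y0 where Y0: "\<And>y. y \<ge> Y0 \<Longrightarrow> (if q (\<i> * of_real y) = 0 then - \<infinity> else ereal (ln (cmod (q (\<i> * of_real y))) / y)) < ereal (\<epsilon> / 2)"
      unfolding eventually_at_top_linorder by blast
    have big: "cmod (q (\<i> * of_real y)) \<le> exp (\<epsilon> / 2 * y)" if y: "y \<ge> Y0" "y > 0" for y
    proof (cases "q (\<i> * of_real y) = 0")
      case False
      then have "ln (cmod (q (\<i> * of_real y))) / y < \<epsilon> / 2" using Y0[OF y(1)] by simp
      then have "ln (cmod (q (\<i> * of_real y))) < \<epsilon> / 2 * y" using y by (simp add: divide_less_eq)
      then have "exp (ln (cmod (q (\<i> * of_real y)))) \<le> exp (\<epsilon> / 2 * y)" by simp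
      then show ?thesis using False by simp
    qed auto
    \<comment> \<open>The mean type controls only large y; the remaining segment is compact and
      \<open>q\<close> is continuous down to the real line.\<close>
    have "continuous_on {0..Y0} (\<lambda>y. q (\<i> * of_real y))"
      by (rule continuous_on_compose2[OF contq]) (auto intro!: continuous_intros)
    then have "compact ((\<lambda>y. q (\<i> * of_real y)) ` {0..Y0})" by (rule compact_continuous_image) simp
    then have "bounded ((\<lambda>y. q (\<i> * of_real y)) ` {0..Y0})" by (rule compact_imp_bounded)
    then obtain M where M: "\<And>y. 0 \<le> y \<Longrightarrow> y \<le> Y0 \<Longrightarrow> cmod (q (\<i> * of_real y)) \<le> M"
      unfolding bounded_iff by (metis atLeastAtMost_iff imageI)
    have qb: "cmod (q (\<i> * of_real y)) \<le> max 1 M * exp (\<epsilon> / 2 * y)" if y: "y > 0" for y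
    proof (cases "y \<ge> Y0")
      case True
      have "1 * exp (\<epsilon> / 2 * y) \<le> max 1 M * exp (\<epsilon> / 2 * y)" by (intro mult_right_mono) auto
      then show ?thesis using big[OF True y] by linarith
    next
      case False
      have "cmod (q (\<i> * of_real y)) \<le> max 1 M * 1" using M[of y] y False by auto
      also have "\<dots> \<le> max 1 M * exp (\<epsilon> / 2 * y)" using e y by (intro mult_left_mono) auto
      finally show ?thesis .
    qed
    have "cmod (Q (\<i> * of_real y)) \<le> (max 1 M)\<^sup>2 * exp (\<epsilon> * y)" if "y > 0" for y
    proof -
      have "cmod (Q (\<i> * of_real y)) \<le> (cmod (q (\<i> * of_real y)))\<^sup>2" using that by (intro Q_le_q) auto
      also have "\<dots> \<le> (max 1 M * exp (\<epsilon> / 2 * y))\<^sup>2" by (intro power_mono qb that) auto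
      also have "\<dots> = (max 1 M)\<^sup>2 * exp (\<epsilon> * y)" by (simp add: power_mult_distrib power2_eq_square exp_add[symmetric])
      finally show ?thesis .
    qed
    then show "\<exists>M. \<forall>y>0. cmod (Q (\<i> * of_real y)) \<le> M * exp (\<epsilon> * y)" by blast
  qed
  define I where "I = (LINT t|lborel. \<bar>(cmod (q (of_real t)))\<^sup>2\<bar>)"
  have I0: "I \<ge> 0" unfolding I_def by simp
  have "(cmod (q z))\<^sup>2 \<le> (2 * pi + 2 * I) * (1 + 1 / Im z)" if z: "0 < Im z" for z
  proof -
    have "(cmod (q z))\<^sup>2 \<le> 2 * pi * cmod (1 + K z)" by (rule q_sq_le[OF z Q1[OF z]])
    also have "\<dots> \<le> 2 * pi * (1 + I / (pi * Im z))"
    proof (intro mult_left_mono)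
      have "cmod (1 + K z) \<le> 1 + cmod (K z)" using norm_triangle_ineq[of 1 "K z"] by simp
      then show "cmod (1 + K z) \<le> 1 + I / (pi * Im z)"
        using norm_herglotz_le[OF norm_sq_integrable z] by (simp add: K_def I_def)
    qed simp
    also have "\<dots> = 2 * pi + 2 * I * (1 / Im z)" by (simp add: field_simps)
    also have "\<dots> \<le> (2 * pi + 2 * I) * (1 + 1 / Im z)"
    proof -
      have "0 \<le> 2 * I + 2 * pi / Im z" using z I0 by simp
      then show ?thesis by (simp add: distrib_left distrib_right add_divide_distrib)
    qed
    finally show ?thesis .
  qed
  then show ?thesis using I0 by (intro exI[of _ "2 * pi + 2 * I"]) auto
qed

text \<open>The term a / Im z is negligible against \<eta> |z|^2 / Im z for large |z|, so the half
  plane principle with constant 0 gives |Q| \<le> 1. Then \<open>(1 + K)\<close> to the power -1/2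
  is an explicit bounded denominator for \<open>q\<close>: the square of the product has modulus at
  most 2 \<pi>. The growth along the imaginary axis gives the mean type.\<close>

lemma in_nevanlinna0:
  assumes a: "a \<ge> 0"
    and growth: "\<And>\<epsilon>. \<epsilon> > 0 \<Longrightarrow> \<exists>C. \<forall>z. 0 < Im z \<longrightarrow> cmod (q z) \<le> C * exp (\<epsilon> * Im z + a / Im z)"
  shows "q \<in> nevanlinna0"
proof -
  have growth1: "\<exists>C\<ge>1. \<forall>z. 0 < Im z \<longrightarrow> cmod (q z) \<le> C * exp (\<epsilon> * Im z + a / Im z)" if e: "\<epsilon> > 0" for \<epsilon>
  proof -
    obtain C where C: "\<And>z. 0 < Im z \<Longrightarrow> cmod (q z) \<le> C * exp (\<epsilon> * Im z + a / Im z)"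
      using growth[OF e] by blast
    have "cmod (q z) \<le> max 1 C * exp (\<epsilon> * Im z + a / Im z)" if "0 < Im z" for z
      by (rule order_trans[OF C[OF that]]) (intro mult_right_mono, auto)
    then show ?thesis by (intro exI[of _ "max 1 C"]) auto
  qed
  have Q1: "cmod (Q z) \<le> 1" if z: "0 < Im z" for z
  proof -
    have "cmod (Q z) \<le> exp (2 * 0 * Im z)"
    proof (rule phragmen_lindelof_half_plane[OF holQ Q_boundary _ _ z])
      fix \<eta> :: real assume e: "\<eta> > 0"
      \<comment> \<open>Squaring \<open>q\<close> doubles \<eta>/4 to \<eta>/2; the other \<eta>/2
        absorbs the contributions of \<open>a\<close> and \<open>ln C\<close> beyond the radius
        \<open>R0\<close>.\<close>
      obtain C where C: "C \<ge> 1" "\<And>z. 0 < Im z \<Longrightarrow> cmod (q z) \<le> C * exp (\<eta> / 4 * Im z + a / Im z)"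
        using growth1[of "\<eta> / 4"] e by auto
      define R0 where "R0 = max 1 (2 * (2 * a + 2 * ln C) / \<eta>)"
      have "cmod (Q z) \<le> exp ((0 + \<eta>) * (cmod z)\<^sup>2 / Im z)" if z: "0 < Im z" "cmod z \<ge> R0" for z
      proof -
        have I: "Im z \<le> cmod z" using abs_Im_le_cmod[of z] by simp
        have lnC: "ln C \<ge> 0" using C(1) by simp
        have R: "cmod z \<ge> 1" "2 * (2 * a + 2 * ln C) / \<eta> \<le> cmod z" using z(2) by (auto simp: R0_def)
        have "2 * a + 2 * ln C * Im z \<le> 2 * a * cmod z + 2 * ln C * cmod z"
          using a lnC R(1) I by (intro add_mono mult_left_mono) (auto simp: mult_le_cancel_left1)
        also have "\<dots> \<le> (\<eta> / 2 * cmod z) * cmod z"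
          unfolding distrib_right[symmetric] using R e by (intro mult_right_mono) (auto simp: field_simps)
        finally have 1: "2 * a + 2 * ln C * Im z \<le> \<eta> / 2 * (cmod z)\<^sup>2" by (simp add: power2_eq_square)
        have "Im z * Im z \<le> cmod z * cmod z" using I z by (intro mult_mono) auto
        then have 2: "\<eta> / 2 * (Im z * Im z) \<le> \<eta> / 2 * (cmod z)\<^sup>2" using e by (intro mult_left_mono) (auto simp: power2_eq_square)
        have "2 * (ln C + (\<eta> / 4 * Im z + a / Im z)) = (2 * a + 2 * ln C * Im z + \<eta> / 2 * (Im z * Im z)) / Im z"
          using z by (simp add: field_simps)
        also have "\<dots> \<le> (\<eta> * (cmod z)\<^sup>2) / Im z"
          using 1 2 z by (intro divide_right_mono) auto
        finally have 3: "2 * (ln C + (\<eta> / 4 * Im z + a / Im z)) \<le> \<eta> * (cmod z)\<^sup>2 / Im z" .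
        have "cmod (Q z) \<le> (cmod (q z))\<^sup>2" by (rule Q_le_q[OF z(1)])
        also have "\<dots> \<le> (exp (ln C + (\<eta> / 4 * Im z + a / Im z)))\<^sup>2"
          using C(2)[OF z(1)] C(1) by (intro power_mono) (auto simp: exp_add)
        also have "\<dots> = exp (2 * (ln C + (\<eta> / 4 * Im z + a / Im z)))"
          by (simp add: power2_eq_square exp_add[symmetric])
        also have "\<dots> \<le> exp (\<eta> * (cmod z)\<^sup>2 / Im z)" using 3 by simp
        finally show ?thesis by simp
      qed
      then show "\<exists>R0. \<forall>z. 0 < Im z \<longrightarrow> R0 \<le> cmod z \<longrightarrow> cmod (Q z) \<le> exp ((0 + \<eta>) * (cmod z)\<^sup>2 / Im z)" by blast
    qed auto
    then show ?thesis by simp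
  qed
  \<comment> \<open>The principal root is holomorphic here because \<open>1 + K\<close> has real
    part at least 1.\<close>
  define h where "h z = 1 / csqrt (1 + K z)" for z
  have nh: "(cmod (h z))\<^sup>2 = 1 / cmod (1 + K z)" for z by (simp add: h_def norm_divide power_divide)
  have holh: "h holomorphic_on {z. 0 < Im z}" unfolding h_def
  proof (intro holomorphic_intros holK)
    fix z assume "z \<in> {z. 0 < Im z}"
    then have z: "0 < Im z" by simp
    show "1 + K z \<notin> \<real>\<^sub>\<le>\<^sub>0" using Re_K_nonneg[OF z] by (auto simp: complex_nonpos_Reals_iff)
    show "csqrt (1 + K z) \<noteq> 0" using one_plus_K_nonzero[OF z] by simp
  qed
  have h_nz: "h z \<noteq> 0" if "0 < Im z" for z using one_plus_K_nonzero[OF that] by (simp add: h_def)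
  have "q \<in> nevanlinna" unfolding nevanlinna_def upper_half_plane_def
  proof (intro CollectI conjI holq exI)
    show "(\<lambda>z. q z * h z) holomorphic_on {z. 0 < Im z}" by (intro holomorphic_intros holq holh)
    show "h holomorphic_on {z. 0 < Im z}" by (rule holh)
    show "bounded (h ` {z. 0 < Im z})"
    proof (rule boundedI)
      fix u assume "u \<in> h ` {z. 0 < Im z}"
      then obtain z where z: "u = h z" "0 < Im z" by auto
      have "(cmod (h z))\<^sup>2 \<le> 1" unfolding nh using norm_one_plus_K(2)[OF z(2)] by (simp add: divide_le_eq)
      then show "norm u \<le> 1" using z by (simp add: abs_square_le_1)
    qed
    show "bounded ((\<lambda>z. q z * h z) ` {z. 0 < Im z})"
    proof (rule boundedI)
      fix u assume "u \<in> (\<lambda>z. q z * h z) ` {z. 0 < Im z}"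
      then obtain z where z: "u = q z * h z" "0 < Im z" by auto
      have "(cmod (q z * h z))\<^sup>2 = (cmod (q z))\<^sup>2 / cmod (1 + K z)"
        unfolding norm_mult power_mult_distrib nh by simp
      also have "\<dots> \<le> 2 * pi" using q_sq_le[OF z(2) Q1[OF z(2)]] norm_one_plus_K(2)[OF z(2)]
        by (simp add: divide_le_eq)
      finally show "norm u \<le> sqrt (2 * pi)" using z by (simp add: real_le_rsqrt)
    qed
    show "\<exists>z\<in>{z. 0 < Im z}. h z \<noteq> 0" using h_nz[of \<i>] by (intro bexI[of _ \<i>]) auto
    show "\<forall>z\<in>{z. 0 < Im z}. h z \<noteq> 0 \<longrightarrow> q z = q z * h z / h z" by auto
  qed
  moreover have "mean_type q \<le> 0"
  proof (rule ereal_le_epsilon2)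
    fix e :: real assume "e > 0"
    obtain C where C: "C \<ge> 1" "\<And>z. 0 < Im z \<Longrightarrow> cmod (q z) \<le> C * exp (e / 2 * Im z + a / Im z)"
      using growth1[of "e / 2"] \<open>e > 0\<close> by auto
    have lim: "((\<lambda>y. ln C / y + e / 2 + a / y\<^sup>2) \<longlongrightarrow> 0 + e / 2 + 0) at_top"
      by (intro tendsto_intros; real_asymp)
    have "eventually (\<lambda>y. ln C / y + e / 2 + a / y\<^sup>2 < e) at_top"
      by (rule order_tendstoD(2)[OF lim]) (use \<open>e > 0\<close> in auto)
    then have "eventually (\<lambda>y. (if q (\<i> * of_real y) = 0 then - \<infinity> else ereal (ln (cmod (q (\<i> * of_real y))) / y)) \<le> ereal e) at_top"
      using eventually_gt_at_top[of 0]
    proof eventually_elim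
      case (elim y)
      show ?case
      proof (cases "q (\<i> * of_real y) = 0")
        case False
        have "cmod (q (\<i> * of_real y)) \<le> exp (ln C + (e / 2 * y + a / y))"
          using C(2)[of "\<i> * of_real y"] elim C(1) by (simp add: exp_add)
        then have "ln (cmod (q (\<i> * of_real y))) \<le> ln C + (e / 2 * y + a / y)"
          using False by (metis exp_gt_zero ln_exp ln_le_cancel_iff zero_less_norm_iff)
        then have "ln (cmod (q (\<i> * of_real y))) / y \<le> (ln C + (e / 2 * y + a / y)) / y"
          using elim by (intro divide_right_mono) auto
        also have "\<dots> = ln C / y + e / 2 + a / y\<^sup>2" using elim by (simp add: field_simps power2_eq_square)
        finally show ?thesis using False elim by simp
      qed auto
    qed
    then show "mean_type q \<le> 0 + ereal e" unfolding mean_type_def by (simp add: Limsup_bounded)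
  qed
  ultimately show ?thesis by (simp add: nevanlinna0_def)
qed

end

section \<open>Analytic completion of the logarithmic potential\<close>

lemma not_nonpos_Real_of_Re_ge_0: "0 \<le> Re w \<Longrightarrow> w \<noteq> 0 \<Longrightarrow> w \<notin> \<real>\<^sub>\<le>\<^sub>0"
  by (auto simp: complex_nonpos_Reals_iff complex_eq_iff)

lemma integrable_indicator_Icc: "integrable lborel (\<lambda>t. indicator {a..b::real} t * c :: real)"
  by (intro integrable_mult_left integrable_real_indicator emeasure_bounded_finite) auto

text \<open>The singularity at 0 is handled by the antiderivative s - s ln s on (0, 1) and its
  mirror image; for 1 \<le> |s| \<le> a the value is at most |ln |a||.\<close>

lemma integrable_abs_ln: "integrable lborel (\<lambda>s. indicator {-a..a} s * \<bar>ln \<bar>s\<bar>\<bar> :: real)"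
proof -
  have "set_integrable lborel (einterval 0 1) (\<lambda>s. - ln s)"
  proof (rule interval_integral_FTC_nonneg(1)[where F = "\<lambda>s. s - s * ln s"])
    show "DERIV (\<lambda>s. s - s * ln s) x :> - ln x" if "0 < ereal x" "ereal x < 1" for x
      using that by (auto intro!: derivative_eq_intros)
    show "isCont (\<lambda>s. - ln s) x" if "0 < ereal x" "ereal x < 1" for x
      using that by (auto intro!: continuous_intros)
    have "((\<lambda>s::real. s - s * ln s) \<longlongrightarrow> 0) (at_right 0)" by real_asymp
    then show "(((\<lambda>s. s - s * ln s) \<circ> real_of_ereal) \<longlongrightarrow> 0) (at_right 0)"
      by (simp add: ereal_tendsto_simps zero_ereal_def)
    have "((\<lambda>s::real. s - s * ln s) \<longlongrightarrow> 1 - 1 * ln 1) (at_left 1)" by (intro tendsto_intros) auto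
    then show "(((\<lambda>s. s - s * ln s) \<circ> real_of_ereal) \<longlongrightarrow> 1) (at_left 1)"
      by (simp add: ereal_tendsto_simps one_ereal_def)
  qed (auto simp: ln_le_zero_iff)
  then have 1: "integrable lborel (\<lambda>s. indicator {0<..<1} s * (- ln s) :: real)"
    by (simp add: set_integrable_def zero_ereal_def one_ereal_def)
  have 2: "integrable lborel (\<lambda>s. indicator {0<..<1} (0 + (-1) * s) * (- ln (0 + (-1) * s)) :: real)"
    by (rule lborel_integrable_real_affine[OF 1]) simp
  have 3: "integrable lborel (\<lambda>s. indicator {-a..a} s * \<bar>ln \<bar>a\<bar>\<bar> :: real)"
    by (rule integrable_indicator_Icc)
  show ?thesis
  proof (rule Bochner_Integration.integrable_bound[OF Bochner_Integration.integrable_add[OF Bochner_Integration.integrable_add[OF 1 2] 3]])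
    show "AE s in lborel. norm (indicator {-a..a} s * \<bar>ln \<bar>s\<bar>\<bar> :: real) \<le> norm (indicator {0<..<1} s * (- ln s) +
       indicator {0<..<1} (0 + (-1) * s) * (- ln (0 + (-1) * s)) + indicator {-a..a} s * \<bar>ln \<bar>a\<bar>\<bar>)"
    proof (rule AE_I2)
      fix s :: real
      consider "s = 0" | "0 < s" "s < 1" | "-1 < s" "s < 0" | "1 \<le> \<bar>s\<bar>" by linarith
      then show "norm (indicator {-a..a} s * \<bar>ln \<bar>s\<bar>\<bar> :: real) \<le> norm (indicator {0<..<1} s * (- ln s) +
       indicator {0<..<1} (0 + (-1) * s) * (- ln (0 + (-1) * s)) + indicator {-a..a} s * \<bar>ln \<bar>a\<bar>\<bar>)"
      proof cases
        case 4
        have "\<bar>ln \<bar>s\<bar>\<bar> \<le> \<bar>ln \<bar>a\<bar>\<bar>" if "\<bar>s\<bar> \<le> a"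
        proof -
          have "0 \<le> ln \<bar>s\<bar>" "ln \<bar>s\<bar> \<le> ln \<bar>a\<bar>" using 4 that by auto
          then show ?thesis by simp
        qed
        then show ?thesis using 4 by (auto simp: indicator_def)
      qed (auto simp: indicator_def ln_less_zero)
    qed
  qed measurable
qed

text \<open>An analytic completion of \<open>log_star\<close> in \<open>z\<close>. Multiplication by
  \<open>- \<i>\<close> turns the upper half plane into the right half plane, so the principal
  branch serves all real \<open>t\<close> at once and stays continuous up to the real line away from
  \<open>z = t\<close>.\<close>

definition log_kernel :: "complex \<Rightarrow> real \<Rightarrow> complex" where
  "log_kernel z t = Ln (- \<i> * (z - of_real t)) - Ln (\<i> * of_real t) + (if \<bar>t\<bar> > 1 then z / of_real t else 0)"

definition log_potential :: "(real \<Rightarrow> real) \<Rightarrow> complex \<Rightarrow> complex" where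
  "log_potential p z = (LINT t|lborel. of_real (p t) * log_kernel z t)"

text \<open>With u = - z / t the kernel equals \<open>Ln (1 + u) - u\<close>, hence is O(|u|^2). The
  logarithms add without a multiple of 2 \<pi> \<i> because both arguments are at most \<pi>/2 in
  modulus, one of them strictly.\<close>

lemma log_kernel_tail:
  assumes z: "0 \<le> Im z" and t: "2 * cmod z \<le> \<bar>t\<bar>" "1 < \<bar>t\<bar>"
  shows "cmod (log_kernel z t) \<le> 2 * (cmod z)\<^sup>2 / t\<^sup>2"
proof -
  have t0: "t \<noteq> 0" using t by auto
  define u where "u = - (z / of_real t)"
  have u: "cmod u \<le> 1 / 2" using t t0 by (simp add: u_def norm_divide divide_le_eq)
  then have "\<bar>Re u\<bar> < 1" using abs_Re_le_cmod[of u] by linarith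
  then have R: "0 < Re (1 + u)" by simp
  have u0: "1 + u \<noteq> 0" using R by (metis less_irrefl zero_complex.simps(1))
  have I1: "\<bar>Im (Ln (1 + u))\<bar> < pi / 2" by (rule Re_Ln_pos_lt_imp[OF R])
  have it: "\<i> * of_real t \<noteq> 0" using t0 by simp
  have I2: "\<bar>Im (Ln (\<i> * of_real t))\<bar> \<le> pi / 2" using Re_Ln_pos_le[OF it] by simp
  have "- \<i> * (z - of_real t) = (\<i> * of_real t) * (1 + u)" using t0 by (simp add: u_def field_simps)
  then have "Ln (- \<i> * (z - of_real t)) = Ln (\<i> * of_real t) + Ln (1 + u)"
    using Ln_times_simple[OF it u0] I1 I2 by simp
  then have "log_kernel z t = Ln (1 + u) - u" using t by (simp add: log_kernel_def u_def)
  then have "cmod (log_kernel z t) \<le> (cmod u)\<^sup>2 / (1 - cmod u)"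
    using Ln_approx_linear[of u] u by simp
  also have "\<dots> \<le> (cmod u)\<^sup>2 / (1 / 2)"
    by (rule divide_left_mono) (use u in auto)
  finally show ?thesis by (simp add: u_def norm_divide power_divide mult.commute)
qed

text \<open>The bound involves only the horizontal part \<open>Re z\<close>, so one majorant serves
  all heights down to the real line.\<close>

lemma norm_Ln_rotated_le:
  assumes "0 \<le> Im z" "z \<noteq> 0" "cmod z \<le> D" "D \<ge> 1" "Re z \<noteq> 0"
  shows "cmod (Ln (- \<i> * z)) \<le> \<bar>ln \<bar>Re z\<bar>\<bar> + ln D + pi"
proof -
  have nz: "- \<i> * z \<noteq> 0" using assms by simp
  have "\<bar>Im (Ln (- \<i> * z))\<bar> \<le> pi / 2" using Re_Ln_pos_le[OF nz] assms by simp
  moreover have "\<bar>Re (Ln (- \<i> * z))\<bar> \<le> \<bar>ln \<bar>Re z\<bar>\<bar> + ln D"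
  proof -
    have e: "Re (Ln (- \<i> * z)) = ln (cmod z)" using Re_Ln[OF nz] by (simp add: norm_mult)
    have "ln \<bar>Re z\<bar> \<le> ln (cmod z)" using abs_Re_le_cmod[of z] assms by (subst ln_le_cancel_iff) auto
    moreover have "ln (cmod z) \<le> ln D" using assms by simp
    moreover have "0 \<le> ln D" using assms by simp
    ultimately show ?thesis unfolding e by linarith
  qed
  ultimately show ?thesis
    using cmod_le[of "Ln (- \<i> * z)"] pi_gt_zero by linarith
qed

lemma borel_measurable_Ln_rotated:
  assumes z: "0 \<le> Im z"
  shows "(\<lambda>t. Ln (- \<i> * (z - of_real t))) \<in> borel_measurable borel"
proof (rule borel_measurable_continuous_countable_exceptions[of "{Re z}"])
  show "continuous_on (- {Re z}) (\<lambda>t. Ln (- \<i> * (z - of_real t)))"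
    by (intro continuous_intros not_nonpos_Real_of_Re_ge_0) (use z in \<open>auto simp: complex_eq_iff\<close>)
qed auto

lemma borel_measurable_Ln_imaginary: "(\<lambda>t. Ln (\<i> * of_real t)) \<in> borel_measurable borel"
  using borel_measurable_Ln_rotated[of 0] by simp

lemma borel_measurable_log_kernel:
  assumes z: "0 \<le> Im z"
  shows "log_kernel z \<in> borel_measurable borel"
  using borel_measurable_Ln_rotated[OF z] borel_measurable_Ln_imaginary
  unfolding log_kernel_def by measurable

lemma integrable_affine_abs_ln:
  "integrable lborel (\<lambda>t. indicator {x - a..x + a} t * \<bar>ln \<bar>x - t\<bar>\<bar> :: real)"
proof -
  have "integrable lborel (\<lambda>t. indicator {-a..a} (x + (-1) * t) * \<bar>ln \<bar>x + (-1) * t\<bar>\<bar> :: real)"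
    by (rule lborel_integrable_real_affine[OF integrable_abs_ln]) simp
  moreover have "indicator {-a..a} (x + (-1) * t) = (indicator {x - a..x + a} t :: real)" for t
    by (auto simp: indicator_def)
  ultimately show ?thesis by simp
qed

lemma inverse_sq_le: "1 < \<bar>t::real\<bar> \<Longrightarrow> 1 / t\<^sup>2 \<le> 2 / (1 + t\<^sup>2)"
proof -
  assume "1 < \<bar>t\<bar>"
  then have "1 < \<bar>t\<bar>\<^sup>2" by (rule one_less_power) simp
  then have 1: "1 < t\<^sup>2" by simp
  then have "0 < t\<^sup>2" by linarith
  then have "0 < 2 * t\<^sup>2 * (1 + t\<^sup>2)" by (intro mult_pos_pos add_pos_pos) auto
  then have "2 / (2 * t\<^sup>2) \<le> 2 / (1 + t\<^sup>2)" using 1 by (intro divide_left_mono) auto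
  then show ?thesis by simp
qed

text \<open>Instantiated twice: with the density \<open>m\<close>, whose potential is \<omega>, and
  with the bounded function \<open>Psi1\<close>, which produces the correction
  \<open>D\<close>.\<close>

locale bounded_weight =
  fixes p :: "real \<Rightarrow> real" and B :: real
  assumes contp: "continuous_on UNIV p" and bound: "\<And>t. \<bar>p t\<bar> \<le> B"
begin

lemma B_nonneg: "B \<ge> 0" using bound[of 0] by linarith

lemma measp[measurable]: "p \<in> borel_measurable borel"
  using contp by (rule borel_measurable_continuous_onI)

lemma isCont_p: "isCont p t"
  using contp by (simp add: continuous_on_eq_continuous_at)

text \<open>The truncated potential is shifted by \<open>Re z\<close> to fix the singularity, so that dominated
  convergence applies even on the real line.\<close>

lemma near_integrable:
  assumes z: "0 \<le> Im z" "cmod z \<le> R"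
  shows "integrable lborel (\<lambda>t. indicator {-T..T} t * (of_real (p t) * Ln (- \<i> * (z - of_real t))))"
proof -
  define D where "D = 1 + R + \<bar>T\<bar>"
  have R0: "R \<ge> 0" using z norm_ge_zero order_trans by blast
  have xR: "\<bar>Re z\<bar> \<le> R" using abs_Re_le_cmod[of z] z by linarith
  show ?thesis
  proof (rule Bochner_Integration.integrable_bound)
    show "integrable lborel (\<lambda>t. B * (indicator {Re z - D..Re z + D} t * \<bar>ln \<bar>Re z - t\<bar>\<bar> + indicator {-T..T} t * (ln D + pi)))"
      by (intro integrable_mult_right Bochner_Integration.integrable_add integrable_affine_abs_ln
          integrable_indicator_Icc)
    show "(\<lambda>t. indicator {-T..T} t * (of_real (p t) * Ln (- \<i> * (z - of_real t)))) \<in> borel_measurable lborel"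
      using borel_measurable_Ln_rotated[OF z(1)] by measurable
    show "AE t in lborel. norm (indicator {-T..T} t * (of_real (p t) * Ln (- \<i> * (z - of_real t))))
        \<le> norm (B * (indicator {Re z - D..Re z + D} t * \<bar>ln \<bar>Re z - t\<bar>\<bar> + indicator {-T..T} t * (ln D + pi)))"
      using AE_lborel_singleton[of "Re z"]
    proof eventually_elim
      case (elim t)
      show ?case
      proof (cases "t \<in> {-T..T}")
        case True
        then have "\<bar>t\<bar> \<le> \<bar>T\<bar>" by auto
        have c: "cmod (z - of_real t) \<le> D"
          using norm_triangle_ineq4[of z "of_real t"] z \<open>\<bar>t\<bar> \<le> \<bar>T\<bar>\<close> by (simp add: D_def)
        have ne: "z - of_real t \<noteq> 0" using elim by (auto simp: complex_eq_iff)
        have "cmod (Ln (- \<i> * (z - of_real t))) \<le> \<bar>ln \<bar>Re (z - of_real t)\<bar>\<bar> + ln D + pi"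
          by (rule norm_Ln_rotated_le) (use z c ne elim R0 in \<open>auto simp: D_def\<close>)
        then have L: "cmod (Ln (- \<i> * (z - of_real t))) \<le> \<bar>ln \<bar>Re z - t\<bar>\<bar> + (ln D + pi)" by simp
        have "t \<in> {Re z - D..Re z + D}" using xR R0 \<open>\<bar>t\<bar> \<le> \<bar>T\<bar>\<close> by (auto simp: D_def)
        then have "norm (indicator {-T..T} t * (of_real (p t) * Ln (- \<i> * (z - of_real t))))
          \<le> B * (indicator {Re z - D..Re z + D} t * \<bar>ln \<bar>Re z - t\<bar>\<bar> + indicator {-T..T} t * (ln D + pi))"
          using True mult_mono[OF bound[of t] L] B_nonneg by (simp add: norm_mult)
        then show ?thesis by (rule order_trans) simp
      qed auto
    qed
  qed
qed

lemma near_continuous: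
  assumes zn: "\<And>n. 0 \<le> Im (z n)" "z \<longlonglongrightarrow> z0" "\<And>n. cmod (z n) \<le> R"
  shows "(\<lambda>n. LINT t|lborel. indicator {-T..T} t * (of_real (p t) * Ln (- \<i> * (z n - of_real t))))
     \<longlonglongrightarrow> (LINT t|lborel. indicator {-T..T} t * (of_real (p t) * Ln (- \<i> * (z0 - of_real t))))"
proof -
  define f :: "complex \<Rightarrow> real \<Rightarrow> complex" where
    "f z s = indicator {-T..T} (Re z + s) * (of_real (p (Re z + s)) * Ln (- \<i> * (\<i> * of_real (Im z) - of_real s)))" for z s
  have shift: "(LINT t|lborel. indicator {-T..T} t * (of_real (p t) * Ln (- \<i> * (z - of_real t)))) = (LINT s|lborel. f z s)" for z
  proof -
    have e: "z - of_real (Re z + 1 * s) = \<i> * of_real (Im z) - of_real s" for s by (simp add: complex_eq_iff)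
    show ?thesis
      by (subst lborel_integral_real_affine[where c = 1 and t = "Re z"], simp, unfold e) (simp add: f_def[abs_def])
  qed
  define D where "D = 1 + 2 * R + \<bar>T\<bar>"
  have R0: "R \<ge> 0" using zn(3)[of 0] norm_ge_zero order_trans by blast
  have Re_lim: "(\<lambda>n. Re (z n)) \<longlonglongrightarrow> Re z0" and Im_lim: "(\<lambda>n. Im (z n)) \<longlonglongrightarrow> Im z0"
    using zn(2) by (auto intro: tendsto_Re tendsto_Im)
  have I0: "0 \<le> Im z0" using Im_lim zn(1) by (intro LIMSEQ_le_const[OF Im_lim]) auto
  have fmeas: "f z \<in> borel_measurable lborel" if "0 \<le> Im z" for z
    unfolding f_def using borel_measurable_Ln_rotated[of "\<i> * of_real (Im z)"] that by measurable
  show ?thesis unfolding shift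
  proof (rule integral_dominated_convergence[where w = "\<lambda>s. B * (indicator {-D..D} s * \<bar>ln \<bar>s\<bar>\<bar> + indicator {-D..D} s * (ln D + pi))"])
    show "f z0 \<in> borel_measurable lborel" "\<And>n. f (z n) \<in> borel_measurable lborel"
      using fmeas I0 zn(1) by auto
    show "integrable lborel (\<lambda>s. B * (indicator {-D..D} s * \<bar>ln \<bar>s\<bar>\<bar> + indicator {-D..D} s * (ln D + pi)))"
      by (intro integrable_mult_right Bochner_Integration.integrable_add integrable_abs_ln
          integrable_indicator_Icc)
    show "AE s in lborel. (\<lambda>n. f (z n) s) \<longlonglongrightarrow> f z0 s"
      \<comment> \<open>The excluded points are the logarithmic singularity and the two ends of the
        shifted interval, where the indicator jumps.\<close>
      using AE_lborel_singleton[of 0] AE_lborel_singleton[of "T - Re z0"] AE_lborel_singleton[of "- T - Re z0"]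
    proof eventually_elim
      case (elim s)
      have "isCont (\<lambda>x. indicator {-T..T} x :: complex) (Re z0 + s)"
      proof -
        have "Re z0 + s \<notin> frontier {-T..T}"
          using elim by (cases "-T \<le> T") (auto simp: frontier_cbox[of "-T" T, simplified])
        then have "isCont (\<lambda>x. indicat_real {-T..T} x) (Re z0 + s)" by (simp add: isCont_indicator)
        then have "isCont (\<lambda>x. complex_of_real (indicat_real {-T..T} x)) (Re z0 + s)" by (intro continuous_intros)
        moreover have "(\<lambda>x. complex_of_real (indicat_real {-T..T} x)) = (\<lambda>x. indicator {-T..T} x)"
          by (auto simp: indicator_def)
        ultimately show ?thesis by simp
      qed
      then have 1: "(\<lambda>n. indicator {-T..T} (Re (z n) + s) :: complex) \<longlonglongrightarrow> indicator {-T..T} (Re z0 + s)"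
        by (rule isCont_tendsto_compose) (intro tendsto_intros Re_lim)
      have 2: "(\<lambda>n. p (Re (z n) + s)) \<longlonglongrightarrow> p (Re z0 + s)"
        by (rule isCont_tendsto_compose[OF isCont_p]) (intro tendsto_intros Re_lim)
      have 3: "(\<lambda>n. Ln (- \<i> * (\<i> * of_real (Im (z n)) - of_real s))) \<longlonglongrightarrow> Ln (- \<i> * (\<i> * of_real (Im z0) - of_real s))"
      proof (rule isCont_tendsto_compose[OF continuous_at_Ln])
        show "- \<i> * (\<i> * of_real (Im z0) - of_real s) \<notin> \<real>\<^sub>\<le>\<^sub>0"
          by (rule not_nonpos_Real_of_Re_ge_0) (use I0 elim in \<open>auto simp: complex_eq_iff\<close>)
      qed (intro tendsto_intros Im_lim)
      show ?case unfolding f_def by (intro tendsto_mult 1 3 tendsto_of_real 2)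
    qed
    show "AE s in lborel. norm (f (z n) s) \<le> B * (indicator {-D..D} s * \<bar>ln \<bar>s\<bar>\<bar> + indicator {-D..D} s * (ln D + pi))" for n
      using AE_lborel_singleton[of 0]
    proof eventually_elim
      case (elim s)
      have xR: "\<bar>Re (z n)\<bar> \<le> R" "\<bar>Im (z n)\<bar> \<le> R"
        using abs_Re_le_cmod[of "z n"] abs_Im_le_cmod[of "z n"] zn(3)[of n] by linarith+
      show ?case
      proof (cases "Re (z n) + s \<in> {-T..T}")
        case True
        then have s: "\<bar>s\<bar> \<le> R + \<bar>T\<bar>" using xR by auto
        define u where "u = \<i> * of_real (Im (z n)) - of_real s"
        have Reu: "Re u = - s" by (simp add: u_def)
        have "cmod u \<le> D"
          using cmod_le[of u] s xR by (simp add: u_def D_def)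
        then have "cmod (Ln (- \<i> * u)) \<le> \<bar>ln \<bar>Re u\<bar>\<bar> + ln D + pi"
          by (intro norm_Ln_rotated_le) (use zn(1)[of n] elim R0 in \<open>auto simp: D_def u_def complex_eq_iff\<close>)
        then have L: "cmod (Ln (- \<i> * u)) \<le> \<bar>ln \<bar>s\<bar>\<bar> + (ln D + pi)" unfolding Reu by simp
        have "s \<in> {-D..D}" using s R0 by (auto simp: D_def)
        moreover have "norm (f (z n) s) = \<bar>p (Re (z n) + s)\<bar> * cmod (Ln (- \<i> * u))"
          using True by (simp add: f_def u_def norm_mult)
        ultimately show ?thesis using mult_mono[OF bound[of "Re (z n) + s"] L] B_nonneg by simp
      qed (use B_nonneg R0 in \<open>auto simp: f_def D_def\<close>)
    qed
  qed
qed

lemma far_bound: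
  assumes z: "0 \<le> Im z" "cmod z \<le> R" and R: "R \<ge> 1"
  shows "cmod (indicator (- {-(2*R)..2*R}) t * (of_real (p t) * log_kernel z t)) \<le> 4 * B * R\<^sup>2 * (1 / (1 + t\<^sup>2))"
proof (cases "t \<in> {-(2*R)..2*R}")
  case True
  then show ?thesis using B_nonneg by (auto intro!: mult_nonneg_nonneg divide_nonneg_nonneg)
next
  case False
  then have t: "2 * R < \<bar>t\<bar>" by auto
  have "cmod (log_kernel z t) \<le> 2 * (cmod z)\<^sup>2 / t\<^sup>2"
    by (rule log_kernel_tail) (use z R t in auto)
  also have "\<dots> = 2 * (cmod z)\<^sup>2 * (1 / t\<^sup>2)" by simp
  also have "\<dots> \<le> 2 * R\<^sup>2 * (2 / (1 + t\<^sup>2))"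
    using z R t by (intro mult_mono inverse_sq_le power_mono) auto
  finally have "\<bar>p t\<bar> * cmod (log_kernel z t) \<le> B * (2 * R\<^sup>2 * (2 / (1 + t\<^sup>2)))"
    using bound[of t] B_nonneg by (intro mult_mono) auto
  also have "\<dots> = 4 * B * R\<^sup>2 * (1 / (1 + t\<^sup>2))" by simp
  finally show ?thesis using False by (simp add: norm_mult)
qed

lemma far_integrable:
  assumes z: "0 \<le> Im z" "cmod z \<le> R" and R: "R \<ge> 1"
  shows "integrable lborel (\<lambda>t. indicator (- {-(2*R)..2*R}) t * (of_real (p t) * log_kernel z t))"
proof (rule Bochner_Integration.integrable_bound)
  show "integrable lborel (\<lambda>t. 4 * B * R\<^sup>2 * (1 / (1 + t\<^sup>2)))"
    by (intro integrable_mult_right integrable_inverse_one_plus_square)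
  show "(\<lambda>t. indicator (- {-(2*R)..2*R}) t * (of_real (p t) * log_kernel z t)) \<in> borel_measurable lborel"
    using borel_measurable_log_kernel[OF z(1)] by measurable
  show "AE t in lborel. norm (indicator (- {-(2*R)..2*R}) t * (of_real (p t) * log_kernel z t)) \<le> norm (4 * B * R\<^sup>2 * (1 / (1 + t\<^sup>2)))"
    by (rule AE_I2, rule order_trans[OF far_bound[OF z R]], unfold real_norm_def, rule abs_ge_self)
qed

lemma far_continuous:
  assumes zn: "\<And>n. 0 \<le> Im (z n)" "z \<longlonglongrightarrow> z0" "\<And>n. cmod (z n) \<le> R" and R: "R \<ge> 1"
  shows "(\<lambda>n. LINT t|lborel. indicator (- {-(2*R)..2*R}) t * (of_real (p t) * log_kernel (z n) t))
     \<longlonglongrightarrow> (LINT t|lborel. indicator (- {-(2*R)..2*R}) t * (of_real (p t) * log_kernel z0 t))"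
proof (rule integral_dominated_convergence[where w = "\<lambda>t. 4 * B * R\<^sup>2 * (1 / (1 + t\<^sup>2))"])
  have Im_lim: "(\<lambda>n. Im (z n)) \<longlonglongrightarrow> Im z0" using zn(2) by (rule tendsto_Im)
  have I0: "0 \<le> Im z0" using Im_lim zn(1) by (intro LIMSEQ_le_const[OF Im_lim]) auto
  have c0: "cmod z0 \<le> R" by (rule LIMSEQ_le_const2[OF tendsto_norm[OF zn(2)]]) (use zn(3) in auto)
  show "(\<lambda>t. indicator (- {-(2*R)..2*R}) t * (of_real (p t) * log_kernel z0 t)) \<in> borel_measurable lborel"
    "(\<lambda>t. indicator (- {-(2*R)..2*R}) t * (of_real (p t) * log_kernel (z n) t)) \<in> borel_measurable lborel" for n
    using borel_measurable_log_kernel[OF zn(1)] borel_measurable_log_kernel[OF I0] by measurable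
  show "integrable lborel (\<lambda>t. 4 * B * R\<^sup>2 * (1 / (1 + t\<^sup>2)))"
    by (intro integrable_mult_right integrable_inverse_one_plus_square)
  show "AE t in lborel. norm (indicator (- {-(2*R)..2*R}) t * (of_real (p t) * log_kernel (z n) t)) \<le> 4 * B * R\<^sup>2 * (1 / (1 + t\<^sup>2))" for n
    by (rule AE_I2, rule far_bound[OF zn(1) zn(3) R])
  show "AE t in lborel. (\<lambda>n. indicator (- {-(2*R)..2*R}) t * (of_real (p t) * log_kernel (z n) t)) \<longlonglongrightarrow>
     indicator (- {-(2*R)..2*R}) t * (of_real (p t) * log_kernel z0 t)"
  proof (rule AE_I2)
    fix t
    show "(\<lambda>n. indicator (- {-(2*R)..2*R}) t * (of_real (p t) * log_kernel (z n) t)) \<longlonglongrightarrow>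
     indicator (- {-(2*R)..2*R}) t * (of_real (p t) * log_kernel z0 t)"
    proof (cases "t \<in> {-(2*R)..2*R}")
      case False
      then have t: "2 * R < \<bar>t\<bar>" by auto
      have "z0 \<noteq> of_real t" using c0 t R by auto
      then have np: "- \<i> * (z0 - of_real t) \<notin> \<real>\<^sub>\<le>\<^sub>0"
        by (intro not_nonpos_Real_of_Re_ge_0) (use I0 in auto)
      have "(\<lambda>n. log_kernel (z n) t) \<longlonglongrightarrow> log_kernel z0 t"
      proof -
        have "(\<lambda>n. Ln (- \<i> * (z n - of_real t))) \<longlonglongrightarrow> Ln (- \<i> * (z0 - of_real t))"
          by (rule isCont_tendsto_compose[OF continuous_at_Ln[OF np]]) (intro tendsto_intros zn(2))
        moreover have "(\<lambda>n. if 1 < \<bar>t\<bar> then z n / of_real t else 0) \<longlonglongrightarrow> (if 1 < \<bar>t\<bar> then z0 / of_real t else 0)"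
          by (cases "1 < \<bar>t\<bar>") (auto intro!: tendsto_divide zn(2))
        ultimately show ?thesis unfolding log_kernel_def by (intro tendsto_add tendsto_diff tendsto_const)
      qed
      then show ?thesis by (intro tendsto_intros)
    qed auto
  qed
qed

text \<open>For |t| \<le> 2R the summands of the kernel are integrated separately. Beyond, the
  kernel is kept whole, since its quadratic decay comes from the cancellation in
  \<open>log_kernel_tail\<close>.\<close>

lemma split_kernel:
  assumes z: "0 \<le> Im z" "cmod z \<le> R" and R: "R \<ge> 1"
  defines "J \<equiv> {-(2*R)..2*R}"
  shows "integrable lborel (\<lambda>t. of_real (p t) * log_kernel z t)"
    and "log_potential p z = (LINT t|lborel. indicator J t * (of_real (p t) * Ln (- \<i> * (z - of_real t))))
      - (LINT t|lborel. indicator J t * (of_real (p t) * Ln (\<i> * of_real t)))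
      + z * (LINT t|lborel. indicator J t * of_real (p t * (if \<bar>t\<bar> > 1 then 1 / t else 0)))
      + (LINT t|lborel. indicator (- J) t * (of_real (p t) * log_kernel z t))"
proof -
  have i1: "integrable lborel (\<lambda>t. indicator J t * (of_real (p t) * Ln (- \<i> * (z - of_real t))))"
    unfolding J_def by (rule near_integrable[OF z])
  have i2: "integrable lborel (\<lambda>t. indicator J t * (of_real (p t) * Ln (\<i> * of_real t)))"
    using near_integrable[of 0 0 "2 * R"] by (simp add: J_def)
  have i3: "integrable lborel (\<lambda>t. indicator J t * complex_of_real (p t * (if \<bar>t\<bar> > 1 then 1 / t else 0)))"
  proof (rule Bochner_Integration.integrable_bound)
    show "integrable lborel (\<lambda>t. indicator J t * B)"
      unfolding J_def by (rule integrable_indicator_Icc)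
    show "(\<lambda>t. indicator J t * complex_of_real (p t * (if \<bar>t\<bar> > 1 then 1 / t else 0))) \<in> borel_measurable lborel"
      unfolding J_def by measurable
    show "AE t in lborel. norm (indicator J t * complex_of_real (p t * (if \<bar>t\<bar> > 1 then 1 / t else 0))) \<le> norm (indicator J t * B)"
    proof (rule AE_I2)
      fix t
      have "\<bar>p t * (if \<bar>t\<bar> > 1 then 1 / t else 0)\<bar> \<le> B * 1"
        unfolding abs_mult using bound[of t] B_nonneg by (intro mult_mono) auto
      then show "norm (indicator J t * complex_of_real (p t * (if \<bar>t\<bar> > 1 then 1 / t else 0))) \<le> norm (indicator J t * B)"
        using B_nonneg unfolding norm_mult norm_of_real by (intro mult_mono) (auto simp: indicator_def)
    qed
  qed
  have i4: "integrable lborel (\<lambda>t. indicator (- J) t * (of_real (p t) * log_kernel z t))"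
    unfolding J_def by (rule far_integrable[OF z R])
  have e: "of_real (p t) * log_kernel z t = indicator J t * (of_real (p t) * Ln (- \<i> * (z - of_real t)))
      - indicator J t * (of_real (p t) * Ln (\<i> * of_real t))
      + z * (indicator J t * of_real (p t * (if \<bar>t\<bar> > 1 then 1 / t else 0)))
      + indicator (- J) t * (of_real (p t) * log_kernel z t)" for t
    by (auto simp: indicator_def log_kernel_def algebra_simps)
  show "integrable lborel (\<lambda>t. of_real (p t) * log_kernel z t)"
  proof -
    have "integrable lborel (\<lambda>t. indicator J t * (of_real (p t) * Ln (- \<i> * (z - of_real t)))
      - indicator J t * (of_real (p t) * Ln (\<i> * of_real t))
      + z * (indicator J t * of_real (p t * (if \<bar>t\<bar> > 1 then 1 / t else 0)))
      + indicator (- J) t * (of_real (p t) * log_kernel z t))"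
      by (intro Bochner_Integration.integrable_add Bochner_Integration.integrable_diff i1 i2 i4 integrable_mult_right i3)
    then show ?thesis unfolding e[symmetric] .
  qed
  show "log_potential p z = (LINT t|lborel. indicator J t * (of_real (p t) * Ln (- \<i> * (z - of_real t))))
      - (LINT t|lborel. indicator J t * (of_real (p t) * Ln (\<i> * of_real t)))
      + z * (LINT t|lborel. indicator J t * of_real (p t * (if \<bar>t\<bar> > 1 then 1 / t else 0)))
      + (LINT t|lborel. indicator (- J) t * (of_real (p t) * log_kernel z t))"
  proof -
    have "(LINT t|lborel. A t - B t + z * C t + D t) = (LINT t|lborel. A t) - (LINT t|lborel. B t) + z * (LINT t|lborel. C t) + (LINT t|lborel. D t)"
      if "integrable lborel A" "integrable lborel B" "integrable lborel C" "integrable lborel D" for A B C D :: "real \<Rightarrow> complex"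
      using that by simp
    note sum = this[OF i1 i2 i3 i4]
    show ?thesis unfolding log_potential_def sum[symmetric] by (rule Bochner_Integration.integral_cong[OF refl]) (rule e)
  qed
qed

lemma log_kernel_integrable: "0 \<le> Im z \<Longrightarrow> integrable lborel (\<lambda>t. of_real (p t) * log_kernel z t)"
  by (rule split_kernel(1)[of z "cmod z + 1"]) auto

lemma continuous_on_log_potential: "continuous_on {z. 0 \<le> Im z} (log_potential p)"
  unfolding continuous_on_sequentially
proof (intro allI ballI impI)
  fix z z0 assume *: "z0 \<in> {z. 0 \<le> Im z}" "(\<forall>n. z n \<in> {z. 0 \<le> Im z}) \<and> z \<longlonglongrightarrow> z0"
  then have zn: "\<And>n. 0 \<le> Im (z n)" "z \<longlonglongrightarrow> z0" and I0: "0 \<le> Im z0" by auto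
  have "bounded (range z)" using zn(2) by (intro convergent_imp_bounded)
  then obtain R' where R': "\<And>n. cmod (z n) \<le> R'" by (auto simp: bounded_iff)
  define R where "R = max 1 R'"
  have R: "R \<ge> 1" and c: "\<And>n. cmod (z n) \<le> R" using R' by (auto simp: R_def intro: le_max_iff_disj[THEN iffD2])
  have c0: "cmod z0 \<le> R" by (rule LIMSEQ_le_const2[OF tendsto_norm[OF zn(2)]]) (use c in auto)
  show "(log_potential p \<circ> z) \<longlonglongrightarrow> log_potential p z0"
    unfolding o_def split_kernel(2)[OF zn(1) c R] split_kernel(2)[OF I0 c0 R]
    by (intro tendsto_intros zn(2) near_continuous[OF zn c] far_continuous[OF zn c R])
qed

end

text \<open>Majorants for differentiating under the integral, uniform for |z| \<le> R and Im z \<ge>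
  \<eta>. For |t| \<le> 2R trivial bounds suffice; for larger |t| the first kernel is
  \<open>z / (of_real t * (z - of_real t))\<close>, so it decays quadratically. Each constant is the
  sum over the two regimes.\<close>

lemma inverse_kernel_bounds:
  fixes z :: complex
  assumes z: "\<eta> \<le> Im z" "0 < \<eta>" "cmod z \<le> R" "1 \<le> R"
  shows "cmod (1 / (z - of_real t) + (if \<bar>t\<bar> > 1 then 1 / of_real t else 0)) \<le> ((1 / \<eta> + 1) * (1 + (2 * R)\<^sup>2) + 4 * R) / (1 + t\<^sup>2)" (is "cmod ?l \<le> _")
    and "cmod (1 / (z - of_real t)\<^sup>2) \<le> (1 / \<eta>\<^sup>2 * (1 + (2 * R)\<^sup>2) + 8) / (1 + t\<^sup>2)" (is "cmod ?r \<le> _")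
proof -
  have pos: "0 < 1 + t\<^sup>2" by (simp add: add_pos_nonneg)
  have d: "\<eta> \<le> cmod (z - of_real t)" using Im_le_cmod_diff_of_real[of z t] z by linarith
  have nz: "z - of_real t \<noteq> 0" using diff_of_real_nonzero[of z t] z by simp
  have i1: "1 / cmod (z - of_real t) \<le> 1 / \<eta>" using d z by (intro divide_left_mono mult_pos_pos) auto
  have i2: "1 / (cmod (z - of_real t))\<^sup>2 \<le> 1 / \<eta>\<^sup>2"
    using d z nz by (intro divide_left_mono mult_pos_pos power_mono zero_less_power) auto
  show "cmod ?l \<le> ((1 / \<eta> + 1) * (1 + (2 * R)\<^sup>2) + 4 * R) / (1 + t\<^sup>2)"
  proof (cases "\<bar>t\<bar> \<le> 2 * R")
    case True
    have "cmod ?l \<le> cmod (1 / (z - of_real t)) + cmod (if \<bar>t\<bar> > 1 then 1 / complex_of_real t else 0)"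
      by (rule norm_triangle_ineq)
    also have "\<dots> \<le> 1 / \<eta> + 1" using i1 by (intro add_mono) (auto simp: norm_divide)
    finally have "cmod ?l \<le> 1 / \<eta> + 1" .
    have "\<bar>t\<bar>\<^sup>2 \<le> (2 * R)\<^sup>2" using True by (intro power_mono) auto
    then have "cmod ?l * (1 + t\<^sup>2) \<le> (1 / \<eta> + 1) * (1 + (2 * R)\<^sup>2)"
      using \<open>cmod ?l \<le> 1 / \<eta> + 1\<close> z pos by (intro mult_mono) auto
    then have "cmod ?l * (1 + t\<^sup>2) \<le> (1 / \<eta> + 1) * (1 + (2 * R)\<^sup>2) + 4 * R" using z by linarith
    then show ?thesis using pos by (simp only: pos_le_divide_eq)
  next
    case False
    then have t: "2 * R < \<bar>t\<bar>" "1 < \<bar>t\<bar>" "t \<noteq> 0" using z by auto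
    have c: "\<bar>t\<bar> / 2 \<le> cmod (z - of_real t)"
      using norm_triangle_ineq2[of "of_real t" z] t z by (simp add: norm_minus_commute)
    have "?l = z / (of_real t * (z - of_real t))" using t nz by (simp add: field_simps)
    then have "cmod ?l = cmod z / (\<bar>t\<bar> * cmod (z - of_real t))" by (simp add: norm_divide norm_mult)
    also have "\<dots> \<le> R / (\<bar>t\<bar> * (\<bar>t\<bar> / 2))"
    proof -
      have pt: "0 < \<bar>t\<bar> * (\<bar>t\<bar> / 2)" using t by (intro mult_pos_pos) auto
      show ?thesis using c z by (intro frac_le mult_left_mono pt) auto
    qed
    also have "\<dots> = 2 * R * (1 / t\<^sup>2)" by (simp add: power2_eq_square flip: abs_mult)
    also have "\<dots> \<le> 2 * R * (2 / (1 + t\<^sup>2))" using z by (intro mult_left_mono inverse_sq_le t) auto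
    also have "\<dots> = 4 * R / (1 + t\<^sup>2)" by simp
    also have "\<dots> \<le> ((1 / \<eta> + 1) * (1 + (2 * R)\<^sup>2) + 4 * R) / (1 + t\<^sup>2)"
      using z pos by (intro divide_right_mono) (auto intro!: mult_nonneg_nonneg)
    finally show ?thesis .
  qed
  show "cmod ?r \<le> (1 / \<eta>\<^sup>2 * (1 + (2 * R)\<^sup>2) + 8) / (1 + t\<^sup>2)"
  proof (cases "\<bar>t\<bar> \<le> 2 * R")
    case True
    have "\<bar>t\<bar>\<^sup>2 \<le> (2 * R)\<^sup>2" using True by (intro power_mono) auto
    then have "cmod ?r * (1 + t\<^sup>2) \<le> 1 / \<eta>\<^sup>2 * (1 + (2 * R)\<^sup>2)"
      using i2 z pos by (intro mult_mono) (auto simp: norm_divide norm_power)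
    then have "cmod ?r * (1 + t\<^sup>2) \<le> 1 / \<eta>\<^sup>2 * (1 + (2 * R)\<^sup>2) + 8" by linarith
    then show ?thesis using pos by (simp only: pos_le_divide_eq)
  next
    case False
    then have t: "2 * R < \<bar>t\<bar>" "1 < \<bar>t\<bar>" "t \<noteq> 0" using z by auto
    have c: "\<bar>t\<bar> / 2 \<le> cmod (z - of_real t)"
      using norm_triangle_ineq2[of "of_real t" z] t z by (simp add: norm_minus_commute)
    then have "(\<bar>t\<bar> / 2)\<^sup>2 \<le> (cmod (z - of_real t))\<^sup>2" by (intro power_mono) auto
    then have "cmod ?r \<le> 1 / (\<bar>t\<bar> / 2)\<^sup>2"
      unfolding norm_divide norm_power norm_one using t nz by (intro divide_left_mono mult_pos_pos) auto
    also have "\<dots> = 4 * (1 / t\<^sup>2)" by (simp add: power_divide)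
    also have "\<dots> \<le> 4 * (2 / (1 + t\<^sup>2))" by (intro mult_left_mono inverse_sq_le t) auto
    also have "\<dots> = 8 / (1 + t\<^sup>2)" by simp
    also have "\<dots> \<le> (1 / \<eta>\<^sup>2 * (1 + (2 * R)\<^sup>2) + 8) / (1 + t\<^sup>2)"
      using z pos by (intro divide_right_mono) auto
    finally show ?thesis .
  qed
qed

lemma half_ball_upper:
  assumes "0 < Im z0" "z \<in> ball z0 (Im z0 / 2)"
  shows "Im z0 / 2 \<le> Im z" "0 < Im z" "cmod z \<le> cmod z0 + Im z0 + 1"
proof -
  have d: "cmod (z0 - z) < Im z0 / 2" using assms by (simp add: dist_norm)
  then show "Im z0 / 2 \<le> Im z" "0 < Im z" using abs_Im_le_cmod[of "z0 - z"] assms by auto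
  show "cmod z \<le> cmod z0 + Im z0 + 1" using norm_triangle_ineq3[of z0 z] d assms by linarith
qed

lemma log_star_eq_Re_log_kernel:
  assumes "t \<noteq> 0" "z \<noteq> of_real t"
  shows "log_star z t = Re (log_kernel z t)"
proof -
  have "cmod (1 - z / of_real t) = cmod (z - of_real t) / \<bar>t\<bar>"
  proof -
    have "1 - z / of_real t = - ((z - of_real t) / of_real t)" using assms by (simp add: field_simps)
    then show ?thesis by (metis norm_divide norm_minus_cancel norm_of_real)
  qed
  then have "ln (cmod (1 - z / of_real t)) = ln (cmod (z - of_real t)) - ln \<bar>t\<bar>"
    using assms by (simp add: ln_div)
  moreover have "Re (Ln (- \<i> * (z - of_real t))) = ln (cmod (z - of_real t))"
    using assms by (subst Re_Ln) (auto simp: norm_mult)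
  moreover have "Re (Ln (\<i> * of_real t)) = ln \<bar>t\<bar>"
    using assms by (subst Re_Ln) (auto simp: norm_mult)
  ultimately show ?thesis by (simp add: log_star_def log_kernel_def Re_divide_of_real)
qed

lemma log_star_cnj: "log_star (cnj z) t = log_star z t"
proof -
  have "cmod (1 - cnj z / of_real t) = cmod (1 - z / of_real t)"
    by (metis complex_cnj_complex_of_real complex_cnj_diff complex_cnj_divide complex_cnj_one complex_mod_cnj)
  then show ?thesis by (simp add: log_star_def)
qed

lemma potential_cnj: "potential m (cnj z) = potential m z"
  by (simp add: potential_def log_star_cnj)

lemma log_star_measurable[measurable]: "log_star z \<in> borel_measurable borel"
  unfolding log_star_def[abs_def] by measurable

lemma AE_not_eq_complex: "AE t in lborel. z \<noteq> complex_of_real t"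
  using AE_lborel_singleton[of "Re z"] by eventually_elim auto

text \<open>An integrable majorant of ln (1 + 8 / s^2). The 9 comes from 1 + 8 / s^2 \<le> 9 / s^2
  for |s| \<le> 1, and the 16 from 8 / s^2 \<le> 16 / (1 + s^2) for |s| > 1.\<close>

definition ln_ratio_bound :: "real \<Rightarrow> real" where
  "ln_ratio_bound s = indicator {-1..1} s * (ln 9) + 2 * (indicator {-1..1} s * \<bar>ln \<bar>s\<bar>\<bar>) + 16 * (1 / (1 + s\<^sup>2))"

lemma ln_ratio_bound_integrable: "integrable lborel ln_ratio_bound"
  unfolding ln_ratio_bound_def[abs_def]
  by (intro Bochner_Integration.integrable_add integrable_indicator_Icc integrable_mult_right integrable_abs_ln
      integrable_inverse_one_plus_square)

lemma ln_ratio_bound_nonneg: "ln_ratio_bound s \<ge> 0"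
  unfolding ln_ratio_bound_def by (intro add_nonneg_nonneg mult_nonneg_nonneg divide_nonneg_nonneg) auto

lemma ln_ratio_bound_ge:
  assumes "s \<noteq> 0" shows "ln (1 + 8 / s\<^sup>2) \<le> ln_ratio_bound s"
proof (cases "\<bar>s\<bar> \<le> 1")
  case True
  have s2: "0 < s\<^sup>2" "s\<^sup>2 \<le> 1" using assms True by (auto simp: abs_square_le_1)
  have "1 + 8 / s\<^sup>2 \<le> 1 / s\<^sup>2 + 8 / s\<^sup>2" using s2 by (intro add_right_mono) (simp add: le_divide_eq)
  then have "1 + 8 / s\<^sup>2 \<le> 9 / s\<^sup>2" by (simp flip: add_divide_distrib)
  then have "ln (1 + 8 / s\<^sup>2) \<le> ln (9 / s\<^sup>2)" using s2 by (subst ln_le_cancel_iff) (auto intro!: add_pos_pos)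
  also have "\<dots> = ln 9 - 2 * ln \<bar>s\<bar>"
  proof -
    have "ln (s\<^sup>2) = 2 * ln \<bar>s\<bar>" using ln_realpow[of "\<bar>s\<bar>" 2] assms by simp
    then show ?thesis using ln_div[of 9 "s\<^sup>2"] s2 by simp
  qed
  also have "\<dots> \<le> ln_ratio_bound s"
  proof -
    have "s \<in> {-1..1}" using True by auto
    then have "ln_ratio_bound s = ln 9 + 2 * \<bar>ln \<bar>s\<bar>\<bar> + 16 * (1 / (1 + s\<^sup>2))" by (simp add: ln_ratio_bound_def)
    moreover have "0 \<le> 16 * (1 / (1 + s\<^sup>2))" by simp
    ultimately show ?thesis using abs_ge_minus_self[of "ln \<bar>s\<bar>"] by linarith
  qed
  finally show ?thesis .
next
  case False
  have "ln (1 + 8 / s\<^sup>2) \<le> 8 / s\<^sup>2" by (rule ln_add_one_self_le_self) simp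
  also have "\<dots> = 8 * (1 / s\<^sup>2)" by simp
  also have "\<dots> \<le> 8 * (2 / (1 + s\<^sup>2))" using False by (intro mult_left_mono inverse_sq_le) auto
  also have "\<dots> = ln_ratio_bound s"
  proof -
    have "s \<notin> {-1..1}" using False by auto
    then show ?thesis by (simp add: ln_ratio_bound_def)
  qed
  finally show ?thesis .
qed

section \<open>Derivatives, boundary values and vertical shifts of the potential\<close>

context bounded_weight
begin

definition log_potential1 :: "complex \<Rightarrow> complex" where
  "log_potential1 z = (LINT t|lborel. of_real (p t) * (1 / (z - of_real t) + (if \<bar>t\<bar> > 1 then 1 / of_real t else 0)))"

definition log_potential2 :: "complex \<Rightarrow> complex" where
  "log_potential2 z = - (LINT t|lborel. of_real (p t) * (1 / (z - of_real t)\<^sup>2))"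

lemma weighted_integrable:
  assumes f: "f \<in> borel_measurable borel" and bd: "\<And>t. cmod (f t) \<le> c / (1 + t\<^sup>2)"
  shows "integrable lborel (\<lambda>t. of_real (p t) * (f t :: complex))"
proof (rule Bochner_Integration.integrable_bound)
  show "integrable lborel (\<lambda>t. B * c * (1 / (1 + t\<^sup>2)))"
    by (intro integrable_mult_right integrable_inverse_one_plus_square)
  show "(\<lambda>t. of_real (p t) * f t) \<in> borel_measurable lborel" using f by measurable
  show "AE t in lborel. norm (of_real (p t) * f t) \<le> norm (B * c * (1 / (1 + t\<^sup>2)))"
  proof (rule AE_I2)
    fix t
    have "norm (of_real (p t) * f t) \<le> B * (c / (1 + t\<^sup>2))"
      unfolding norm_mult norm_of_real by (intro mult_mono bound bd B_nonneg) auto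
    also have "\<dots> = B * c * (1 / (1 + t\<^sup>2))" by simp
    also have "\<dots> \<le> norm (B * c * (1 / (1 + t\<^sup>2)))" unfolding real_norm_def by (rule abs_ge_self)
    finally show "norm (of_real (p t) * f t) \<le> norm (B * c * (1 / (1 + t\<^sup>2)))" .
  qed
qed

lemma inverse_kernel_integrable:
  assumes "0 < Im z"
  shows "integrable lborel (\<lambda>t. of_real (p t) * (1 / (z - of_real t) + (if \<bar>t\<bar> > 1 then 1 / of_real t else 0)))"
    and "integrable lborel (\<lambda>t. of_real (p t) * (1 / (z - of_real t)\<^sup>2))"
proof -
  have R: "Im z / 2 \<le> Im z" "0 < Im z / 2" "cmod z \<le> cmod z + 1" "1 \<le> cmod z + 1" using assms by auto
  show "integrable lborel (\<lambda>t. of_real (p t) * (1 / (z - of_real t) + (if \<bar>t\<bar> > 1 then 1 / of_real t else 0)))"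
    by (rule weighted_integrable[OF _ inverse_kernel_bounds(1)[OF R]]) measurable
  show "integrable lborel (\<lambda>t. of_real (p t) * (1 / (z - of_real t)\<^sup>2))"
    by (rule weighted_integrable[OF _ inverse_kernel_bounds(2)[OF R]]) measurable
qed

lemma log_potential_has_derivative:
  assumes z0: "0 < Im z0"
  shows "(log_potential p has_field_derivative log_potential1 z0) (at z0)"
  unfolding log_potential_def[abs_def] log_potential1_def
proof (rule has_field_derivative_integral[where r = "Im z0 / 2" and f' = "\<lambda>z t. of_real (p t) * (1 / (z - of_real t) + (if \<bar>t\<bar> > 1 then 1 / of_real t else 0))"])
  define R where "R = cmod z0 + Im z0 + 1"
  have R: "1 \<le> R" using z0 by (simp add: R_def)
  define c where "c = (1 / (Im z0 / 2) + 1) * (1 + (2 * R)\<^sup>2) + 4 * R"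
  show "Im z0 / 2 > 0" using z0 by simp
  show "(\<lambda>t. of_real (p t) * (1 / (z0 - of_real t) + (if \<bar>t\<bar> > 1 then 1 / complex_of_real t else 0))) \<in> borel_measurable lborel"
    by measurable
  show "integrable lborel (\<lambda>t. B * (c / (1 + t\<^sup>2)))"
    using integrable_mult_right[OF integrable_inverse_one_plus_square, of "B * c"] by simp
  fix z assume z: "z \<in> ball z0 (Im z0 / 2)"
  note zz = half_ball_upper[OF z0 z]
  show "integrable lborel (\<lambda>t. of_real (p t) * log_kernel z t)" by (rule log_kernel_integrable) (use zz in simp)
  fix t
  have "- \<i> * (z - of_real t) \<notin> \<real>\<^sub>\<le>\<^sub>0"
    by (rule not_nonpos_Real_of_Re_ge_0) (use zz in \<open>auto simp: complex_eq_iff\<close>)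
  have "((\<lambda>z. log_kernel z t) has_field_derivative (- \<i> / (- \<i> * (z - of_real t)) + (if \<bar>t\<bar> > 1 then 1 / of_real t else 0))) (at z)"
    unfolding log_kernel_def
  proof (rule DERIV_add)
    show "((\<lambda>z. Ln (- \<i> * (z - of_real t)) - Ln (\<i> * of_real t)) has_field_derivative - \<i> / (- \<i> * (z - of_real t))) (at z)"
      using \<open>- \<i> * (z - of_real t) \<notin> \<real>\<^sub>\<le>\<^sub>0\<close> by (auto intro!: derivative_eq_intros simp: field_simps)
    show "((\<lambda>z. if \<bar>t\<bar> > 1 then z / of_real t else 0) has_field_derivative (if \<bar>t\<bar> > 1 then 1 / of_real t else 0)) (at z)"
      by (cases "\<bar>t\<bar> > 1") (auto intro!: derivative_eq_intros)
  qed
  moreover have "- \<i> / (- \<i> * (z - of_real t)) = 1 / (z - of_real t)" by simp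
  ultimately show "((\<lambda>z. of_real (p t) * log_kernel z t) has_field_derivative of_real (p t) * (1 / (z - of_real t) + (if \<bar>t\<bar> > 1 then 1 / of_real t else 0))) (at z)"
    by (intro DERIV_cmult) simp
  show "cmod (of_real (p t) * (1 / (z - of_real t) + (if \<bar>t\<bar> > 1 then 1 / of_real t else 0))) \<le> B * (c / (1 + t\<^sup>2))"
    unfolding norm_mult norm_of_real c_def
    by (intro mult_mono bound inverse_kernel_bounds B_nonneg) (use zz z0 R in \<open>auto simp: R_def\<close>)
qed

lemma log_potential1_has_derivative:
  assumes z0: "0 < Im z0"
  shows "(log_potential1 has_field_derivative log_potential2 z0) (at z0)"
proof -
  have "((\<lambda>z. LINT t|lborel. of_real (p t) * (1 / (z - of_real t) + (if \<bar>t\<bar> > 1 then 1 / of_real t else 0)))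
     has_field_derivative (LINT t|lborel. - (of_real (p t) * (1 / (z0 - of_real t)\<^sup>2)))) (at z0)"
  proof (rule has_field_derivative_integral[where r = "Im z0 / 2" and f' = "\<lambda>z t. - (of_real (p t) * (1 / (z - of_real t)\<^sup>2))"])
    define R where "R = cmod z0 + Im z0 + 1"
    have R: "1 \<le> R" using z0 by (simp add: R_def)
    define c where "c = 1 / (Im z0 / 2)\<^sup>2 * (1 + (2 * R)\<^sup>2) + 8"
    show "Im z0 / 2 > 0" using z0 by simp
    show "(\<lambda>t. - (of_real (p t) * (1 / (z0 - of_real t)\<^sup>2))) \<in> borel_measurable lborel"
      by measurable
    show "integrable lborel (\<lambda>t. B * (c / (1 + t\<^sup>2)))"
      using integrable_mult_right[OF integrable_inverse_one_plus_square, of "B * c"] by simp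
    fix z assume z: "z \<in> ball z0 (Im z0 / 2)"
    note zz = half_ball_upper[OF z0 z]
    show "integrable lborel (\<lambda>t. of_real (p t) * (1 / (z - of_real t) + (if \<bar>t\<bar> > 1 then 1 / of_real t else 0)))"
      by (rule inverse_kernel_integrable(1)[OF zz(2)])
    fix t
    have "((\<lambda>z. 1 / (z - of_real t) + (if \<bar>t\<bar> > 1 then 1 / of_real t else 0)) has_field_derivative - (1 / (z - of_real t)\<^sup>2)) (at z)"
      using diff_of_real_nonzero[OF zz(2), of t] by (auto intro!: derivative_eq_intros simp: power2_eq_square)
    from DERIV_cmult[OF this, of "of_real (p t)"]
    show "((\<lambda>z. of_real (p t) * (1 / (z - of_real t) + (if \<bar>t\<bar> > 1 then 1 / of_real t else 0))) has_field_derivative - (of_real (p t) * (1 / (z - of_real t)\<^sup>2))) (at z)"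
      by simp
    show "cmod (- (of_real (p t) * (1 / (z - of_real t)\<^sup>2))) \<le> B * (c / (1 + t\<^sup>2))"
      unfolding norm_minus_cancel norm_mult norm_of_real c_def
      by (intro mult_mono bound inverse_kernel_bounds B_nonneg) (use zz z0 R in \<open>auto simp: R_def\<close>)
  qed
  then show ?thesis by (simp add: log_potential1_def[abs_def] log_potential2_def)
qed

lemma norm_log_potential2_le:
  assumes "0 < Im z"
  shows "cmod (log_potential2 z) \<le> B * pi / Im z"
proof -
  have "cmod (log_potential2 z) \<le> (LINT t|lborel. cmod (of_real (p t) * (1 / (z - of_real t)\<^sup>2)))"
    unfolding log_potential2_def norm_minus_cancel by (rule integral_norm_bound)
  also have "\<dots> \<le> (LINT t|lborel. B * (1 / (cmod (z - of_real t))\<^sup>2))"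
  proof (rule integral_mono)
    show "integrable lborel (\<lambda>t. cmod (of_real (p t) * (1 / (z - of_real t)\<^sup>2)))"
      by (intro integrable_norm inverse_kernel_integrable(2)[OF assms])
    show "integrable lborel (\<lambda>t. B * (1 / (cmod (z - of_real t))\<^sup>2))"
      by (intro integrable_mult_right poisson_integrable[OF assms])
    show "cmod (of_real (p t) * (1 / (z - of_real t)\<^sup>2)) \<le> B * (1 / (cmod (z - of_real t))\<^sup>2)" for t
      unfolding norm_mult norm_divide norm_power norm_of_real norm_one by (intro mult_right_mono bound) auto
  qed
  also have "\<dots> = B * (pi / Im z)" unfolding integral_mult_right_zero poisson_integral[OF assms] ..
  finally show ?thesis by simp
qed

lemma log_star_integrable: "integrable lborel (\<lambda>t. log_star z t * p t)"
  and Re_log_potential: "0 \<le> Im z \<Longrightarrow> Re (log_potential p z) = potential p z"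
proof -
  have *: "integrable lborel (\<lambda>t. log_star z t * p t) \<and> Re (log_potential p z) = potential p z" if z: "0 \<le> Im z" for z
  proof -
    have ae: "AE t in lborel. Re (of_real (p t) * log_kernel z t) = log_star z t * p t"
      using AE_lborel_singleton[of 0] AE_not_eq_complex[of z]
      by eventually_elim (simp add: log_star_eq_Re_log_kernel)
    have int: "integrable lborel (\<lambda>t. Re (of_real (p t) * log_kernel z t))"
      by (rule integrable_Re) (rule log_kernel_integrable[OF z])
    have m: "(\<lambda>t. Re (of_real (p t) * log_kernel z t)) \<in> borel_measurable lborel"
      "(\<lambda>t. log_star z t * p t) \<in> borel_measurable lborel"
      using int by auto
    have "integrable lborel (\<lambda>t. log_star z t * p t)"
      using int integrable_cong_AE[OF m ae] by simp
    moreover have "Re (log_potential p z) = (LINT t|lborel. Re (of_real (p t) * log_kernel z t))"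
      unfolding log_potential_def by (rule integral_Re[symmetric]) (rule log_kernel_integrable[OF z])
    moreover have "\<dots> = potential p z" unfolding potential_def by (rule integral_cong_AE[OF m ae])
    ultimately show ?thesis by simp
  qed
  show "0 \<le> Im z \<Longrightarrow> Re (log_potential p z) = potential p z" using * by blast
  show "integrable lborel (\<lambda>t. log_star z t * p t)"
    using *[of z] *[of "cnj z"] by (cases "0 \<le> Im z") (auto simp: log_star_cnj)
qed

lemma potential_measurable: "(\<lambda>x. potential p (of_real x)) \<in> borel_measurable borel"
proof -
  have "continuous_on UNIV (\<lambda>x. Re (log_potential p (of_real x)))"
    by (intro continuous_intros continuous_on_compose2[OF continuous_on_log_potential]) auto
  then show ?thesis by (simp add: Re_log_potential borel_measurable_continuous_onI)
qed

lemma Im_log_kernel_real: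
  assumes "t \<noteq> 0" "t \<noteq> x"
  shows "Im (log_kernel (of_real x) t) = pi * ((if t > x then 1 else 0) - (if t > 0 then 1 else 0))"
proof -
  have L: "Im (Ln (\<i> * of_real s)) = (if s > 0 then pi / 2 else - pi / 2)" if "s \<noteq> 0" for s
  proof (cases "s > 0")
    case True
    have "Ln (of_real s * \<i>) = of_real (ln s) + Ln \<i>" using True by (subst Ln_times_of_real) (auto simp: Ln_of_real)
    then show ?thesis using True by (simp add: Ln_ii mult.commute)
  next
    case False
    have "Ln (of_real (- s) * (- \<i>)) = of_real (ln (- s)) + Ln (- \<i>)"
      using False that Ln_times_of_real[of "- s" "- \<i>"] Ln_of_real[of "- s"] by simp
    then show ?thesis using False by (simp add: Ln_minus_ii mult.commute)
  qed
  have e: "- \<i> * (complex_of_real x - of_real t) = \<i> * of_real (t - x)" by (simp add: algebra_simps)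
  have i: "Im (if \<bar>t\<bar> > 1 then complex_of_real x / of_real t else 0) = 0" by (simp add: Im_divide_of_real)
  show ?thesis unfolding log_kernel_def plus_complex.sel minus_complex.sel e i
    using assms L[of t] L[of "t - x"] by simp
qed

text \<open>On the real line the imaginary part of the kernel is piecewise constant: - \<pi> for t
  between 0 and x if x > 0, + \<pi> for t between x and 0 if x < 0, and 0 elsewhere. The potential
  thus measures the increment of \<open>P\<close> from 0 to x.\<close>

lemma Im_log_potential_real:
  assumes P: "\<And>t. (P has_real_derivative p t) (at t)"
  shows "Im (log_potential p (of_real x)) = - pi * (P x - P 0)"
proof -
  define f where "f t = (if 0 \<le> x then - pi * (indicator {0..x} t * p t) else pi * (indicator {x..0} t * p t))" for t
  have ae: "AE t in lborel. Im (of_real (p t) * log_kernel (of_real x) t) = f t"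
    using AE_lborel_singleton[of 0] AE_lborel_singleton[of x]
  proof eventually_elim
    case (elim t)
    have "Im (of_real (p t) * log_kernel (of_real x) t) = p t * Im (log_kernel (of_real x) t)" by simp
    then show ?case unfolding Im_log_kernel_real[OF elim]
      using elim by (auto simp: f_def indicator_def)
  qed
  have int: "integrable lborel (\<lambda>t. of_real (p t) * log_kernel (of_real x) t)" by (rule log_kernel_integrable) simp
  have m: "(\<lambda>t. Im (of_real (p t) * log_kernel (of_real x) t)) \<in> borel_measurable lborel" "f \<in> borel_measurable lborel"
    using integrable_Im[OF int] by (auto simp: f_def[abs_def])
  have ftc: "(LINT t|lborel. indicator {a..b} t * p t) = P b - P a" if "a \<le> b" for a b
    using integral_FTC_atLeastAtMost[of a b P p] that P contp
    by (auto simp: has_real_derivative_iff_has_vector_derivative intro: has_vector_derivative_at_within continuous_on_subset)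
  have "Im (log_potential p (of_real x)) = (LINT t|lborel. Im (of_real (p t) * log_kernel (of_real x) t))"
    unfolding log_potential_def by (rule integral_Im[symmetric, OF int])
  also have "\<dots> = (LINT t|lborel. f t)" by (rule integral_cong_AE[OF m ae])
  also have "\<dots> = - pi * (P x - P 0)"
  proof (cases "0 \<le> x")
    case True
    then have "(LINT t|lborel. f t) = - pi * (LINT t|lborel. indicator {0..x} t * p t)" by (simp add: f_def)
    then show ?thesis using ftc[OF True] by simp
  next
    case False
    then have e: "(LINT t|lborel. f t) = pi * (LINT t|lborel. indicator {x..0} t * p t)" by (simp add: f_def)
    have "x \<le> 0" using False by simp
    then show ?thesis unfolding e ftc[OF \<open>x \<le> 0\<close>] by (simp add: algebra_simps)
  qed
  finally show ?thesis .
qed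

text \<open>Near the real line, \<omega> may be replaced up to a bounded error by its value two
  units higher, which is the real part of a holomorphic function there. For |Im z| \<le> 1 the shift
  does not reduce the distance to any real t, so positivity of \<open>p\<close> fixes the
  sign.\<close>

lemma potential_shift:
  assumes pos: "\<And>t. p t \<ge> 0"
  shows "\<exists>C\<ge>0. \<forall>z. \<bar>Im z\<bar> \<le> 1 \<longrightarrow> potential p z \<le> potential p (z + 2 * \<i>) \<and> potential p (z + 2 * \<i>) \<le> potential p z + C"
proof -
  have "0 \<le> potential p (z + 2 * \<i>) - potential p z \<and> potential p (z + 2 * \<i>) - potential p z \<le> B * (LINT s|lborel. ln_ratio_bound s)"
    if y: "\<bar>Im z\<bar> \<le> 1" for z
  proof -
    have diff: "potential p (z + 2 * \<i>) - potential p z = (LINT t|lborel. log_star (z + 2 * \<i>) t * p t - log_star z t * p t)"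
      unfolding potential_def by (rule Bochner_Integration.integral_diff[symmetric]) (rule log_star_integrable)+
    have int: "integrable lborel (\<lambda>t. log_star (z + 2 * \<i>) t * p t - log_star z t * p t)"
      by (intro Bochner_Integration.integrable_diff log_star_integrable)
    have ae: "AE t in lborel. 0 \<le> log_star (z + 2 * \<i>) t * p t - log_star z t * p t \<and>
       log_star (z + 2 * \<i>) t * p t - log_star z t * p t \<le> B * ln_ratio_bound (Re z - t)"
      using AE_lborel_singleton[of 0] AE_lborel_singleton[of "Re z"]
    proof eventually_elim
      case (elim t)
      define s where "s = Re z - t"
      have s0: "s \<noteq> 0" using elim by (simp add: s_def)
      have ne: "z \<noteq> of_real t" "z + 2 * \<i> \<noteq> of_real t" using elim by (auto simp: complex_eq_iff)
      have R: "Re (Ln (- \<i> * w)) = ln ((cmod w)\<^sup>2) / 2" if "w \<noteq> 0" for w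
        using that by (subst Re_Ln) (auto simp: norm_mult ln_realpow)
      have "log_star (z + 2 * \<i>) t - log_star z t = Re (Ln (- \<i> * (z + 2 * \<i> - of_real t))) - Re (Ln (- \<i> * (z - of_real t)))"
        unfolding log_star_eq_Re_log_kernel[OF elim(1) ne(1)] log_star_eq_Re_log_kernel[OF elim(1) ne(2)]
        by (simp add: log_kernel_def Re_divide_of_real)
      also have "\<dots> = ln (s\<^sup>2 + (Im z + 2)\<^sup>2) / 2 - ln (s\<^sup>2 + (Im z)\<^sup>2) / 2"
        using ne R[of "z - of_real t"] R[of "z + 2 * \<i> - of_real t"] by (simp add: cmod_power2 s_def)
      finally have e: "log_star (z + 2 * \<i>) t - log_star z t = (ln (s\<^sup>2 + (Im z + 2)\<^sup>2) - ln (s\<^sup>2 + (Im z)\<^sup>2)) / 2" by simp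
      define d where "d = s\<^sup>2 + (Im z)\<^sup>2"
      have d: "d > 0" "s\<^sup>2 \<le> d" using s0 by (auto simp: d_def add_pos_nonneg)
      have s2: "0 < s\<^sup>2" using s0 by simp
      \<comment> \<open>The increment (Im z + 2)^2 - (Im z)^2 = 4 (1 + Im z) lies between 0 and 8,
        hence the 8 in \<open>ln_ratio_bound_ge\<close>.\<close>
      have e2: "s\<^sup>2 + (Im z + 2)\<^sup>2 = d + 4 * (1 + Im z)" by (simp add: d_def power2_eq_square algebra_simps)
      have lo: "ln d \<le> ln (s\<^sup>2 + (Im z + 2)\<^sup>2)" using d y unfolding e2 by (subst ln_le_cancel_iff) auto
      have "ln (s\<^sup>2 + (Im z + 2)\<^sup>2) - ln d = ln ((d + 4 * (1 + Im z)) / d)"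
        using d y unfolding e2 by (subst ln_div) auto
      also have "\<dots> \<le> ln (1 + 8 / s\<^sup>2)"
      proof -
        have "(d + 4 * (1 + Im z)) / d = 1 + 4 * (1 + Im z) / d" using d by (simp add: field_simps)
        also have "\<dots> \<le> 1 + 8 / s\<^sup>2" using d y s2 by (intro add_left_mono frac_le) auto
        finally show ?thesis using d y by (subst ln_le_cancel_iff) (auto intro!: divide_pos_pos add_pos_nonneg)
      qed
      also have "\<dots> \<le> ln_ratio_bound s" by (rule ln_ratio_bound_ge[OF s0])
      finally have u: "ln (s\<^sup>2 + (Im z + 2)\<^sup>2) - ln d \<le> ln_ratio_bound s" .
      have "v / 2 \<le> g" if "v \<le> g" "0 \<le> g" for v g :: real using that by linarith
      from this[OF u ln_ratio_bound_nonneg] have up: "log_star (z + 2 * \<i>) t - log_star z t \<le> ln_ratio_bound s"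
        unfolding e d_def[symmetric] .
      have lo': "0 \<le> log_star (z + 2 * \<i>) t - log_star z t" unfolding e using lo by (simp add: d_def)
      have "(log_star (z + 2 * \<i>) t - log_star z t) * p t \<le> ln_ratio_bound s * B"
        using up lo' bound[of t] pos[of t] ln_ratio_bound_nonneg by (intro mult_mono) auto
      moreover have "0 \<le> (log_star (z + 2 * \<i>) t - log_star z t) * p t" using lo' pos by simp
      ultimately show ?case by (simp add: s_def algebra_simps)
    qed
    have G: "integrable lborel (\<lambda>t. B * ln_ratio_bound (Re z - t))"
      using lborel_integrable_real_affine[OF ln_ratio_bound_integrable, of "-1" "Re z"] by simp
    have "0 \<le> (LINT t|lborel. log_star (z + 2 * \<i>) t * p t - log_star z t * p t)"
      by (rule integral_nonneg_AE) (use ae in auto)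
    moreover have "(LINT t|lborel. log_star (z + 2 * \<i>) t * p t - log_star z t * p t) \<le> (LINT t|lborel. B * ln_ratio_bound (Re z - t))"
      by (rule integral_mono_AE[OF int G]) (use ae in auto)
    moreover have "(LINT t|lborel. ln_ratio_bound (Re z - t)) = (LINT s|lborel. ln_ratio_bound s)"
      using lborel_integral_real_affine[of "-1" ln_ratio_bound "Re z"] by simp
    ultimately show ?thesis unfolding diff by simp
  qed
  moreover have "B * (LINT s|lborel. ln_ratio_bound s) \<ge> 0"
    using B_nonneg ln_ratio_bound_nonneg by (intro mult_nonneg_nonneg integral_nonneg_AE) auto
  ultimately show ?thesis by (intro exI[of _ "B * (LINT s|lborel. ln_ratio_bound s)"]) fastforce
qed

end

section \<open>The smoothed phase\<close>

locale regular_phase =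
  fixes \<phi> \<phi>' \<phi>1 \<phi>2 :: "real \<Rightarrow> real" and N C1 C2 :: real
  assumes der: "\<And>x. (\<phi> has_real_derivative \<phi>' x) (at x)"
    and cont': "continuous_on UNIV \<phi>'" and nonneg: "\<And>x. \<phi>' x \<ge> 0"
    and der1: "\<And>x. (\<phi>1 has_real_derivative \<phi> x) (at x)"
    and der2: "\<And>x. (\<phi>2 has_real_derivative \<phi>1 x) (at x)"
    and N: "N \<ge> 0" and C1: "C1 > 0" and C2: "C2 > 0"
    and bilip: "\<And>x1 x2. x2 - x1 > N \<Longrightarrow> C1 * (x2 - x1) \<le> \<phi> x2 - \<phi> x1 \<and> \<phi> x2 - \<phi> x1 \<le> C2 * (x2 - x1)"
begin

text \<open>Exceeding N makes the bi-Lipschitz condition available on a window. Being at least 1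
  keeps points on or beyond the ends of the window at distance at least 1 from its centre, which
  bounds the boundary terms and the outer integral below.\<close>

definition h where "h = N + 1"
definition m where "m x = (\<phi> (x + h) - \<phi> (x - h)) / (2 * pi * h)"
definition M where "M x = (\<phi>1 (x + h) - \<phi>1 (x - h)) / (2 * h)"
definition Psi where "Psi x = \<phi> x - M x"
text \<open>The difference between \<open>\<phi>1\<close> and its own window average, hence a
  primitive of \<open>Psi\<close>.\<close>

definition Psi1 where "Psi1 x = \<phi>1 x - (\<phi>2 (x + h) - \<phi>2 (x - h)) / (2 * h)"
definition S where "S = C2 * h\<^sup>2"

lemma h_bounds: "h \<ge> 1" "h > N" "h > 0" using N by (auto simp: h_def)

lemma S_nonneg: "S \<ge> 0" using C2 by (simp add: S_def)

lemma mono: "x \<le> y \<Longrightarrow> \<phi> x \<le> \<phi> y"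
  by (rule DERIV_nonneg_imp_nondecreasing) (use der nonneg in auto)

lemma cont: "continuous_on A \<phi>" "continuous_on A \<phi>1" "continuous_on A \<phi>2"
  using der der1 der2 by (meson DERIV_isCont continuous_at_imp_continuous_on)+

lemma phi_diff_h: "C1 * (2 * h) \<le> \<phi> (x + h) - \<phi> (x - h)" "\<phi> (x + h) - \<phi> (x - h) \<le> C2 * (2 * h)"
proof -
  have e: "(x + h) - (x - h) = 2 * h" by simp
  have "N < (x + h) - (x - h)" using h_bounds N by simp
  from bilip[OF this] show "C1 * (2 * h) \<le> \<phi> (x + h) - \<phi> (x - h)" "\<phi> (x + h) - \<phi> (x - h) \<le> C2 * (2 * h)"
    unfolding e by auto
qed

lemma m_bounds: "C1 / pi \<le> m x" "m x \<le> C2 / pi"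
proof -
  have p: "0 < 2 * pi * h" using h_bounds by simp
  have "C1 / pi = C1 * (2 * h) / (2 * pi * h)" "C2 / pi = C2 * (2 * h) / (2 * pi * h)" using h_bounds by auto
  note e = this
  show "C1 / pi \<le> m x" "m x \<le> C2 / pi"
    unfolding m_def e using phi_diff_h[of x] p by (intro divide_right_mono; simp)+
qed

lemma m_pos: "0 < m x"
  using m_bounds(1)[of x] C1 by (meson divide_pos_pos less_le_trans pi_gt_zero)

lemma cont_m: "continuous_on UNIV m"
  unfolding m_def using h_bounds by (intro continuous_intros continuous_on_compose2[OF cont(1)[of UNIV]]) auto

lemma M_der: "(M has_real_derivative pi * m x) (at x)"
proof -
  have "((\<lambda>x. \<phi>1 (x + h) - \<phi>1 (x - h)) has_real_derivative \<phi> (x + h) - \<phi> (x - h)) (at x)"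
    by (intro DERIV_diff) (auto intro!: DERIV_chain2[OF der1, THEN DERIV_cong] derivative_eq_intros)
  from DERIV_cdivide[OF this, of "2 * h"] show ?thesis
    unfolding M_def m_def using h_bounds by simp
qed

lemma Psi1_der: "(Psi1 has_real_derivative Psi x) (at x)"
proof -
  have "((\<lambda>x. \<phi>2 (x + h) - \<phi>2 (x - h)) has_real_derivative \<phi>1 (x + h) - \<phi>1 (x - h)) (at x)"
    by (intro DERIV_diff) (auto intro!: DERIV_chain2[OF der2, THEN DERIV_cong] derivative_eq_intros)
  from DERIV_diff[OF der1 DERIV_cdivide[OF this, of "2 * h"]] show ?thesis
    unfolding Psi1_def Psi_def M_def .
qed

text \<open>The symmetric average cancels the first-order term, so the second primitive of \<open>\<phi>' - \<pi> m\<close> is bounded.\<close>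

lemma Psi1_bound: "\<bar>Psi1 x\<bar> \<le> S"
proof -
  define K where "K = C2 * (2 * h)"
  \<comment> \<open>\<open>k\<close> and its first derivative \<open>k1\<close> vanish at 0, and the
    second derivative \<open>k2\<close> lies between 0 and \<open>K\<close> by monotonicity. Two
    applications of the mean value theorem give 0 \<le> k h \<le> K h^2, and division by 2h yields
    \<open>S\<close>.\<close>
  define k where "k s = \<phi>2 (x + s) - \<phi>2 (x - s) - 2 * s * \<phi>1 x" for s
  define k1 where "k1 s = \<phi>1 (x + s) + \<phi>1 (x - s) - 2 * \<phi>1 x" for s
  define k2 where "k2 s = \<phi> (x + s) - \<phi> (x - s)" for s
  have K0: "K \<ge> 0" using C2 h_bounds by (simp add: K_def)
  have dk: "(k has_real_derivative k1 s) (at s)" for s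
    unfolding k_def k1_def by (auto intro!: derivative_eq_intros DERIV_chain2[OF der2, THEN DERIV_cong])
  have dk1: "(k1 has_real_derivative k2 s) (at s)" for s
    unfolding k1_def k2_def by (auto intro!: derivative_eq_intros DERIV_chain2[OF der1, THEN DERIV_cong])
  have k2b: "0 \<le> k2 s" "k2 s \<le> K" if "0 \<le> s" "s \<le> h" for s
  proof -
    show "0 \<le> k2 s" unfolding k2_def using mono[of "x - s" "x + s"] that by simp
    show "k2 s \<le> K" unfolding k2_def K_def
      using phi_diff_h(2)[of x] mono[of "x + s" "x + h"] mono[of "x - h" "x - s"] that by simp
  qed
  have k1b: "0 \<le> k1 s \<and> k1 s \<le> K * h" if "0 \<le> s" "s \<le> h" for s
  proof (cases "s = 0")
    case False
    then have "0 < s" using that by simp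
    obtain u where u: "0 < u" "u < s" "k1 s - k1 0 = (s - 0) * k2 u"
      using MVT2[OF \<open>0 < s\<close>, of k1 k2] dk1 by blast
    have "s * k2 u \<le> h * K" using that u k2b[of u] h_bounds by (intro mult_mono) auto
    then show ?thesis using u that k2b[of u] by (simp add: k1_def mult.commute)
  qed (use K0 h_bounds in \<open>auto simp: k1_def\<close>)
  obtain u where u: "0 < u" "u < h" "k h - k 0 = (h - 0) * k1 u"
    using MVT2[OF h_bounds(3), of k k1] dk by blast
  have kh: "0 \<le> k h" "k h \<le> h * (K * h)"
    using u k1b[of u] h_bounds by (auto simp: k_def intro!: mult_left_mono)
  have e: "Psi1 x = - k h / (2 * h)" using h_bounds by (simp add: Psi1_def k_def field_simps)
  have "k h / (2 * h) \<le> S" using kh(2) h_bounds by (simp add: K_def S_def field_simps power2_eq_square)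
  then show ?thesis unfolding e using kh(1) h_bounds by simp
qed

sublocale mw: bounded_weight m "C2 / pi"
  using cont_m m_bounds m_pos by unfold_locales (auto simp: abs_of_pos)

sublocale Pw: bounded_weight Psi1 S
  using Psi1_der Psi1_bound by unfold_locales (auto intro!: DERIV_isCont continuous_at_imp_continuous_on)

section \<open>Comparison of the correction with theta\<close>

lemma cont_M: "continuous_on A M"
  by (intro continuous_at_imp_continuous_on ballI DERIV_isCont[OF M_der])

lemma cont_Psi: "continuous_on A Psi"
  unfolding Psi_def by (intro continuous_intros cont cont_M)

lemma cont_Psi1: "continuous_on A Psi1"
  using Pw.contp continuous_on_subset by blast

text \<open>The integral defining \<theta>, with 1 / (t - x) smoothed to a conjugate Poisson kernel
  at height \<open>Im z\<close> and with window radius \<open>h\<close>.\<close>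

definition local_part :: "complex \<Rightarrow> real" where
  "local_part z = (LINT t:{Re z - h..Re z + h}|lborel. (\<phi> t - \<phi> (Re z)) * (t - Re z) / ((t - Re z)\<^sup>2 + (Im z)\<^sup>2))"

text \<open>The function \<open>D\<close> of the overview; the minus sign is part of
  \<open>log_potential2\<close>.\<close>

definition correction :: "complex \<Rightarrow> complex" where
  "correction z = Pw.log_potential2 z / of_real pi"

lemma set_integral_bounded:
  fixes f :: "real \<Rightarrow> real"
  assumes "a \<le> b" "set_integrable lborel {a..b} f" "\<And>t. t \<in> {a..b} \<Longrightarrow> \<bar>f t\<bar> \<le> c"
  shows "\<bar>LINT t:{a..b}|lborel. f t\<bar> \<le> c * (b - a)"
proof -
  have "norm (LINT t:{a..b}|lborel. f t) \<le> (LINT t|lborel. norm (indicator {a..b} t *\<^sub>R f t))"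
    unfolding set_lebesgue_integral_def by (rule integral_norm_bound)
  also have "\<dots> \<le> (LINT t|lborel. indicator {a..b} t * c)"
    using assms unfolding set_integrable_def
    by (intro integral_mono integrable_indicator_Icc integrable_norm) (auto simp: indicator_def)
  also have "\<dots> = c * (b - a)" using assms(1) by simp
  finally show ?thesis by simp
qed

text \<open>Off the window the horizontal distance exceeds 1, so the kernel has an integrable
  majorant independent of the height of \<open>z\<close>.\<close>

lemma outer_part:
  assumes z: "0 < Im z"
  defines "I \<equiv> {Re z - h..Re z + h}"
  shows "cmod (LINT t|lborel. indicator (- I) t * (of_real (Psi1 t) * (1 / (z - of_real t)\<^sup>2))) \<le> 2 * S * pi"
proof -
  define F where "F t = indicator (- I) t * (complex_of_real (Psi1 t) * (1 / (z - of_real t)\<^sup>2))" for t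
  have int: "integrable lborel F" unfolding F_def I_def
    using integrable_mult_indicator[OF _ Pw.inverse_kernel_integrable(2)[OF z], of "- {Re z - h..Re z + h}"]
    by (simp add: scaleR_conv_of_real of_real_indicator)
  have G: "integrable lborel (\<lambda>t. 2 * S * (1 / (1 + (Re z + (-1) * t)\<^sup>2)))"
    by (intro integrable_mult_right lborel_integrable_real_affine[OF integrable_inverse_one_plus_square]) simp
  have "cmod (LINT t|lborel. F t) \<le> (LINT t|lborel. cmod (F t))" by (rule integral_norm_bound)
  also have "\<dots> \<le> (LINT t|lborel. 2 * S * (1 / (1 + (Re z + (-1) * t)\<^sup>2)))"
  proof (rule integral_mono[OF integrable_norm[OF int] G])
    fix t
    show "cmod (F t) \<le> 2 * S * (1 / (1 + (Re z + (-1) * t)\<^sup>2))"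
    proof (cases "t \<in> I")
      case True
      then show ?thesis using S_nonneg by (simp add: F_def)
    next
      case False
      then have s: "1 < \<bar>Re z - t\<bar>" using h_bounds by (auto simp: I_def)
      have "\<bar>Re z - t\<bar> \<le> cmod (z - of_real t)" using abs_Re_le_cmod[of "z - of_real t"] by simp
      then have "\<bar>Re z - t\<bar>\<^sup>2 \<le> (cmod (z - of_real t))\<^sup>2" by (intro power_mono) auto
      then have "1 / (cmod (z - of_real t))\<^sup>2 \<le> 1 / (Re z - t)\<^sup>2"
        using s by (intro divide_left_mono mult_pos_pos) (auto simp: diff_of_real_nonzero[OF z])
      also have "\<dots> \<le> 2 / (1 + (Re z - t)\<^sup>2)" by (rule inverse_sq_le[OF s])
      finally have "\<bar>Psi1 t\<bar> * (1 / (cmod (z - of_real t))\<^sup>2) \<le> S * (2 / (1 + (Re z - t)\<^sup>2))"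
        by (intro mult_mono Psi1_bound S_nonneg) auto
      then show ?thesis using False by (simp add: F_def norm_mult norm_divide norm_power mult.commute)
    qed
  qed
  also have "\<dots> = 2 * S * pi"
    unfolding integral_mult_right_zero
    using lborel_integral_real_affine[of "-1" "\<lambda>t. 1 / (1 + t\<^sup>2)" "Re z"] integral_inverse_one_plus_square by simp
  finally show ?thesis by (simp add: F_def)
qed

text \<open>Integration by parts trades \<open>Psi1\<close> for \<open>Psi\<close>, each boundary
  term costing at most \<open>S\<close>. Then \<open>Psi t\<close> is written as (\<phi> t - \<phi>
  x) - (M t - M x) + Psi x. The first difference yields \<open>local_part\<close>, the second is
  harmless because \<open>M\<close> is Lipschitz with constant \<open>C2\<close>, and the constant
  disappears because the remaining kernel is odd about x.\<close>

lemma inner_part: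
  assumes z: "0 < Im z"
  defines "I \<equiv> {Re z - h..Re z + h}"
  shows "\<bar>Re (LINT t:I|lborel. of_real (Psi1 t) * (1 / (z - of_real t)\<^sup>2)) - local_part z\<bar> \<le> 2 * S + 2 * h * C2"
proof -
  define x y where "x = Re z" and "y = Im z"
  have zxy: "z = Complex x y" by (simp add: x_def y_def)
  have y: "y > 0" using z by (simp add: y_def)
  have I: "I = {x - h..x + h}" by (simp add: I_def x_def)
  have ab: "x - h \<le> x + h" using h_bounds by simp
  have nz: "z - of_real t \<noteq> 0" for t by (rule diff_of_real_nonzero[OF z])
  define q where "q t = (t - x)\<^sup>2 + y\<^sup>2" for t
  have q: "q t > 0" for t using y by (simp add: q_def add_nonneg_pos)
  then have qn: "q t \<noteq> 0" for t by (metis less_irrefl)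
  define G where "G t = complex_of_real (Psi1 t) / (z - of_real t)" for t
  have dG: "(G has_vector_derivative (of_real (Psi t) / (z - of_real t) + of_real (Psi1 t) * (1 / (z - of_real t)\<^sup>2))) (at t within A)" for t A
  proof -
    have "((\<lambda>t. complex_of_real (Psi1 t)) has_vector_derivative of_real (Psi t)) (at t within A)"
      by (rule has_vector_derivative_of_real[OF has_field_derivative_at_within[OF Psi1_der]])
    moreover have "((\<lambda>t. 1 / (z - of_real t)) has_vector_derivative (1 / (z - of_real t)\<^sup>2)) (at t within A)"
    proof -
      have "((\<lambda>u. 1 / (z - u)) has_field_derivative (1 / (z - of_real t)\<^sup>2)) (at (of_real t))"
        using nz[of t] by (auto intro!: derivative_eq_intros simp: power2_eq_square)
      then show ?thesis by (rule has_vector_derivative_real_field)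
    qed
    ultimately have "((\<lambda>t. complex_of_real (Psi1 t) * (1 / (z - of_real t))) has_vector_derivative
      (of_real (Psi1 t) * (1 / (z - of_real t)\<^sup>2) + of_real (Psi t) * (1 / (z - of_real t)))) (at t within A)"
      by (rule has_vector_derivative_mult)
    then show ?thesis by (simp add: G_def[abs_def] add.commute)
  qed
  have c1: "continuous_on A (\<lambda>t. complex_of_real (Psi t) / (z - of_real t))" for A
    using nz by (intro continuous_intros cont_Psi) auto
  have c2: "continuous_on A (\<lambda>t. complex_of_real (Psi1 t) * (1 / (z - of_real t)\<^sup>2))" for A
    using nz by (intro continuous_intros cont_Psi1) auto
  have i1: "set_integrable lborel I (\<lambda>t. complex_of_real (Psi t) / (z - of_real t))"
    unfolding I by (rule borel_integrable_atLeastAtMost'[OF c1])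
  have i2: "set_integrable lborel I (\<lambda>t. complex_of_real (Psi1 t) * (1 / (z - of_real t)\<^sup>2))"
    unfolding I by (rule borel_integrable_atLeastAtMost'[OF c2])
  have "(LINT t:I|lborel. of_real (Psi t) / (z - of_real t) + of_real (Psi1 t) * (1 / (z - of_real t)\<^sup>2)) = G (x + h) - G (x - h)"
    unfolding set_lebesgue_integral_def I
    by (rule integral_FTC_atLeastAtMost[OF ab dG]) (intro continuous_on_add c1 c2)
  then have parts: "(LINT t:I|lborel. of_real (Psi1 t) * (1 / (z - of_real t)\<^sup>2)) =
      G (x + h) - G (x - h) - (LINT t:I|lborel. of_real (Psi t) / (z - of_real t))"
    using set_integral_add(2)[OF i1 i2] by simp
  have Gb: "cmod (G t) \<le> S" if "\<bar>t - x\<bar> = h" for t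
  proof -
    have "h \<le> cmod (z - of_real t)" using abs_Re_le_cmod[of "z - of_real t"] that by (simp add: x_def)
    then have "1 \<le> cmod (z - of_real t)" using h_bounds by simp
    then have "cmod (G t) \<le> \<bar>Psi1 t\<bar> / 1"
      unfolding G_def norm_divide norm_of_real by (intro divide_left_mono) auto
    then show ?thesis using Psi1_bound[of t] by simp
  qed
  have Re_k: "Re (of_real (Psi t) / (z - of_real t)) = Psi t * (x - t) / q t" for t
    by (simp add: zxy Re_divide q_def power2_commute)
  have "Re (LINT t:I|lborel. of_real (Psi t) / (z - of_real t)) = (LINT t:I|lborel. Psi t * (x - t) / q t)"
  proof -
    have "Re (LINT t:I|lborel. of_real (Psi t) / (z - of_real t)) = (LINT t|lborel. Re (indicator I t *\<^sub>R (of_real (Psi t) / (z - of_real t))))"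
      unfolding set_lebesgue_integral_def by (rule integral_Re[symmetric]) (use i1 in \<open>simp add: set_integrable_def\<close>)
    then show ?thesis by (simp add: set_lebesgue_integral_def Re_k)
  qed
  also have "\<dots> = (LINT t:I|lborel. (M t - M x) * (t - x) / q t) - (LINT t:I|lborel. (\<phi> t - \<phi> x) * (t - x) / q t) + Psi x * (LINT t:I|lborel. (x - t) / q t)"
  proof -
    have cq: "continuous_on A q" for A unfolding q_def by (intro continuous_intros)
    have j1: "set_integrable lborel I (\<lambda>t. (M t - M x) * (t - x) / q t)"
      unfolding I by (intro borel_integrable_atLeastAtMost' continuous_intros cont_M cq) (auto simp: qn)
    have j2: "set_integrable lborel I (\<lambda>t. (\<phi> t - \<phi> x) * (t - x) / q t)"
      unfolding I by (intro borel_integrable_atLeastAtMost' continuous_intros cont cq) (auto simp: qn)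
    have j3: "set_integrable lborel I (\<lambda>t. Psi x * ((x - t) / q t))"
      unfolding I by (intro borel_integrable_atLeastAtMost' continuous_intros cq) (auto simp: qn)
    have "Psi t * (x - t) / q t = (M t - M x) * (t - x) / q t - (\<phi> t - \<phi> x) * (t - x) / q t + Psi x * ((x - t) / q t)" for t
      using q[of t] by (simp add: Psi_def field_simps)
    then have "(LINT t:I|lborel. Psi t * (x - t) / q t) = (LINT t:I|lborel. (M t - M x) * (t - x) / q t - (\<phi> t - \<phi> x) * (t - x) / q t + Psi x * ((x - t) / q t))"
      by simp
    also have "\<dots> = (LINT t:I|lborel. (M t - M x) * (t - x) / q t) - (LINT t:I|lborel. (\<phi> t - \<phi> x) * (t - x) / q t) + (LINT t:I|lborel. Psi x * ((x - t) / q t))"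
      using set_integral_add(2)[OF set_integral_diff(1)[OF j1 j2] j3] set_integral_diff(2)[OF j1 j2] by simp
    finally show ?thesis unfolding set_integral_mult_right .
  qed
  also have "(LINT t:I|lborel. (x - t) / q t) = 0"
  proof -
    have "(LINT t:I|lborel. (x - t) / q t) = - ln (q (x + h)) / 2 - (- ln (q (x - h)) / 2)"
      unfolding set_lebesgue_integral_def I
    proof (rule integral_FTC_atLeastAtMost[OF ab])
      show "continuous_on {x - h..x + h} (\<lambda>t. (x - t) / q t)"
        unfolding q_def by (intro continuous_intros) (use qn in \<open>auto simp: q_def\<close>)
      fix t
      have "((\<lambda>t. - ln (q t) / 2) has_real_derivative (x - t) / q t) (at t within {x - h..x + h})"
      proof -
        have "(q has_real_derivative 2 * (t - x)) (at t within {x - h..x + h})"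
          unfolding q_def by (auto intro!: derivative_eq_intros)
        then have "((\<lambda>t. - ln (q t) / 2) has_real_derivative - (inverse (q t) * (2 * (t - x))) / 2) (at t within {x - h..x + h})"
          by (intro DERIV_cdivide DERIV_minus DERIV_chain2[OF DERIV_ln]) (rule q)
        moreover have "- (inverse (q t) * (2 * (t - x))) / 2 = (x - t) / q t" using qn[of t] by (simp add: field_simps)
        ultimately show ?thesis by simp
      qed
      then show "((\<lambda>t. - ln (q t) / 2) has_vector_derivative (x - t) / q t) (at t within {x - h..x + h})"
        by (simp add: has_real_derivative_iff_has_vector_derivative)
    qed
    then show ?thesis by (simp add: q_def)
  qed
  finally have Re_in: "Re (LINT t:I|lborel. of_real (Psi t) / (z - of_real t)) = (LINT t:I|lborel. (M t - M x) * (t - x) / q t) - local_part z"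
    by (simp add: local_part_def I_def x_def y_def q_def)
  have Mb: "\<bar>LINT t:I|lborel. (M t - M x) * (t - x) / q t\<bar> \<le> C2 * ((x + h) - (x - h))"
    unfolding I
  proof (rule set_integral_bounded[OF ab])
    show "set_integrable lborel {x - h..x + h} (\<lambda>t. (M t - M x) * (t - x) / q t)"
      unfolding q_def by (intro borel_integrable_atLeastAtMost' continuous_intros cont_M) (use qn in \<open>auto simp: q_def\<close>)
    fix t
    have "\<bar>M t - M x\<bar> \<le> C2 * \<bar>t - x\<bar>"
    proof -
      have "norm (M t - M x) \<le> C2 * norm (t - x)"
      proof (rule field_differentiable_bound[of UNIV M "\<lambda>x. pi * m x"])
        show "(M has_field_derivative pi * m z) (at z within UNIV)" for z using M_der by simp
        show "norm (pi * m z) \<le> C2" for z using m_bounds(2)[of z] m_pos[of z] by (simp add: abs_mult field_simps)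
      qed auto
      then show ?thesis by simp
    qed
    then have "\<bar>(M t - M x) * (t - x)\<bar> \<le> C2 * \<bar>t - x\<bar> * \<bar>t - x\<bar>"
      unfolding abs_mult by (intro mult_right_mono) auto
    also have "\<dots> = C2 * (t - x)\<^sup>2" by (simp add: power2_eq_square)
    also have "\<dots> \<le> C2 * q t" using C2 by (intro mult_left_mono) (auto simp: q_def)
    finally show "\<bar>(M t - M x) * (t - x) / q t\<bar> \<le> C2" using q[of t] by (simp add: divide_le_eq)
  qed
  have "Re (LINT t:I|lborel. of_real (Psi1 t) * (1 / (z - of_real t)\<^sup>2)) - local_part z =
      Re (G (x + h)) - Re (G (x - h)) - (LINT t:I|lborel. (M t - M x) * (t - x) / q t)"
    unfolding parts minus_complex.sel Re_in by simp
  moreover have "\<bar>Re (G (x + h))\<bar> \<le> S" "\<bar>Re (G (x - h))\<bar> \<le> S"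
    using abs_Re_le_cmod[of "G (x + h)"] abs_Re_le_cmod[of "G (x - h)"] Gb[of "x + h"] Gb[of "x - h"] h_bounds by auto
  ultimately show ?thesis using Mb by (simp add: algebra_simps)
qed

definition Cc where "Cc = (2 * S * pi + 2 * S + 2 * h * C2) / pi"

lemma Re_correction:
  assumes z: "0 < Im z"
  shows "\<bar>Re (correction z) + local_part z / pi\<bar> \<le> Cc"
proof -
  define I where "I = {Re z - h..Re z + h}"
  define F where "F t = complex_of_real (Psi1 t) * (1 / (z - of_real t)\<^sup>2)" for t
  have int: "integrable lborel F" unfolding F_def by (rule Pw.inverse_kernel_integrable(2)[OF z])
  have A: "integrable lborel (\<lambda>t. indicator I t *\<^sub>R F t)" "integrable lborel (\<lambda>t. indicator (- I) t *\<^sub>R F t)"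
    by (intro integrable_mult_indicator int; simp add: I_def)+
  have "(LINT t|lborel. F t) = (LINT t|lborel. indicator I t *\<^sub>R F t + indicator (- I) t *\<^sub>R F t)"
    by (intro Bochner_Integration.integral_cong) (auto simp: indicator_def)
  also have "\<dots> = (LINT t|lborel. indicator I t *\<^sub>R F t) + (LINT t|lborel. indicator (- I) t *\<^sub>R F t)"
    by (rule Bochner_Integration.integral_add[OF A])
  also have "(LINT t|lborel. indicator (- I) t *\<^sub>R F t) = (LINT t|lborel. indicator (- I) t * F t)"
    by (intro Bochner_Integration.integral_cong) (auto simp: indicator_def)
  finally have split: "(LINT t|lborel. F t) = (LINT t:I|lborel. F t) + (LINT t|lborel. indicator (- I) t * F t)"
    unfolding set_lebesgue_integral_def .
  have "Re (correction z) = - (Re (LINT t:I|lborel. F t) + Re (LINT t|lborel. indicator (- I) t * F t)) / pi"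
    unfolding correction_def Pw.log_potential2_def F_def[symmetric] split by (simp add: Re_divide_of_real)
  then have "Re (correction z) + local_part z / pi = - ((Re (LINT t:I|lborel. F t) - local_part z) + Re (LINT t|lborel. indicator (- I) t * F t)) / pi"
    by (simp add: field_simps)
  then have "\<bar>Re (correction z) + local_part z / pi\<bar> = \<bar>(Re (LINT t:I|lborel. F t) - local_part z) + Re (LINT t|lborel. indicator (- I) t * F t)\<bar> / pi"
    by simp
  also have "\<dots> \<le> Cc" unfolding Cc_def
  proof (rule divide_right_mono)
    have "\<bar>Re (LINT t|lborel. indicator (- I) t * F t)\<bar> \<le> 2 * S * pi"
      using abs_Re_le_cmod[of "LINT t|lborel. indicator (- I) t * F t"] outer_part[OF z] by (simp add: I_def F_def)
    then show "\<bar>(Re (LINT t:I|lborel. F t) - local_part z) + Re (LINT t|lborel. indicator (- I) t * F t)\<bar> \<le> 2 * S * pi + 2 * S + 2 * h * C2"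
      using inner_part[OF z] unfolding I_def F_def by linarith
  qed simp
  finally show ?thesis .
qed

lemma slope_nonneg: "(\<phi> t - \<phi> x) * (t - x) \<ge> 0" "(\<phi> t - \<phi> x) / (t - x) \<ge> 0"
  using mono[of t x] mono[of x t]
  by (cases "t \<le> x"; simp add: mult_nonneg_nonneg mult_nonpos_nonpos divide_nonneg_nonneg divide_nonpos_nonpos)+

lemma local_part_nonneg: "local_part z \<ge> 0"
  unfolding local_part_def set_lebesgue_integral_def
  by (intro integral_nonneg_AE AE_I2) (auto simp: slope_nonneg intro!: mult_nonneg_nonneg divide_nonneg_nonneg)

text \<open>Monotonicity of \<phi> makes \<open>local_part\<close> nonnegative; this upper bound is
  therefore uniform up to the real line.\<close>

lemma Re_correction_le: "0 < Im z \<Longrightarrow> Re (correction z) \<le> Cc"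
  using Re_correction[of z] divide_nonneg_pos[OF local_part_nonneg[of z] pi_gt_zero] by linarith

lemma norm_correction_le: "0 < Im z \<Longrightarrow> cmod (correction z) \<le> S / Im z"
  using Pw.norm_log_potential2_le[of z] by (simp add: correction_def norm_divide field_simps)

lemma slope_measurable[measurable]: "(\<lambda>t. (\<phi> t - \<phi> x) / (t - x)) \<in> borel_measurable borel"
  using borel_measurable_continuous_onI[OF cont(1)] by measurable

lemma slope_bounded: "\<exists>L. \<forall>t\<in>{x - h..x + h}. \<bar>(\<phi> t - \<phi> x) / (t - x)\<bar> \<le> L"
proof -
  have "compact (\<phi>' ` {x - h..x + h})"
    by (rule compact_continuous_image[OF continuous_on_subset[OF cont']]) auto
  then obtain L where L: "\<And>t. t \<in> {x - h..x + h} \<Longrightarrow> norm (\<phi>' t) \<le> L"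
    by (meson bounded_iff compact_imp_bounded imageI)
  have "\<bar>(\<phi> t - \<phi> x) / (t - x)\<bar> \<le> L" if t: "t \<in> {x - h..x + h}" for t
  proof -
    have "norm (\<phi> t - \<phi> x) \<le> L * norm (t - x)"
      by (rule field_differentiable_bound[of "{x - h..x + h}" \<phi> \<phi>'])
        (use t h_bounds L der in \<open>auto intro: has_field_derivative_at_within\<close>)
    moreover have "0 \<le> L" using L[OF t] norm_ge_zero order_trans by blast
    ultimately show ?thesis by (cases "t = x") (auto simp: divide_le_eq)
  qed
  then show ?thesis by blast
qed

text \<open>The analogue of \<theta> with the window radius \<open>h\<close> that
  \<open>local_part\<close> uses.\<close>

definition theta_h where "theta_h x = (LINT t:{x - h..x + h}|lborel. (\<phi> t - \<phi> x) / (t - x)) / pi"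

lemma slope_set_integrable: "set_integrable lborel {x - h..x + h} (\<lambda>t. (\<phi> t - \<phi> x) / (t - x))"
proof -
  obtain L where L: "\<And>t. t \<in> {x - h..x + h} \<Longrightarrow> \<bar>(\<phi> t - \<phi> x) / (t - x)\<bar> \<le> L" using slope_bounded by blast
  show ?thesis unfolding set_integrable_def
  proof (rule Bochner_Integration.integrable_bound[OF integrable_indicator_Icc[of "x - h" "x + h" L]])
    show "AE t in lborel. norm (indicator {x - h..x + h} t *\<^sub>R ((\<phi> t - \<phi> x) / (t - x))) \<le> norm (indicator {x - h..x + h} t * L)"
      using L by (intro AE_I2) (force simp: indicator_def)
  qed measurable
qed

text \<open>The smoothed integrands are dominated by the difference quotient of \<phi>, which is
  integrable on the window because \<phi> is continuously differentiable.\<close>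

lemma local_part_tendsto: "((\<lambda>y. local_part (Complex x y)) \<longlongrightarrow> pi * theta_h x) (at_right 0)"
proof (rule tendsto_at_right_sequentially[of 0 1])
  fix Y :: "nat \<Rightarrow> real"
  assume Y: "\<And>n. 0 < Y n" "\<And>n. Y n < 1" "decseq Y" "Y \<longlonglongrightarrow> 0"
  have "(\<lambda>n. LINT t|lborel. indicator {x - h..x + h} t *\<^sub>R ((\<phi> t - \<phi> x) * (t - x) / ((t - x)\<^sup>2 + (Y n)\<^sup>2)))
     \<longlonglongrightarrow> (LINT t|lborel. indicator {x - h..x + h} t *\<^sub>R ((\<phi> t - \<phi> x) / (t - x)))"
  proof (rule integral_dominated_convergence)
    show "integrable lborel (\<lambda>t. norm (indicator {x - h..x + h} t *\<^sub>R ((\<phi> t - \<phi> x) / (t - x))))"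
      using slope_set_integrable unfolding set_integrable_def by (rule integrable_norm)
    have [measurable]: "\<phi> \<in> borel_measurable borel" by (rule borel_measurable_continuous_onI[OF cont(1)])
    show "(\<lambda>t. indicator {x - h..x + h} t *\<^sub>R ((\<phi> t - \<phi> x) / (t - x))) \<in> borel_measurable lborel"
      "(\<lambda>t. indicator {x - h..x + h} t *\<^sub>R ((\<phi> t - \<phi> x) * (t - x) / ((t - x)\<^sup>2 + (Y n)\<^sup>2))) \<in> borel_measurable lborel" for n
      by measurable
    show "AE t in lborel. (\<lambda>n. indicator {x - h..x + h} t *\<^sub>R ((\<phi> t - \<phi> x) * (t - x) / ((t - x)\<^sup>2 + (Y n)\<^sup>2)))
       \<longlonglongrightarrow> indicator {x - h..x + h} t *\<^sub>R ((\<phi> t - \<phi> x) / (t - x))"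
      using AE_lborel_singleton[of x]
    proof eventually_elim
      case (elim t)
      have "(\<lambda>n. (\<phi> t - \<phi> x) * (t - x) / ((t - x)\<^sup>2 + (Y n)\<^sup>2)) \<longlonglongrightarrow> (\<phi> t - \<phi> x) * (t - x) / ((t - x)\<^sup>2 + 0\<^sup>2)"
        using elim by (intro tendsto_intros Y) auto
      moreover have "(\<phi> t - \<phi> x) * (t - x) / ((t - x)\<^sup>2 + 0\<^sup>2) = (\<phi> t - \<phi> x) / (t - x)"
        using elim by (simp add: power2_eq_square)
      ultimately show ?case by (intro tendsto_scaleR tendsto_const) simp
    qed
    show "AE t in lborel. norm (indicator {x - h..x + h} t *\<^sub>R ((\<phi> t - \<phi> x) * (t - x) / ((t - x)\<^sup>2 + (Y n)\<^sup>2)))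
       \<le> norm (indicator {x - h..x + h} t *\<^sub>R ((\<phi> t - \<phi> x) / (t - x)))" for n
      using AE_lborel_singleton[of x]
    proof eventually_elim
      case (elim t)
      have "\<bar>(\<phi> t - \<phi> x) * (t - x) / ((t - x)\<^sup>2 + (Y n)\<^sup>2)\<bar> \<le> \<bar>(\<phi> t - \<phi> x) * (t - x)\<bar> / (t - x)\<^sup>2"
        unfolding abs_divide using elim by (intro divide_left_mono) (auto intro!: mult_pos_pos simp: add_pos_nonneg)
      also have "\<dots> = \<bar>(\<phi> t - \<phi> x) / (t - x)\<bar>"
      proof -
        have "a * b / b\<^sup>2 = a / b" if "b \<noteq> 0" for a b :: real using that by (simp add: power2_eq_square)
        from this[of "\<bar>t - x\<bar>" "\<bar>\<phi> t - \<phi> x\<bar>"] show ?thesis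
          using elim unfolding abs_mult abs_divide power2_abs by simp
      qed
      finally show ?case by (auto simp: indicator_def)
    qed
  qed
  then show "(\<lambda>n. local_part (Complex x (Y n))) \<longlonglongrightarrow> pi * theta_h x"
    by (simp add: local_part_def set_lebesgue_integral_def theta_h_def)
qed simp

lemma theta_eq: "theta N \<phi> x = (LINT t|lborel. indicator {t. \<bar>t - x\<bar> < N} t *\<^sub>R ((\<phi> t - \<phi> x) / (t - x))) / pi"
  by (simp add: theta_def set_lebesgue_integral_def)

lemma theta_nonneg: "theta N \<phi> x \<ge> 0"
  unfolding theta_eq
  by (intro divide_nonneg_nonneg integral_nonneg_AE AE_I2 scaleR_nonneg_nonneg slope_nonneg(2)) auto

text \<open>Between the two windows the bi-Lipschitz condition applies to the pair t, x, so the
  difference quotient lies between 0 and \<open>C2\<close>.\<close>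

lemma theta_diff: "\<bar>theta_h x - theta N \<phi> x\<bar> \<le> 2 * h * C2 / pi"
proof -
  define J where "J = {t. \<bar>t - x\<bar> < N}"
  define f where "f t = (\<phi> t - \<phi> x) / (t - x)" for t
  have Jsub: "J \<subseteq> {x - h..x + h}" using h_bounds by (auto simp: J_def)
  have Jm: "J \<in> sets borel" unfolding J_def by measurable
  have i1: "integrable lborel (\<lambda>t. indicator {x - h..x + h} t *\<^sub>R f t)"
    using slope_set_integrable unfolding set_integrable_def f_def .
  have i2: "integrable lborel (\<lambda>t. indicator J t *\<^sub>R f t)"
  proof -
    have "integrable lborel (\<lambda>t. indicator J t *\<^sub>R (indicator {x - h..x + h} t *\<^sub>R f t))"
      by (rule integrable_mult_indicator[OF _ i1]) (use Jm in simp)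
    moreover have "(\<lambda>t. indicator J t *\<^sub>R (indicator {x - h..x + h} t *\<^sub>R f t)) = (\<lambda>t. indicator J t *\<^sub>R f t)"
      using Jsub by (intro ext) (auto simp: indicator_def)
    ultimately show ?thesis by metis
  qed
  have d: "pi * theta_h x - pi * theta N \<phi> x = (LINT t|lborel. indicator {x - h..x + h} t *\<^sub>R f t - indicator J t *\<^sub>R f t)"
    unfolding Bochner_Integration.integral_diff[OF i1 i2] by (simp add: theta_h_def theta_eq set_lebesgue_integral_def f_def J_def)
  have ae: "AE t in lborel. 0 \<le> indicator {x - h..x + h} t *\<^sub>R f t - indicator J t *\<^sub>R f t \<and>
     indicator {x - h..x + h} t *\<^sub>R f t - indicator J t *\<^sub>R f t \<le> indicator {x - h..x + h} t * C2"
    \<comment> \<open>The condition requires a distance strictly larger than N, so the two points at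
      distance exactly N are discarded.\<close>
    using AE_lborel_singleton[of "x - N"] AE_lborel_singleton[of "x + N"]
  proof eventually_elim
    case (elim t)
    show ?case
    proof (cases "t \<in> J \<or> t \<notin> {x - h..x + h}")
      case True
      then show ?thesis using Jsub C2 by (auto simp: indicator_def)
    next
      case False
      then have t: "\<bar>t - x\<bar> > N" using elim by (auto simp: J_def abs_if split: if_splits)
      have "f t \<le> C2"
      proof (cases "t > x")
        case True
        then have "N < t - x" "t - x > 0" using t N by auto
        then show ?thesis using bilip[OF \<open>N < t - x\<close>] by (simp add: f_def divide_le_eq)
      next
        case False
        then have "N < x - t" "x - t > 0" using t N by auto
        then have "(\<phi> x - \<phi> t) / (x - t) \<le> C2" using bilip[OF \<open>N < x - t\<close>] by (simp add: divide_le_eq)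
        moreover have "f t = (\<phi> x - \<phi> t) / (x - t)" unfolding f_def by (metis minus_diff_eq minus_divide_divide)
        ultimately show ?thesis by simp
      qed
      then show ?thesis using False slope_nonneg(2)[of t x] by (auto simp: indicator_def f_def)
    qed
  qed
  have "0 \<le> pi * theta_h x - pi * theta N \<phi> x" unfolding d by (rule integral_nonneg_AE) (use ae in auto)
  moreover have "pi * theta_h x - pi * theta N \<phi> x \<le> (LINT t|lborel. indicator {x - h..x + h} t * C2)"
    unfolding d by (rule integral_mono_AE) (use ae i1 i2 integrable_indicator_Icc in auto)
  moreover have "(LINT t|lborel. indicator {x - h..x + h} t * C2) = 2 * h * C2" using h_bounds by simp
  ultimately have "\<bar>pi * (theta_h x - theta N \<phi> x)\<bar> \<le> 2 * h * C2"
    unfolding right_diff_distrib by linarith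
  then show ?thesis by (simp add: abs_mult le_divide_eq mult.commute)
qed

lemma theta_measurable: "theta N \<phi> \<in> borel_measurable borel"
proof -
  have [measurable]: "\<phi> \<in> borel_measurable borel" by (rule borel_measurable_continuous_onI[OF cont(1)])
  have "(\<lambda>x. LINT t|lborel. indicator {u. \<bar>u - x\<bar> < N} t *\<^sub>R ((\<phi> t - \<phi> x) / (t - x))) \<in> borel_measurable borel"
    by (rule lborel.borel_measurable_lebesgue_integral) (simp add: indicator_def case_prod_beta', measurable)
  then show ?thesis unfolding theta_eq[abs_def] by measurable
qed

end

section \<open>The logarithm of a Hermite-Biehler function\<close>

lemma continuous_real_analytic:
  assumes "real_analytic f"
  shows "isCont f x0"
proof -
  obtain r a where r: "r > 0" and a: "\<And>x. \<bar>x - x0\<bar> < r \<Longrightarrow> (\<lambda>n. a n * (x - x0) ^ n) sums f x"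
    using assms unfolding real_analytic_def by blast
  define s where "s u = (\<Sum>n. a n * u ^ n)" for u
  have "summable (\<lambda>n. a n * (r / 2) ^ n)"
    using a[of "x0 + r / 2"] r by (auto simp: sums_iff)
  then have "isCont s 0" unfolding s_def by (rule isCont_powser) (use r in simp)
  then have "isCont s (x0 - x0)" by simp
  moreover have "isCont (\<lambda>x. x - x0) x0" by (intro continuous_intros)
  ultimately have "isCont (\<lambda>x. s (x - x0)) x0" by (rule isCont_o2[rotated])
  moreover have "eventually (\<lambda>x. s (x - x0) = f x) (nhds x0)"
    unfolding eventually_nhds_metric s_def
    using r a by (intro exI[of _ r]) (auto simp: dist_real_def sums_iff)
  ultimately show ?thesis by (simp add: isCont_cong)
qed

lemma Im_has_real_derivative:
  assumes F: "(F has_field_derivative d) (at (of_real x) within S)" and S: "\<And>t::real. of_real t \<in> S"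
  shows "((\<lambda>t. Im (F (of_real t))) has_real_derivative Im d) (at x)"
proof -
  have "(F has_derivative (*) d) (at (of_real x) within range of_real)"
    using F unfolding has_field_derivative_def by (rule has_derivative_subset) (use S in auto)
  then have "((F \<circ> of_real) has_derivative ((*) d \<circ> of_real)) (at x)"
    by (intro diff_chain_within) (auto intro!: derivative_eq_intros)
  then have "((\<lambda>t. Im ((F \<circ> of_real) t)) has_derivative (\<lambda>t. Im (((*) d \<circ> of_real) t))) (at x)"
    by (rule has_derivative_Im)
  moreover have "(\<lambda>t. Im (((*) d \<circ> of_real) t)) = (*) (Im d)" by auto
  ultimately show ?thesis by (simp add: has_field_derivative_def o_def)
qed

text \<open>The half plane is convex, so holomorphy inside and continuity on the closure suffice.
  The derivative within the closed half plane is what permits differentiation along the real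
  line.\<close>

lemma closed_half_plane_primitive:
  assumes "continuous_on {z. 0 \<le> Im z} f" "f holomorphic_on {z. 0 < Im z}"
  obtains F where "\<And>z. 0 \<le> Im z \<Longrightarrow> (F has_field_derivative f z) (at z within {z. 0 \<le> Im z})"
    "continuous_on {z. 0 \<le> Im z} F" "F holomorphic_on {z. 0 < Im z}"
    "\<And>z. 0 < Im z \<Longrightarrow> (F has_field_derivative f z) (at z)"
proof -
  have pos: "0 < Im z" if int: "z \<in> interior {z. 0 \<le> Im z}" for z
  proof -
    obtain e where e: "e > 0" "ball z e \<subseteq> {z. 0 \<le> Im z}" using int unfolding mem_interior by blast
    have "z - \<i> * of_real (e / 2) \<in> ball z e" using e(1) by (simp add: dist_norm norm_mult)
    then have "0 \<le> Im (z - \<i> * of_real (e / 2))" using e(2) by blast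
    then show ?thesis using e(1) by simp
  qed
  obtain F where F: "\<And>z. z \<in> {z. 0 \<le> Im z} \<Longrightarrow> (F has_field_derivative f z) (at z within {z. 0 \<le> Im z})"
  proof (rule holomorphic_convex_primitive[of "{z. 0 \<le> Im z}" "{}" f])
    show "convex {z. 0 \<le> Im z}" by (rule convex_halfspace_Im_ge)
    show "f field_differentiable at x" if "x \<in> interior {z. 0 \<le> Im z} - {}" for x
      using assms(2) pos[of x] that open_halfspace_Im_gt[of 0] by (auto intro: holomorphic_on_imp_differentiable_at)
  qed (use assms in auto)
  have at: "(F has_field_derivative f z) (at z)" if z: "0 < Im z" for z
  proof -
    have "(F has_field_derivative f z) (at z within {z. 0 < Im z})"
      using F[of z] z by (intro has_field_derivative_subset[OF F]) auto
    then show ?thesis using z by (simp add: at_within_open[OF _ open_halfspace_Im_gt])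
  qed
  show ?thesis
  proof
    show "continuous_on {z. 0 \<le> Im z} F" by (rule DERIV_continuous_on) (rule F)
    show "F holomorphic_on {z. 0 < Im z}" unfolding holomorphic_on_open[OF open_halfspace_Im_gt] using at by auto
  qed (use F at in auto)
qed

lemma hermite_biehler_nonzero:
  assumes "hermite_biehler E" "\<forall>x::real. E (of_real x) \<noteq> 0" "0 \<le> Im z"
  shows "E z \<noteq> 0"
proof (cases "Im z = 0")
  case True
  then have "z = of_real (Re z)" by (simp add: complex_eq_iff)
  then show ?thesis using assms(2) by metis
next
  case False
  then show ?thesis using assms by (auto simp: hermite_biehler_def dest!: spec[of _ z])
qed

text \<open>A primitive of E'/E is normalised twice: by \<open>Ln k\<close> to obtain a logarithm of
  \<open>E\<close>, and by a multiple of 2 \<pi> \<i> to match the prescribed phase.\<close>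

lemma hermite_biehler_logarithm:
  assumes HB: "hermite_biehler E" and nz: "\<forall>x::real. E (of_real x) \<noteq> 0" and ph: "is_phase E \<phi>"
  obtains l where "\<And>z. 0 \<le> Im z \<Longrightarrow> (l has_field_derivative deriv E z / E z) (at z within {z. 0 \<le> Im z})"
    "continuous_on {z. 0 \<le> Im z} l" "l holomorphic_on {z. 0 < Im z}"
    "\<And>z. 0 \<le> Im z \<Longrightarrow> E z = exp (l z)" "\<And>x::real. Im (l (of_real x)) = - \<phi> x"
proof -
  define H where "H = {z. 0 \<le> Im z}"
  have hol: "E holomorphic_on UNIV" using HB by (simp add: hermite_biehler_def entire_def)
  have holA: "E holomorphic_on A" for A using hol by (rule holomorphic_on_subset) auto
  have dholA: "deriv E holomorphic_on A" for A
    using holomorphic_deriv[OF hol open_UNIV] by (rule holomorphic_on_subset) auto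
  have nzH: "E z \<noteq> 0" if "z \<in> H" for z using hermite_biehler_nonzero[OF HB nz] that by (simp add: H_def)
  have c: "continuous_on {z. 0 \<le> Im z} (\<lambda>z. deriv E z / E z)"
    by (intro continuous_intros holomorphic_on_imp_continuous_on holA dholA) (use nzH in \<open>auto simp: H_def\<close>)
  have ho: "(\<lambda>z. deriv E z / E z) holomorphic_on {z. 0 < Im z}"
    by (intro holomorphic_intros holA dholA) (use nzH in \<open>auto simp: H_def\<close>)
  obtain l0 where l0: "\<And>z. 0 \<le> Im z \<Longrightarrow> (l0 has_field_derivative deriv E z / E z) (at z within {z. 0 \<le> Im z})"
    "continuous_on {z. 0 \<le> Im z} l0" "l0 holomorphic_on {z. 0 < Im z}"
    using closed_half_plane_primitive[OF c ho] by metis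
  have dE: "(E has_field_derivative deriv E z) (at z within A)" for z A
    using holomorphic_derivI[OF hol open_UNIV] by (auto intro: has_field_derivative_at_within)
  have "\<exists>k. \<forall>z\<in>H. E z * exp (- l0 z) = k"
  proof (rule has_field_derivative_zero_constant)
    show "convex H" unfolding H_def by (rule convex_halfspace_Im_ge)
    fix z assume z: "z \<in> H"
    have "((\<lambda>z. E z * exp (- l0 z)) has_field_derivative (deriv E z * exp (- l0 z) + (exp (- l0 z) * - (deriv E z / E z)) * E z)) (at z within H)"
      using l0(1)[of z] z unfolding H_def[symmetric]
      by (intro DERIV_mult dE DERIV_chain2[OF DERIV_exp] DERIV_minus) (auto simp: H_def)
    then show "((\<lambda>z. E z * exp (- l0 z)) has_field_derivative 0) (at z within H)"
      using nzH[OF z] by simp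
  qed
  then obtain k where k: "\<And>z. z \<in> H \<Longrightarrow> E z * exp (- l0 z) = k" by blast
  have k0: "k \<noteq> 0" using k[of 0] nzH[of 0] by (auto simp: H_def)
  have El0: "E z = exp (l0 z + Ln k)" if "z \<in> H" for z
    using k[OF that] k0 by (simp add: exp_add exp_minus field_simps)
  \<comment> \<open>The discrepancy with the phase in units of 2 \<pi>. It is continuous and integer
    valued, hence constant.\<close>
  define \<delta> where "\<delta> x = (Im (l0 (of_real x) + Ln k) + \<phi> x) / (2 * pi)" for x
  have int: "\<delta> x \<in> \<int>" for x
  proof -
    define w where "w = l0 (of_real x) + Ln k"
    have Ex: "E (of_real x) = exp w" using El0[of "of_real x"] by (simp add: w_def H_def)
    have "E (of_real x) = of_real (cmod (E (of_real x))) * exp (- \<i> * of_real (\<phi> x))"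
      using ph by (simp add: is_phase_def)
    then have "exp w = of_real (exp (Re w)) * exp (- \<i> * of_real (\<phi> x))" unfolding Ex by simp
    also have "\<dots> = exp (of_real (Re w) - \<i> * of_real (\<phi> x))" by (simp add: exp_diff exp_minus exp_of_real field_simps)
    finally obtain n :: int where "w = (of_real (Re w) - \<i> * of_real (\<phi> x)) + (of_int (2 * n) * pi) * \<i>"
      unfolding exp_eq by blast
    from arg_cong[OF this, of Im] have "Im w = - \<phi> x + 2 * of_int n * pi" by simp
    then have "\<delta> x = of_int n" by (simp add: \<delta>_def w_def)
    then show ?thesis by simp
  qed
  have cphi: "continuous_on UNIV \<phi>"
    using ph continuous_real_analytic by (auto simp: is_phase_def intro!: continuous_at_imp_continuous_on)
  have cl0: "continuous_on UNIV (\<lambda>x::real. l0 (of_real x))"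
    by (rule continuous_on_compose2[OF l0(2)]) (auto intro!: continuous_intros)
  have "continuous_on UNIV \<delta>" unfolding \<delta>_def by (intro continuous_intros cphi cl0) auto
  then have "\<delta> constant_on UNIV"
  proof (rule continuous_discrete_range_constant[OF connected_UNIV])
    fix x
    show "\<exists>e>0. \<forall>y. y \<in> UNIV \<and> \<delta> y \<noteq> \<delta> x \<longrightarrow> e \<le> norm (\<delta> y - \<delta> x)"
    proof (intro exI[of _ 1] conjI allI impI)
      fix y assume "y \<in> UNIV \<and> \<delta> y \<noteq> \<delta> x"
      moreover have "\<delta> y - \<delta> x \<in> \<int>" using int by (intro Ints_diff)
      ultimately show "1 \<le> norm (\<delta> y - \<delta> x)" by (metis Ints_nonzero_abs_ge1 real_norm_def right_minus_eq)
    qed auto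
  qed
  then obtain d where d: "\<And>x. \<delta> x = d" by (auto simp: constant_on_def)
  obtain n where n: "d = of_int n" using int[of 0] d by (auto elim: Ints_cases)
  define l where "l z = l0 z + (Ln k - \<i> * of_real (2 * pi * d))" for z
  have "exp (\<i> * of_real (2 * pi * d)) = 1"
    using exp_integer_2pi[of "of_int n"] n by (simp add: mult_ac)
  then have "exp (l0 z + Ln k) = exp (l z)" for z
    by (simp add: l_def exp_add exp_diff)
  then have El: "E z = exp (l z)" if "0 \<le> Im z" for z using El0[of z] that by (simp add: H_def)
  show ?thesis
  proof (rule that[of l])
    show "(l has_field_derivative deriv E z / E z) (at z within {z. 0 \<le> Im z})" if "0 \<le> Im z" for z
      using DERIV_add[OF l0(1)[OF that] DERIV_const] by (simp add: l_def[abs_def])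
    show "continuous_on {z. 0 \<le> Im z} l" "l holomorphic_on {z. 0 < Im z}"
      unfolding l_def by (intro continuous_intros holomorphic_intros l0)+
    show "Im (l (of_real x)) = - \<phi> x" for x
      using d[of x] by (simp add: l_def \<delta>_def field_simps)
  qed (rule El)
qed

text \<open>The derivative is - Im (E'/E) on the real line. Its sign comes from the Hermite-Biehler
  inequality: |E(x + iy)|^2 - |E(x - iy)|^2 vanishes at y = 0 and is nonnegative for y > 0, so its
  derivative at 0, namely - 4 Im (E' cnj E), is nonnegative.\<close>

lemma hermite_biehler_phase_derivative:
  assumes HB: "hermite_biehler E" and nz: "\<forall>x::real. E (of_real x) \<noteq> 0" and ph: "is_phase E \<phi>"
  obtains \<phi>' where "\<And>x. (\<phi> has_real_derivative \<phi>' x) (at x)" "continuous_on UNIV \<phi>'" "\<And>x. \<phi>' x \<ge> 0"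
proof -
  obtain l where l: "\<And>z. 0 \<le> Im z \<Longrightarrow> (l has_field_derivative deriv E z / E z) (at z within {z. 0 \<le> Im z})"
    "\<And>x::real. Im (l (of_real x)) = - \<phi> x"
    using hermite_biehler_logarithm[OF assms] by metis
  have hol: "E holomorphic_on UNIV" using HB by (simp add: hermite_biehler_def entire_def)
  have cA: "continuous_on A E" "continuous_on A (deriv E)" for A
    using holomorphic_on_imp_continuous_on[OF hol] holomorphic_on_imp_continuous_on[OF holomorphic_deriv[OF hol open_UNIV]]
    by (auto intro: continuous_on_subset)
  define \<phi>' where "\<phi>' x = - Im (deriv E (of_real x) / E (of_real x))" for x :: real
  have der: "(\<phi> has_real_derivative \<phi>' x) (at x)" for x
  proof -
    have "((\<lambda>t. Im (l (of_real t))) has_real_derivative Im (deriv E (of_real x) / E (of_real x))) (at x)"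
      by (rule Im_has_real_derivative[OF l(1)]) auto
    from DERIV_minus[OF this] show ?thesis by (simp add: l(2) \<phi>'_def)
  qed
  have cont: "continuous_on UNIV \<phi>'" unfolding \<phi>'_def
    by (intro continuous_intros continuous_on_compose2[OF cA(1)[of UNIV]] continuous_on_compose2[OF cA(2)[of UNIV]])
      (use nz in auto)
  have "\<phi>' x \<ge> 0" for x
  proof -
    define u where "u y = E (of_real x + \<i> * of_real y)" for y :: real
    define e e' where "e = E (of_real x)" and "e' = deriv E (of_real x)"
    have du: "(u has_vector_derivative \<i> * e') (at 0)"
    proof -
      have "(E has_field_derivative e') (at (of_real x + \<i> * of_real 0))"
        using holomorphic_derivI[OF hol open_UNIV] by (simp add: e'_def)
      moreover have "((\<lambda>y. of_real x + \<i> * of_real y) has_vector_derivative \<i>) (at 0)"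
        by (auto intro!: derivative_eq_intros)
      ultimately have "((E \<circ> (\<lambda>y. of_real x + \<i> * of_real y)) has_vector_derivative \<i> * e') (at 0)"
        by (rule field_vector_diff_chain_at[rotated])
      then show ?thesis by (simp add: u_def[abs_def] o_def)
    qed
    have dRe: "((\<lambda>y. Re (u y)) has_real_derivative Re (\<i> * e')) (at 0)"
      and dIm: "((\<lambda>y. Im (u y)) has_real_derivative Im (\<i> * e')) (at 0)"
      using has_vector_derivative_complex_iff[of u "\<i> * e'" "at 0"] du
      by (auto simp: has_real_derivative_iff_has_vector_derivative)
    have u0: "u 0 = e" by (simp add: u_def e_def)
    define v where "v y = (Re (u y))\<^sup>2 + (Im (u y))\<^sup>2" for y
    define D where "D = 2 * (Re e * Re (\<i> * e') + Im e * Im (\<i> * e'))"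
    have dv: "(v has_real_derivative D) (at 0)"
      unfolding v_def D_def using DERIV_add[OF DERIV_power[OF dRe, of 2] DERIV_power[OF dIm, of 2]]
      by (simp add: u0 algebra_simps)
    have "((\<lambda>y. v (- 1 * y)) has_real_derivative D * - 1) (at 0)"
      by (rule DERIV_chain2[of v]) (use dv in \<open>auto intro!: derivative_eq_intros\<close>)
    from DERIV_diff[OF dv this] have dw: "((\<lambda>y. v y - v (- y)) has_real_derivative 2 * D) (at 0)" by simp
    have pos: "v y - v (- y) \<ge> 0" if "y > 0" for y
    proof -
      have "cmod (u (- y)) < cmod (u y)"
        using HB that by (auto simp: hermite_biehler_def u_def dest!: spec[of _ "of_real x + \<i> * of_real y"])
      then have "(cmod (u (- y)))\<^sup>2 \<le> (cmod (u y))\<^sup>2" by (intro power_mono) auto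
      then show ?thesis by (simp add: v_def cmod_power2)
    qed
    have "D \<ge> 0"
    proof (rule ccontr)
      assume "\<not> D \<ge> 0"
      then obtain d where d: "d > 0" "\<And>y. 0 < y \<Longrightarrow> y < d \<Longrightarrow> v (0 + y) - v (- (0 + y)) < v 0 - v (- 0)"
        using DERIV_neg_dec_right[OF dw] by auto
      have "0 < d / 2" "d / 2 < d" using d(1) by auto
      from d(2)[OF this] pos[OF this(1)] show False by simp
    qed
    then have "Im (e' * cnj e) \<le> 0" by (simp add: D_def algebra_simps)
    moreover have "Im (e' / e) = Im (e' * cnj e) / (cmod e)\<^sup>2"
      by (simp add: Im_divide cmod_power2)
    ultimately show ?thesis by (simp add: \<phi>'_def e_def e'_def divide_nonpos_nonneg)
  qed
  then show ?thesis using der cont that by blast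
qed

lemma real_antiderivative:
  assumes "continuous_on UNIV f"
  obtains F where "\<And>x::real. (F has_real_derivative f x) (at x)"
proof -
  have "\<exists>F. \<forall>x::real. -\<infinity> < ereal x \<longrightarrow> ereal x < \<infinity> \<longrightarrow> (F has_vector_derivative f x) (at x)"
    by (rule einterval_antiderivative) (use assms in \<open>auto simp: continuous_on_eq_continuous_at\<close>)
  then show ?thesis using that by (auto simp: has_real_derivative_iff_has_vector_derivative)
qed

section \<open>Real-entire functions and the conjugation f*\<close>

lemma real_entire_deriv:
  assumes "real_entire g"
  shows "real_entire (deriv g)"
proof -
  have hol: "g holomorphic_on UNIV" using assms by (simp add: real_entire_def entire_def)
  have "Im (deriv g (of_real x)) = 0" for x :: real
  proof -
    have "(g has_field_derivative deriv g (of_real x)) (at (of_real x) within UNIV)"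
      using holomorphic_derivI[OF hol open_UNIV] by simp
    then have "((\<lambda>t. Im (g (of_real t))) has_real_derivative Im (deriv g (of_real x))) (at x)"
      by (rule Im_has_real_derivative) simp
    moreover have "(\<lambda>t::real. Im (g (of_real t))) = (\<lambda>t. 0)"
      using assms by (auto simp: real_entire_def complex_is_Real_iff)
    ultimately show ?thesis by (metis DERIV_const DERIV_unique)
  qed
  then show ?thesis
    using holomorphic_deriv[OF hol open_UNIV] by (auto simp: real_entire_def entire_def complex_is_Real_iff)
qed

lemma entire_sharp:
  assumes "entire f" shows "entire (sharp f)"
proof -
  have "cnj \<circ> f \<circ> cnj holomorphic_on UNIV"
    by (rule holomorphic_on_compose_cnj_cnj) (use assms in \<open>auto simp: entire_def intro: holomorphic_on_subset\<close>)
  then show ?thesis by (simp add: entire_def sharp_def o_def)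
qed

text \<open>The two entire functions agree on the real line, which accumulates at 0, so the identity
  theorem applies.\<close>

lemma sharp_real_entire:
  assumes g: "real_entire g"
  shows "sharp g = g"
proof
  fix z
  have "(\<lambda>z. sharp g z - g z) holomorphic_on UNIV"
    using entire_sharp[of g] g by (auto simp: real_entire_def entire_def intro!: holomorphic_intros)
  then have "sharp g z - g z = 0"
  proof (rule analytic_continuation[of _ _ "range complex_of_real" 0])
    show "0 islimpt range complex_of_real" unfolding islimpt_approachable
    proof (intro allI impI)
      fix e :: real assume "e > 0"
      show "\<exists>x'\<in>range complex_of_real. x' \<noteq> 0 \<and> dist x' 0 < e"
      proof (intro bexI conjI)
        show "complex_of_real (e / 2) \<in> range complex_of_real" by (rule rangeI)
      qed (use \<open>e > 0\<close> in \<open>auto simp: dist_norm\<close>)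
    qed
    show "sharp g z - g z = 0" if z: "z \<in> range complex_of_real" for z
    proof -
      obtain x where x: "z = of_real x" using z by auto
      have "g (of_real x) \<in> \<real>" using g by (simp add: real_entire_def)
      then show ?thesis by (simp add: sharp_def x Reals_cnj_iff)
    qed
  qed auto
  then show "sharp g z = g z" by simp
qed

section \<open>The real-entire function g and the size of E on the real line\<close>

locale hb_representation = regular_phase +
  fixes E l :: "complex \<Rightarrow> complex"
  assumes contl: "continuous_on {z. 0 \<le> Im z} l" and holl: "l holomorphic_on {z. 0 < Im z}"
    and El: "\<And>z. 0 \<le> Im z \<Longrightarrow> E z = exp (l z)" and Im_l: "\<And>x::real. Im (l (of_real x)) = - \<phi> x"
begin

text \<open>The function \<open>l - log_potential m - correction\<close> has real boundary values. Schwarz reflection is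
  applied to its second primitive, because that one extends continuously to the real line.\<close>

lemma representation:
  "\<exists>g. real_entire g \<and> (\<forall>z. 0 < Im z \<longrightarrow> g z = l z - log_potential m z + \<i> * of_real (M 0) - correction z)"
proof -
  let ?U = "{z. 0 \<le> Im z}"
  \<comment> \<open>The potential is normalised to have imaginary part 0 at the origin; the added
    constant restores \<open>M 0\<close>, so that \<open>Im a = - Psi\<close> holds exactly on the
    real line.\<close>
  define a where "a z = l z - log_potential m z + \<i> * of_real (M 0)" for z
  have holW: "log_potential m holomorphic_on {z. 0 < Im z}"
    unfolding holomorphic_on_open[OF open_halfspace_Im_gt] using mw.log_potential_has_derivative by auto
  have ca: "continuous_on ?U a" unfolding a_def
    by (intro continuous_intros contl mw.continuous_on_log_potential)
  have ha: "a holomorphic_on {z. 0 < Im z}" unfolding a_def by (intro holomorphic_intros holl holW)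
  have Im_a: "Im (a (of_real x)) = - Psi x" for x
  proof -
    have "((\<lambda>x. M x / pi) has_real_derivative m x) (at x)" for x
      using DERIV_cdivide[OF M_der[of x], of pi] by simp
    from mw.Im_log_potential_real[OF this, of x]
    have "Im (log_potential m (of_real x)) = - pi * (M x / pi - M 0 / pi)" .
    also have "\<dots> = M 0 - M x" by (simp add: field_simps)
    finally show ?thesis by (simp add: a_def Im_l Psi_def)
  qed
  obtain b where b: "\<And>z. 0 \<le> Im z \<Longrightarrow> (b has_field_derivative a z) (at z within ?U)"
    "continuous_on ?U b" "b holomorphic_on {z. 0 < Im z}" "\<And>z. 0 < Im z \<Longrightarrow> (b has_field_derivative a z) (at z)"
    using closed_half_plane_primitive[OF ca ha] by metis
  have "((\<lambda>t. Im (b (of_real t)) + Psi1 t) has_real_derivative 0) (at x)" for x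
    using DERIV_add[OF Im_has_real_derivative[OF b(1)] Psi1_der] by (simp add: Im_a)
  then have "\<exists>c. \<forall>x. Im (b (of_real x)) + Psi1 x = c" by (meson DERIV_isconst_all)
  then obtain c where c: "\<And>x. Im (b (of_real x)) = c - Psi1 x" by (metis add_diff_cancel_right')
  define a1 where "a1 z = b z - \<i> * of_real c" for z
  have ca1: "continuous_on ?U a1" and ha1: "a1 holomorphic_on {z. 0 < Im z}"
    unfolding a1_def by (intro continuous_intros holomorphic_intros b)+
  have da1: "(a1 has_field_derivative a z) (at z)" if "0 < Im z" for z
    using DERIV_diff[OF b(4)[OF that] DERIV_const] by (simp add: a1_def[abs_def])
  have Im_a1: "Im (a1 (of_real x)) = - Psi1 x" for x by (simp add: a1_def c)
  obtain a2 where a2: "\<And>z. 0 \<le> Im z \<Longrightarrow> (a2 has_field_derivative a1 z) (at z within ?U)"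
    "continuous_on ?U a2" "a2 holomorphic_on {z. 0 < Im z}" "\<And>z. 0 < Im z \<Longrightarrow> (a2 has_field_derivative a1 z) (at z)"
    using closed_half_plane_primitive[OF ca1 ha1] by metis
  \<comment> \<open>This is automatically a primitive of \<open>Psi1\<close>, so
    \<open>Im_log_potential_real\<close> identifies the boundary values of the potential of
    \<open>Psi1\<close> with those of \<open>a2\<close>.\<close>
  define P where "P x = - Im (a2 (of_real x))" for x
  have dP: "(P has_real_derivative Psi1 x) (at x)" for x
    unfolding P_def using DERIV_minus[OF Im_has_real_derivative[OF a2(1)]] by (simp add: Im_a1)
  \<comment> \<open>Dividing the potential by \<pi> matches its boundary imaginary part to that of
    \<open>a2\<close>, and the constant removes the difference at 0. In the upper half plane the
    second derivative of \<open>J\<close> is \<open>a - correction\<close>.\<close>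
  define J where "J z = a2 z - log_potential Psi1 z / of_real pi + \<i> * of_real (P 0)" for z
  have holP: "log_potential Psi1 holomorphic_on {z. 0 < Im z}"
    unfolding holomorphic_on_open[OF open_halfspace_Im_gt] using Pw.log_potential_has_derivative by auto
  have cJ: "continuous_on ?U J" unfolding J_def
    by (intro continuous_intros a2 Pw.continuous_on_log_potential) auto
  have hJ: "J holomorphic_on {z. 0 < Im z}" unfolding J_def by (intro holomorphic_intros a2 holP) auto
  have Im_J: "Im (J (of_real x)) = 0" for x
    using Pw.Im_log_potential_real[OF dP, of x] by (simp add: J_def P_def Im_divide_of_real)
  define G where "G z = (if 0 \<le> Im z then J z else cnj (J (cnj z)))" for z
  have "(\<lambda>z. if 0 \<le> Im z then J z else cnj (J (cnj z))) holomorphic_on UNIV"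
  proof (rule Schwarz_reflection)
    show "J z \<in> \<real>" if "z \<in> \<real>" for z
    proof -
      obtain x where "z = of_real x" using \<open>z \<in> \<real>\<close> by (rule Reals_cases)
      then show ?thesis using Im_J by (simp add: complex_is_Real_iff)
    qed
  qed (use cJ hJ in auto)
  then have holG: "G holomorphic_on UNIV" by (simp add: G_def[abs_def])
  have "real_entire G" using holG Im_J by (auto simp: real_entire_def entire_def G_def complex_is_Real_iff)
  then have rg: "real_entire (deriv (deriv G))" by (intro real_entire_deriv)
  have d1: "deriv G z = a1 z - Pw.log_potential1 z / of_real pi" if z: "0 < Im z" for z
  proof (rule DERIV_imp_deriv)
    have dJ: "(J has_field_derivative a1 z - Pw.log_potential1 z / of_real pi) (at z)"
    proof -
      have "((\<lambda>z. a2 z - log_potential Psi1 z / of_real pi + \<i> * of_real (P 0)) has_field_derivative a1 z - Pw.log_potential1 z / of_real pi + 0) (at z)"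
        by (intro DERIV_add DERIV_diff DERIV_cdivide a2 z Pw.log_potential_has_derivative DERIV_const)
      then show ?thesis by (simp add: J_def[abs_def])
    qed
    show "(G has_field_derivative a1 z - Pw.log_potential1 z / of_real pi) (at z)"
      by (rule has_field_derivative_transform_within_open[OF dJ open_halfspace_Im_gt])
        (use z in \<open>auto simp: G_def\<close>)
  qed
  have d2: "deriv (deriv G) z = a z - correction z" if z: "0 < Im z" for z
  proof (rule DERIV_imp_deriv)
    have "((\<lambda>z. a1 z - Pw.log_potential1 z / of_real pi) has_field_derivative a z - Pw.log_potential2 z / of_real pi) (at z)"
      by (intro DERIV_diff DERIV_cdivide da1 z Pw.log_potential1_has_derivative)
    then show "(deriv G has_field_derivative a z - correction z) (at z)"
      unfolding correction_def
      by (rule has_field_derivative_transform_within_open[OF _ open_halfspace_Im_gt]) (use z d1 in auto)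
  qed
  then show ?thesis using rg by (intro exI[of _ "deriv (deriv G)"]) (auto simp: a_def)
qed

definition g where
  "g = (SOME g. real_entire g \<and> (\<forall>z. 0 < Im z \<longrightarrow> g z = l z - log_potential m z + \<i> * of_real (M 0) - correction z))"

lemma g_spec: "real_entire g" "0 < Im z \<Longrightarrow> g z = l z - log_potential m z + \<i> * of_real (M 0) - correction z"
  using someI_ex[OF representation] unfolding g_def by auto

lemma holg: "g holomorphic_on A"
  using g_spec(1) by (auto simp: real_entire_def entire_def intro: holomorphic_on_subset)

lemma norm_E: "0 \<le> Im z \<Longrightarrow> cmod (E z) = exp (Re (l z))"
  by (simp add: El)

lemma Re_l: "0 < Im z \<Longrightarrow> Re (l z) = Re (g z) + potential m z + Re (correction z)"
  using g_spec(2)[of z] mw.Re_log_potential[of z] by simp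

lemma Re_l_real: "\<bar>Re (l (of_real x)) - Re (g (of_real x)) - potential m (of_real x) + theta N \<phi> x\<bar> \<le> Cc + 2 * h * C2 / pi"
proof -
  \<comment> \<open>Equal to \<open>Re (correction z)\<close> in the open half plane, but also
    continuous on the real line. Thus the estimate of the correction passes to the boundary without
    giving a value to its singular integral there.\<close>
  define f where "f z = Re (l z) - Re (g z) - Re (log_potential m z)" for z
  have cf: "continuous_on {z. 0 \<le> Im z} f" unfolding f_def
    by (intro continuous_intros contl mw.continuous_on_log_potential holomorphic_on_imp_continuous_on[OF holg])
  have "continuous (at 0 within {0..}) (\<lambda>y. f (Complex x y))"
  proof -
    have "continuous_on {0..} (\<lambda>y. f (Complex x y))"
      by (rule continuous_on_compose2[OF cf]) (auto intro!: continuous_intros)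
    then show ?thesis by (simp add: continuous_on_eq_continuous_within)
  qed
  then have "((\<lambda>y. f (Complex x y)) \<longlongrightarrow> f (Complex x 0)) (at_right 0)"
    unfolding continuous_within by (rule tendsto_within_subset) auto
  then have lim: "((\<lambda>y. \<bar>f (Complex x y) + local_part (Complex x y) / pi\<bar>) \<longlongrightarrow> \<bar>f (Complex x 0) + pi * theta_h x / pi\<bar>) (at_right 0)"
    by (intro tendsto_intros local_part_tendsto) auto
  have "eventually (\<lambda>y. \<bar>f (Complex x y) + local_part (Complex x y) / pi\<bar> \<le> Cc) (at_right 0)"
  proof -
    have "\<bar>f (Complex x y) + local_part (Complex x y) / pi\<bar> \<le> Cc" if "y > 0" for y
    proof -
      have "f (Complex x y) = Re (correction (Complex x y))"
        using Re_l[of "Complex x y"] mw.Re_log_potential[of "Complex x y"] that by (simp add: f_def)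
      then show ?thesis using Re_correction[of "Complex x y"] that by simp
    qed
    then show ?thesis by (auto simp: eventually_at_filter)
  qed
  then have "\<bar>f (Complex x 0) + pi * theta_h x / pi\<bar> \<le> Cc" by (intro tendsto_upperbound[OF lim]) auto
  moreover have "f (Complex x 0) = Re (l (of_real x)) - Re (g (of_real x)) - potential m (of_real x)"
    using mw.Re_log_potential[of "of_real x"] by (simp add: f_def complex_of_real_def)
  ultimately show ?thesis using theta_diff[of x] by simp
qed

end

section \<open>De Branges spaces\<close>

locale hb_space = hb_representation +
  assumes holE: "E holomorphic_on UNIV"
begin

definition Cr where "Cr = Cc + 2 * h * C2 / pi"

lemma E_nonzero: "0 \<le> Im z \<Longrightarrow> E z \<noteq> 0"
  by (simp add: El)

lemma holE': "E holomorphic_on A"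
  using holE by (rule holomorphic_on_subset) auto

lemma cont_entire: "entire f \<Longrightarrow> continuous_on A f"
  unfolding entire_def by (meson continuous_on_subset holomorphic_on_imp_continuous_on subset_UNIV)

lemma norm_quotient:
  assumes "0 < Im z"
  shows "cmod (exp (g z) * f z / E z) = cmod (f z) * exp (- potential m z) * exp (- Re (correction z))"
  using assms Re_l[OF assms] by (simp add: norm_divide norm_mult norm_E exp_add exp_minus field_simps)

definition weighted_sq where
  "weighted_sq f x = (cmod (f (of_real x)))\<^sup>2 * exp (- 2 * potential m (of_real x)) * exp (2 * theta N \<phi> x)"

lemma norm_quotient_real:
  shows "weighted_sq f x \<le> exp (2 * Cr) * (cmod (exp (g (of_real x)) * f (of_real x) / E (of_real x)))\<^sup>2"
    and "(cmod (exp (g (of_real x)) * f (of_real x) / E (of_real x)))\<^sup>2 \<le> exp (2 * Cr) * weighted_sq f x"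
proof -
  define d where "d = Re (l (of_real x)) - Re (g (of_real x)) - potential m (of_real x) + theta N \<phi> x"
  have d: "\<bar>d\<bar> \<le> Cr" using Re_l_real[of x] by (simp add: d_def Cr_def)
  have "(cmod (exp (g (of_real x)) * f (of_real x) / E (of_real x)))\<^sup>2 =
    (cmod (f (of_real x)))\<^sup>2 * (exp (Re (g (of_real x)) - Re (l (of_real x))))\<^sup>2"
    by (simp add: norm_divide norm_mult norm_E exp_diff power_mult_distrib power_divide)
  also have "(exp (Re (g (of_real x)) - Re (l (of_real x))))\<^sup>2 =
      exp (- 2 * potential m (of_real x)) * exp (2 * theta N \<phi> x) * exp (- 2 * d)"
    by (simp add: d_def power2_eq_square flip: exp_add)
  finally have e: "(cmod (exp (g (of_real x)) * f (of_real x) / E (of_real x)))\<^sup>2 = weighted_sq f x * exp (- 2 * d)"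
    by (simp add: weighted_sq_def)
  have w0: "weighted_sq f x \<ge> 0" by (simp add: weighted_sq_def)
  have "exp (- 2 * d) \<le> exp (2 * Cr)" using d by simp
  from mult_left_mono[OF this w0]
  show "(cmod (exp (g (of_real x)) * f (of_real x) / E (of_real x)))\<^sup>2 \<le> exp (2 * Cr) * weighted_sq f x"
    unfolding e by (simp add: mult.commute)
  have "1 \<le> exp (2 * Cr) * exp (- 2 * d)" using d by (simp flip: exp_add)
  from mult_left_mono[OF this w0]
  show "weighted_sq f x \<le> exp (2 * Cr) * (cmod (exp (g (of_real x)) * f (of_real x) / E (of_real x)))\<^sup>2"
    unfolding e by (simp add: mult_ac)
qed

definition weighted_space :: "(complex \<Rightarrow> complex) set" where
  "weighted_space = {f. entire f \<and>
      integrable lborel (\<lambda>x. weighted_sq f x) \<and>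
      subexp_growth m f}"

lemma weight_measurable:
  assumes "entire f"
  shows "(\<lambda>x. weighted_sq f x) \<in> borel_measurable lborel"
proof -
  have [measurable]: "(\<lambda>x::real. f (of_real x)) \<in> borel_measurable borel"
    by (intro borel_measurable_continuous_onI continuous_on_compose2[OF cont_entire[OF assms, of UNIV]] continuous_intros) auto
  note [measurable] = mw.potential_measurable theta_measurable
  show ?thesis unfolding weighted_sq_def by measurable
qed

lemma quotient_measurable:
  assumes "entire f"
  shows "(\<lambda>x. f (of_real x) / E (of_real x)) \<in> borel_measurable lborel"
proof -
  have "continuous_on UNIV (\<lambda>x::real. f (of_real x) / E (of_real x))"
    by (intro continuous_intros continuous_on_compose2[OF cont_entire[OF assms, of UNIV]]
        continuous_on_compose2[OF holomorphic_on_imp_continuous_on[OF holE]]) (auto simp: E_nonzero)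
  then show ?thesis by (simp add: borel_measurable_continuous_onI)
qed

lemma sharp_exp_g: "sharp (\<lambda>z. exp (g z) * f z) z = exp (g z) * sharp f z"
  using fun_cong[OF sharp_real_entire[OF g_spec(1)], of z] by (simp add: sharp_def exp_cnj)

lemma norm_sharp_real: "cmod (sharp f (of_real x)) = cmod (f (of_real x))"
  by (simp add: sharp_def)

lemma boundary_quotient:
  assumes "entire f" "square_integrable (\<lambda>x. f (of_real x) / E (of_real x))"
  shows "boundary_square_integrable (\<lambda>z. f z / E z)"
proof
  have "f holomorphic_on A" for A
    using assms(1) unfolding entire_def by (rule holomorphic_on_subset) auto
  then show "(\<lambda>z. f z / E z) holomorphic_on {z. 0 < Im z}"
    by (intro holomorphic_intros holE') (auto simp: E_nonzero)
  show "continuous_on {z. 0 \<le> Im z} (\<lambda>z. f z / E z)"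
    by (intro continuous_intros cont_entire[OF assms(1)] holomorphic_on_imp_continuous_on[OF holE']) (auto simp: E_nonzero)
qed (rule assms(2))

text \<open>Passing from the quotient by \<open>E\<close> to the weight exp (- \<omega>) costs the
  factor exp (Re D), which is bounded.\<close>

lemma upper_bound:
  assumes f: "entire f" "square_integrable (\<lambda>x. exp (g (of_real x)) * f (of_real x) / E (of_real x))"
    "(\<lambda>z. exp (g z) * f z / E z) \<in> nevanlinna0"
  shows "\<exists>A\<ge>0. \<forall>z. 0 < Im z \<longrightarrow> (cmod (f z) * exp (- potential m z))\<^sup>2 \<le> A * (1 + 1 / Im z)"
proof -
  have "entire (\<lambda>z. exp (g z) * f z)"
    using f(1) holg unfolding entire_def by (intro holomorphic_intros)
  from boundary_quotient[OF this f(2)] interpret boundary_square_integrable "\<lambda>z. exp (g z) * f z / E z" .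
  obtain A where A: "A \<ge> 0" "\<And>z. 0 < Im z \<Longrightarrow> (cmod (exp (g z) * f z / E z))\<^sup>2 \<le> A * (1 + 1 / Im z)"
    using pointwise_bound[OF f(3)] by blast
  have "(cmod (f z) * exp (- potential m z))\<^sup>2 \<le> (exp (2 * Cc) * A) * (1 + 1 / Im z)" if z: "0 < Im z" for z
  proof -
    have "cmod (f z) * exp (- potential m z) = cmod (exp (g z) * f z / E z) * exp (Re (correction z))"
      unfolding norm_quotient[OF z] by (simp add: mult.assoc flip: exp_add)
    also have "\<dots> \<le> cmod (exp (g z) * f z / E z) * exp Cc"
      using Re_correction_le[OF z] by (intro mult_left_mono) auto
    finally have "(cmod (f z) * exp (- potential m z))\<^sup>2 \<le> (cmod (exp (g z) * f z / E z) * exp Cc)\<^sup>2"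
      by (intro power_mono) auto
    also have "\<dots> = exp (2 * Cc) * (cmod (exp (g z) * f z / E z))\<^sup>2"
      by (simp add: power_mult_distrib power2_eq_square flip: exp_add)
    also have "\<dots> \<le> exp (2 * Cc) * (A * (1 + 1 / Im z))" by (intro mult_left_mono A z) auto
    finally show ?thesis by (simp add: mult.assoc)
  qed
  then show ?thesis using A(1) by (intro exI[of _ "exp (2 * Cc) * A"]) auto
qed

text \<open>Near the real line the bound \<open>O(1 / sqrt \<bar>Im z\<bar>)\<close> is improved by dividing by the zero-free function
  \<open>exp (log_potential m (z + 2 \<i>))\<close> and applying the maximum principle in discs centred on the real line.\<close>

lemma growth_from_bound:
  assumes f: "entire f" and A: "A \<ge> 0"
    and bd: "\<And>z. Im z \<noteq> 0 \<Longrightarrow> (cmod (f z) * exp (- potential m z))\<^sup>2 \<le> A * (1 + 1 / \<bar>Im z\<bar>)"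
  shows "subexp_growth m f"
proof -
  obtain Cs where Cs: "Cs \<ge> 0" "\<And>z. \<bar>Im z\<bar> \<le> 1 \<Longrightarrow> potential m z \<le> potential m (z + 2 * \<i>) \<and> potential m (z + 2 * \<i>) \<le> potential m z + Cs"
    using mw.potential_shift m_pos by (metis less_imp_le)
  define P where "P w = f w * exp (- log_potential m (w + 2 * \<i>))" for w
  have nP: "cmod (P w) = cmod (f w) * exp (- potential m (w + 2 * \<i>))" if "\<bar>Im w\<bar> \<le> 1" for w
  proof -
    have "0 \<le> Im (w + 2 * \<i>)" using that by simp
    then show ?thesis using mw.Re_log_potential[of "w + 2 * \<i>"] by (simp add: P_def norm_mult)
  qed
  have P1: "cmod (P w) \<le> cmod (f w) * exp (- potential m w)" if "\<bar>Im w\<bar> \<le> 1" for w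
    unfolding nP[OF that] using Cs(2)[OF that] by (intro mult_left_mono) auto
  have P2: "cmod (f w) * exp (- potential m w) \<le> cmod (P w) * exp Cs" if "\<bar>Im w\<bar> \<le> 1" for w
  proof -
    have "exp (- potential m w) \<le> exp (- potential m (w + 2 * \<i>)) * exp Cs"
      using Cs(2)[OF that] by (simp flip: exp_add)
    then show ?thesis unfolding nP[OF that] by (simp add: mult.assoc mult_left_mono)
  qed
  have holP: "P holomorphic_on {w. -2 < Im w}"
  proof -
    have W: "log_potential m holomorphic_on {z. 0 < Im z}"
      unfolding holomorphic_on_open[OF open_halfspace_Im_gt] using mw.log_potential_has_derivative by auto
    have "(log_potential m \<circ> (\<lambda>w. w + 2 * \<i>)) holomorphic_on {w. -2 < Im w}"
      by (rule holomorphic_on_compose_gen[OF _ W]) (auto intro!: holomorphic_intros)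
    moreover have "f holomorphic_on {w. -2 < Im w}" using f unfolding entire_def by (rule holomorphic_on_subset) auto
    ultimately show ?thesis unfolding P_def by (intro holomorphic_intros) (auto simp: o_def)
  qed
  \<comment> \<open>The 8 is 4 * (1 * 1 + 1), the largest value on the unit circle below of (1 +
    1/y) (2y)^2 with y = |Im u|.\<close>
  define B where "B = sqrt (8 * A)"
  have Bn: "B \<ge> 0" using A by (simp add: B_def)
  have near: "cmod (P w) \<le> B" if w: "\<bar>Im w\<bar> \<le> 1 / 2" for w
  proof -
    define x0 where "x0 = complex_of_real (Re w)"
    \<comment> \<open>The quadratic factor vanishes where the circle meets the real line and has
      modulus 2 |Im u| on the circle, which outweighs the singularity |Im u| to the power -1/2. At
      \<open>w\<close>, directly above or below the centre, its modulus is at least 1.\<close>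
    define k where "k u = P u * ((u - x0)\<^sup>2 - 1)" for u
    have sub: "cball x0 1 \<subseteq> {w. -2 < Im w}"
    proof
      fix u assume "u \<in> cball x0 1"
      then have "\<bar>Im (x0 - u)\<bar> \<le> 1" using abs_Im_le_cmod[of "x0 - u"] by (simp add: dist_norm)
      then show "u \<in> {w. -2 < Im w}" by (simp add: x0_def)
    qed
    have holk: "k holomorphic_on cball x0 1"
      unfolding k_def by (intro holomorphic_intros holomorphic_on_subset[OF holP sub])
    have "cmod (k w) \<le> B"
    proof (rule maximum_modulus_frontier[of k "ball x0 1"])
      show "k holomorphic_on interior (ball x0 1)" using holk by (rule holomorphic_on_subset) auto
      show "continuous_on (closure (ball x0 1)) k" using holomorphic_on_imp_continuous_on[OF holk] by simp
      have "w - x0 = \<i> * of_real (Im w)" by (simp add: x0_def complex_eq_iff)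
      then show "w \<in> ball x0 1" using w by (simp add: dist_norm norm_minus_commute norm_mult)
      fix u assume "u \<in> frontier (ball x0 1)"
      then have u1: "cmod (u - x0) = 1" by (simp add: dist_norm norm_minus_commute)
      define s where "s = u - x0"
      have s1: "cmod s = 1" and Ims: "Im s = Im u" using u1 by (auto simp: s_def x0_def)
      have y1: "\<bar>Im u\<bar> \<le> 1" using abs_Im_le_cmod[of s] s1 Ims by simp
      have ss: "cmod (s\<^sup>2 - 1) = 2 * \<bar>Im u\<bar>"
      proof -
        have "s\<^sup>2 - 1 = s * (s - cnj s)"
          using complex_norm_square[of s] s1 by (simp add: power2_eq_square algebra_simps)
        moreover have "cmod (s - cnj s) = 2 * \<bar>Im s\<bar>" by (simp add: complex_diff_cnj norm_mult)
        ultimately show ?thesis using s1 Ims by (simp add: norm_mult)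
      qed
      show "cmod (k u) \<le> B"
      proof (cases "Im u = 0")
        case True
        then show ?thesis using ss Bn by (simp add: k_def s_def norm_mult)
      next
        case False
        have "(cmod (k u))\<^sup>2 = (cmod (P u))\<^sup>2 * (2 * \<bar>Im u\<bar>)\<^sup>2"
          unfolding k_def s_def[symmetric] norm_mult ss power_mult_distrib ..
        also have "\<dots> \<le> (A * (1 + 1 / \<bar>Im u\<bar>)) * (2 * \<bar>Im u\<bar>)\<^sup>2"
        proof (rule mult_right_mono)
          have "(cmod (P u))\<^sup>2 \<le> (cmod (f u) * exp (- potential m u))\<^sup>2" using P1[OF y1] by (intro power_mono) auto
          then show "(cmod (P u))\<^sup>2 \<le> A * (1 + 1 / \<bar>Im u\<bar>)" using bd[OF False] by linarith
        qed simp
        also have "\<dots> = A * (4 * (\<bar>Im u\<bar> * \<bar>Im u\<bar> + \<bar>Im u\<bar>))"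
          using False by (simp add: power2_eq_square field_simps)
        also have "\<dots> \<le> A * (4 * (1 * 1 + 1))"
          using A y1 by (intro mult_left_mono add_mono mult_mono) auto
        finally show ?thesis by (simp add: B_def real_le_rsqrt mult.commute)
      qed
    qed simp
    moreover have "cmod (P w) * 1 \<le> cmod (P w) * cmod ((w - x0)\<^sup>2 - 1)"
    proof (rule mult_left_mono)
      have "w - x0 = \<i> * of_real (Im w)" by (simp add: x0_def complex_eq_iff)
      then have "(w - x0)\<^sup>2 - 1 = - of_real (1 + (Im w)\<^sup>2)" by (simp add: power_mult_distrib)
      then have "cmod ((w - x0)\<^sup>2 - 1) = 1 + (Im w)\<^sup>2" by (simp only: norm_minus_cancel norm_of_real) simp
      then show "1 \<le> cmod ((w - x0)\<^sup>2 - 1)" by simp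
    qed simp
    ultimately show ?thesis by (simp add: k_def norm_mult)
  qed
  \<comment> \<open>The two entries treat |Im z| \<le> 1/2 and |Im z| > 1/2, where 1 + 1 / |Im z|
    \<le> 3; adding 1 secures positivity. The resulting bound needs no exponential factor at
    all.\<close>
  define C where "C = max (B * exp Cs) (sqrt (3 * A)) + 1"
  have Cpos: "C > 0"
  proof -
    have "0 \<le> B * exp Cs" using Bn by simp
    then show ?thesis unfolding C_def by linarith
  qed
  have tot: "cmod (f z) * exp (- potential m z) \<le> C" for z
  proof (cases "\<bar>Im z\<bar> \<le> 1 / 2")
    case True
    then have "cmod (f z) * exp (- potential m z) \<le> cmod (P z) * exp Cs" by (intro P2) auto
    also have "\<dots> \<le> B * exp Cs" using near[OF True] by (intro mult_right_mono) auto
    finally show ?thesis by (simp add: C_def)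
  next
    case False
    then have "1 / \<bar>Im z\<bar> \<le> 2" by (simp add: field_simps)
    then have "A * (1 + 1 / \<bar>Im z\<bar>) \<le> A * 3" using A by (intro mult_left_mono) auto
    moreover have "Im z \<noteq> 0" using False by auto
    ultimately have "(cmod (f z) * exp (- potential m z))\<^sup>2 \<le> 3 * A" using bd[of z] by simp
    then have "cmod (f z) * exp (- potential m z) \<le> sqrt (3 * A)" by (rule real_le_rsqrt)
    then show ?thesis by (simp add: C_def)
  qed
  show ?thesis unfolding subexp_growth_def
  proof (intro allI impI exI conjI)
    fix \<epsilon> :: real and z assume "\<epsilon> > 0"
    have "C * 1 \<le> C * exp (\<epsilon> * \<bar>Im z\<bar>)" using Cpos \<open>\<epsilon> > 0\<close> by (intro mult_left_mono) auto
    then show "cmod (f z) * exp (- potential m z) \<le> C * exp (\<epsilon> * \<bar>Im z\<bar>)" using tot[of z] by simp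
  qed (rule Cpos)
qed

lemma norm_sharp_weight:
  "cmod (sharp f (cnj z)) * exp (- potential m (cnj z)) = cmod (f z) * exp (- potential m z)"
  by (simp add: sharp_def potential_cnj)

text \<open>The quotient F/E controls the upper half plane. The quotient F*/E controls the lower
  one, because g is real-entire and the potential is invariant under conjugation.\<close>

lemma de_branges_to_weighted:
  assumes "(\<lambda>z. exp (g z) * f z) \<in> de_branges E" "entire f"
  shows "f \<in> weighted_space"
proof -
  have sq: "square_integrable (\<lambda>x. exp (g (of_real x)) * f (of_real x) / E (of_real x))"
    and n1: "(\<lambda>z. exp (g z) * f z / E z) \<in> nevanlinna0"
    and n2: "(\<lambda>z. exp (g z) * sharp f z / E z) \<in> nevanlinna0"
    using assms(1) by (auto simp: de_branges_def sharp_exp_g)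
  have sq': "square_integrable (\<lambda>x. exp (g (of_real x)) * sharp f (of_real x) / E (of_real x))"
    using sq by (simp add: square_integrable_def norm_divide norm_mult norm_sharp_real)
  obtain A1 where A1: "A1 \<ge> 0" "\<And>z. 0 < Im z \<Longrightarrow> (cmod (f z) * exp (- potential m z))\<^sup>2 \<le> A1 * (1 + 1 / Im z)"
    using upper_bound[OF assms(2) sq n1] by blast
  obtain A2 where A2: "A2 \<ge> 0" "\<And>z. 0 < Im z \<Longrightarrow> (cmod (sharp f z) * exp (- potential m z))\<^sup>2 \<le> A2 * (1 + 1 / Im z)"
    using upper_bound[OF entire_sharp[OF assms(2)] sq' n2] by blast
  have "(cmod (f z) * exp (- potential m z))\<^sup>2 \<le> (A1 + A2) * (1 + 1 / \<bar>Im z\<bar>)" if "Im z \<noteq> 0" for z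
  proof -
    have mono: "a * (1 + 1 / \<bar>Im z\<bar>) \<le> (A1 + A2) * (1 + 1 / \<bar>Im z\<bar>)" if "a \<le> A1 + A2" for a
      using that by (intro mult_right_mono) auto
    show ?thesis
    proof (cases "Im z > 0")
      case True
      then show ?thesis using A1(2)[of z] mono[of A1] A2(1) by simp
    next
      case False
      then have "0 < Im (cnj z)" using \<open>Im z \<noteq> 0\<close> by simp
      from A2(2)[OF this] mono[of A2] A1(1) False show ?thesis unfolding norm_sharp_weight by simp
    qed
  qed
  then have "subexp_growth m f" by (rule growth_from_bound[OF assms(2) add_nonneg_nonneg[OF A1(1) A2(1)]])
  moreover have "integrable lborel (\<lambda>x. weighted_sq f x)"
  proof (rule Bochner_Integration.integrable_bound)
    show "integrable lborel (\<lambda>x. exp (2 * Cr) * (cmod (exp (g (of_real x)) * f (of_real x) / E (of_real x)))\<^sup>2)"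
      using sq by (simp add: square_integrable_def)
    show "AE x in lborel. norm (weighted_sq f x)
       \<le> norm (exp (2 * Cr) * (cmod (exp (g (of_real x)) * f (of_real x) / E (of_real x)))\<^sup>2)"
      using norm_quotient_real(1)[of f] by (intro AE_I2) (simp add: weighted_sq_def)
  qed (rule weight_measurable[OF assms(2)])
  ultimately show ?thesis using assms(2) by (simp add: weighted_space_def)
qed

text \<open>Here the factor exp (- Re D) appears, and it is estimated only by exp (S / Im z). This
  is the parameter \<open>a\<close> of \<open>in_nevanlinna0\<close>.\<close>

lemma quotient_in_nevanlinna0:
  assumes "entire f" "square_integrable (\<lambda>x. exp (g (of_real x)) * f (of_real x) / E (of_real x))" "subexp_growth m f"
  shows "(\<lambda>z. exp (g z) * f z / E z) \<in> nevanlinna0"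
proof -
  have "entire (\<lambda>z. exp (g z) * f z)"
    using assms(1) holg unfolding entire_def by (intro holomorphic_intros)
  from boundary_quotient[OF this assms(2)] interpret boundary_square_integrable "\<lambda>z. exp (g z) * f z / E z" .
  show ?thesis
  proof (rule in_nevanlinna0[OF S_nonneg])
    fix \<epsilon> :: real assume "\<epsilon> > 0"
    then obtain C where C: "C > 0" "\<And>z. cmod (f z) * exp (- potential m z) \<le> C * exp (\<epsilon> * \<bar>Im z\<bar>)"
      using assms(3) unfolding subexp_growth_def by blast
    have "cmod (exp (g z) * f z / E z) \<le> C * exp (\<epsilon> * Im z + S / Im z)" if z: "0 < Im z" for z
    proof -
      have "\<bar>Re (correction z)\<bar> \<le> S / Im z"
        using norm_correction_le[OF z] abs_Re_le_cmod[of "correction z"] by linarith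
      then have "exp (- Re (correction z)) \<le> exp (S / Im z)" by simp
      then have "cmod (f z) * exp (- potential m z) * exp (- Re (correction z)) \<le> C * exp (\<epsilon> * \<bar>Im z\<bar>) * exp (S / Im z)"
        using C(1) by (intro mult_mono C) auto
      then show ?thesis unfolding norm_quotient[OF z] using z by (simp add: exp_add mult.assoc)
    qed
    then show "\<exists>C. \<forall>z. 0 < Im z \<longrightarrow> cmod (exp (g z) * f z / E z) \<le> C * exp (\<epsilon> * Im z + S / Im z)" by blast
  qed
qed

lemma subexp_growth_sharp:
  assumes "subexp_growth m f" shows "subexp_growth m (sharp f)"
proof -
  have "cmod (sharp f z) * exp (- potential m z) = cmod (f (cnj z)) * exp (- potential m (cnj z))" for z
    by (simp add: sharp_def potential_cnj)
  moreover have "\<bar>Im (cnj z)\<bar> = \<bar>Im z\<bar>" for z by simp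
  ultimately show ?thesis using assms unfolding subexp_growth_def by metis
qed

lemma weighted_to_de_branges:
  assumes "f \<in> weighted_space"
  shows "(\<lambda>z. exp (g z) * f z) \<in> de_branges E"
proof -
  have f: "entire f" "subexp_growth m f"
    and int: "integrable lborel (\<lambda>x. weighted_sq f x)"
    using assms by (auto simp: weighted_space_def)
  have ent: "entire (\<lambda>z. exp (g z) * f z)"
    using f(1) holg unfolding entire_def by (intro holomorphic_intros)
  have sq: "square_integrable (\<lambda>x. exp (g (of_real x)) * f (of_real x) / E (of_real x))"
    unfolding square_integrable_def
  proof (rule Bochner_Integration.integrable_bound)
    show "integrable lborel (\<lambda>x. exp (2 * Cr) * (weighted_sq f x))"
      by (rule integrable_mult_right[OF int])
    show "(\<lambda>x. (cmod (exp (g (of_real x)) * f (of_real x) / E (of_real x)))\<^sup>2) \<in> borel_measurable lborel"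
      using quotient_measurable[OF ent] by measurable
    show "AE x in lborel. norm ((cmod (exp (g (of_real x)) * f (of_real x) / E (of_real x)))\<^sup>2)
       \<le> norm (exp (2 * Cr) * (weighted_sq f x))"
      using norm_quotient_real(2)[where f = f] by (intro AE_I2) (simp add: weighted_sq_def)
  qed
  have sq': "square_integrable (\<lambda>x. exp (g (of_real x)) * sharp f (of_real x) / E (of_real x))"
    using sq by (simp add: square_integrable_def norm_divide norm_mult norm_sharp_real)
  show ?thesis
    using ent sq quotient_in_nevanlinna0[OF f(1) sq f(2)]
      quotient_in_nevanlinna0[OF entire_sharp[OF f(1)] sq' subexp_growth_sharp[OF f(2)]]
    by (auto simp: de_branges_def sharp_exp_g)
qed

lemma weighted_space_eq: "exp_mult (\<lambda>z. - g z) (de_branges E) = weighted_space"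
proof (intro equalityI subsetI)
  fix f assume "f \<in> exp_mult (\<lambda>z. - g z) (de_branges E)"
  then obtain F where F: "F \<in> de_branges E" "f = (\<lambda>z. exp (- g z) * F z)" by (auto simp: exp_mult_def)
  have "(\<lambda>z. exp (g z) * f z) = F" by (auto simp: F(2) exp_minus)
  moreover have "entire f"
    using F(1) holg unfolding F(2) de_branges_def entire_def by (auto intro!: holomorphic_intros)
  ultimately show "f \<in> weighted_space" using de_branges_to_weighted[of f] F(1) by simp
next
  fix f assume "f \<in> weighted_space"
  then have "(\<lambda>z. exp (g z) * f z) \<in> de_branges E" by (rule weighted_to_de_branges)
  moreover have "f = (\<lambda>z. exp (- g z) * (exp (g z) * f z))" by (auto simp: exp_minus)
  ultimately show "f \<in> exp_mult (\<lambda>z. - g z) (de_branges E)"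
    unfolding exp_mult_def by (intro CollectI exI conjI)
qed

text \<open>Since \<theta> is nonnegative, removing the factor exp (2 \<theta>) can only decrease
  the integral.\<close>

lemma weighted_subset_PW: "weighted_space \<subseteq> PW m"
proof
  fix f assume f: "f \<in> weighted_space"
  then have ent: "entire f" by (simp add: weighted_space_def)
  have [measurable]: "(\<lambda>x::real. f (of_real x)) \<in> borel_measurable borel"
    by (intro borel_measurable_continuous_onI continuous_on_compose2[OF cont_entire[OF ent, of UNIV]] continuous_intros) auto
  note [measurable] = mw.potential_measurable
  have "square_integrable (\<lambda>x. f (of_real x) * of_real (exp (- potential m (of_real x))))"
    unfolding square_integrable_def
  proof (rule Bochner_Integration.integrable_bound)
    show "integrable lborel (\<lambda>x. weighted_sq f x)"
      using f by (simp add: weighted_space_def)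
    show "AE x in lborel. norm ((cmod (f (of_real x) * of_real (exp (- potential m (of_real x)))))\<^sup>2)
       \<le> norm (weighted_sq f x)"
    proof (rule AE_I2)
      fix x
      have "(cmod (f (of_real x) * of_real (exp (- potential m (of_real x)))))\<^sup>2 = (cmod (f (of_real x)))\<^sup>2 * exp (- 2 * potential m (of_real x)) * 1"
        by (simp add: norm_mult power_mult_distrib power2_eq_square flip: exp_add)
      also have "\<dots> \<le> weighted_sq f x"
        unfolding weighted_sq_def using theta_nonneg[of x] by (intro mult_left_mono) auto
      finally show "norm ((cmod (f (of_real x) * of_real (exp (- potential m (of_real x)))))\<^sup>2)
       \<le> norm (weighted_sq f x)" by simp
    qed
  qed measurable
  then show "f \<in> PW m" using f by (simp add: weighted_space_def PW_def)
qed

lemma de_branges_subset: "de_branges E \<subseteq> exp_mult g (PW m)"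
proof
  fix F assume F: "F \<in> de_branges E"
  then have "(\<lambda>z. exp (- g z) * F z) \<in> weighted_space" using weighted_space_eq by (auto simp: exp_mult_def)
  then have "(\<lambda>z. exp (- g z) * F z) \<in> PW m" using weighted_subset_PW by blast
  moreover have "F = (\<lambda>z. exp (g z) * (exp (- g z) * F z))" by (auto simp: exp_minus)
  ultimately show "F \<in> exp_mult g (PW m)" unfolding exp_mult_def by (intro CollectI exI conjI)
qed

end

theorem theorem1p1:
  fixes E :: "complex \<Rightarrow> complex" and \<phi> :: "real \<Rightarrow> real" and N :: real
  assumes "hermite_biehler E"
    and "\<forall>x::real. E (of_real x) \<noteq> 0"
    and "is_phase E \<phi>"
    and "N \<ge> 0"
    and "bi_lipschitz_beyond N \<phi>"
  shows "\<exists>(m :: real \<Rightarrow> real) (g :: complex \<Rightarrow> complex).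
    m \<in> borel_measurable borel \<and> (\<forall>t. 0 < m t) \<and> comparable_to_1 m \<and> real_entire g \<and>
    de_branges E \<subseteq> exp_mult g (PW m) \<and>
    exp_mult (\<lambda>z. - g z) (de_branges E) =
      {f. entire f \<and>
          integrable lborel (\<lambda>x. (cmod (f (of_real x)))\<^sup>2
            * exp (- 2 * potential m (of_real x)) * exp (2 * theta N \<phi> x)) \<and>
          subexp_growth m f}"
proof -
  obtain l where l: "continuous_on {z. 0 \<le> Im z} l" "l holomorphic_on {z. 0 < Im z}"
    "\<And>z. 0 \<le> Im z \<Longrightarrow> E z = exp (l z)" "\<And>x::real. Im (l (of_real x)) = - \<phi> x"
    using hermite_biehler_logarithm[OF assms(1-3)] by metis
  obtain \<phi>' where \<phi>': "\<And>x. (\<phi> has_real_derivative \<phi>' x) (at x)" "continuous_on UNIV \<phi>'" "\<And>x. \<phi>' x \<ge> 0"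
    using hermite_biehler_phase_derivative[OF assms(1-3)] by metis
  obtain C1 C2 where C: "C1 > 0" "C2 > 0"
    "\<And>x1 x2. x2 - x1 > N \<Longrightarrow> C1 * (x2 - x1) \<le> \<phi> x2 - \<phi> x1 \<and> \<phi> x2 - \<phi> x1 \<le> C2 * (x2 - x1)"
    using assms(5) unfolding bi_lipschitz_beyond_def by blast
  have "continuous_on UNIV \<phi>" using \<phi>'(1) by (meson DERIV_isCont continuous_at_imp_continuous_on)
  then obtain \<phi>1 where \<phi>1: "\<And>x. (\<phi>1 has_real_derivative \<phi> x) (at x)" using real_antiderivative by metis
  then have "continuous_on UNIV \<phi>1" by (meson DERIV_isCont continuous_at_imp_continuous_on)
  then obtain \<phi>2 where \<phi>2: "\<And>x. (\<phi>2 has_real_derivative \<phi>1 x) (at x)" using real_antiderivative by metis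
  have holE: "E holomorphic_on UNIV" using assms(1) by (simp add: hermite_biehler_def entire_def)
  interpret hb_space \<phi> \<phi>' \<phi>1 \<phi>2 N C1 C2 E l
    by unfold_locales (fact \<phi>' \<phi>1 \<phi>2 C l holE assms(4))+
  have "comparable_to_1 m" unfolding comparable_to_1_def
  proof (intro exI conjI allI)
    show "0 < C1 / pi" "0 < C2 / pi" using C by auto
  qed (rule m_bounds)+
  then show ?thesis
    using mw.measp m_pos g_spec(1) de_branges_subset weighted_space_eq unfolding weighted_space_def weighted_sq_def
    by (intro exI[of _ m] exI[of _ g]) auto
qed

end
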